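(* For all $\vec{x}=(a,b,c,d,e,f,g)^T\in V$ (the coefficient of $K_{p_0}$ being extended by continuity where $\sin\pi(c-b)=0$) we have the relation $$\frac{\sin\pi(e-b)}{\sin\pi(c-b)}\Bigl[\sin\pi(f-c)\sin\pi(g-c)\sin\pi(e-a-c)\,\gamma(\sigma(12)(34)\vec{x})-\sin\pi(f-b)\sin\pi(g-b)\sin\pi(e-a-b)\,\gamma(\sigma(1342)\vec{x})\Bigr]K_{p_0}(\vec{x})$$ $$+\,\pi^6\sin\pi e\;\beta(\vec{x})\,\beta(\sigma(12)\vec{x})\,K_{n_4}(\vec{x})+\pi^3\,\gamma(\vec{x})\,\beta(\sigma^{-1}(12)\vec{x})\,K_{p_4}(\vec{x})=0,$$ where $\sigma:V\to V$ is the bijection $$\sigma\vec{x}=(1+b-e,\;b,\;f-c,\;g-c,\;1+a+b-e,\;1+b-c,\;1+b+d-e)^T,$$ and $\sigma(12)\vec{x}$ etc. means $\sigma$ applied to the permuted vector, with $(12)\vec{x}=(b,a,c,d,e,f,g)^T$, $(12)(34)\vec{x}=(b,a,d,c,e,f,g)^T$, $(1342)\vec{x}=(c,a,d,b,e,f,g)^T$. This is a $246$ relation, i.e. the triple $(p_0,n_4,p_4)$ has Hamming type $246$.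
   Context: Let $V=\{(a,b,c,d,e,f,g)^T\in\mathbb{C}^7 : e+f+g-a-b-c-d=1\}$. With $(u)_k=u(u+1)\cdots(u+k-1)$, $(u)_0=1$, and ${}_4F_3(a,b,c,d;e,f,g;1)=\sum_{k\ge0}\frac{(a)_k(b)_k(c)_k(d)_k}{k!\,(e)_k(f)_k(g)_k}$, define for $\vec{x}=(a,b,c,d,e,f,g)^T\in V$ $$K(\vec{x})=K(a;b,c,d;e,f,g)=\frac{{}_4F_3(a,b,c,d;e,f,g;1)}{\Gamma(e)\Gamma(f)\Gamma(g)\Gamma(1+a-e)\Gamma(1+a-f)\Gamma(1+a-g)}+\frac{{}_4F_3(a,1+a-e,1+a-f,1+a-g;1+a-b,1+a-c,1+a-d;1)}{\Gamma(1+a-b)\Gamma(1+a-c)\Gamma(1+a-d)\Gamma(b)\Gamma(c)\Gamma(d)},$$ where each ${}_4F_3(A,B,C,D;E,F,G;1)/(\Gamma(E)\Gamma(F)\Gamma(G))$ is read as $\sum_{k\ge0}\frac{(A)_k(B)_k(C)_k(D)_k}{k!\,\Gamma(k+E)\Gamma(k+F)\Gamma(k+G)}$, so $K$ is entire on $V$. Put $$\beta(\vec{x})=\frac{1}{\Gamma(a)\Gamma(1+b-e)\Gamma(f-c)\Gamma(f-d)\Gamma(g-c)\Gamma(g-d)},$$ $$\gamma(\vec{x})=\frac{\sin\pi(e-b)}{\sin\pi(c-b)}\Bigl[\sin\pi(a-c)\sin\pi(e-a-b)\sin\pi(f-b)\sin\pi(g-b)-\sin\pi(a-b)\sin\pi(e-a-c)\sin\pi(f-c)\sin\pi(g-c)\Bigr],$$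 with $\gamma$ extended by continuity across its removable singularities $c-b\in\mathbb{Z}$. The map $\sigma$ satisfies $\sigma^3=\mathrm{id}$, so $\sigma^{-1}=\sigma^2$. For an element $\mu$ of the group $M_K$ below, $K_\mu(\vec{x})=K(\mu\vec{x})$. The elements $p_0,n_4,p_4\in M_K$ act on $V$ by $p_0\vec{x}=\vec{x}$, $n_4\vec{x}=(e-a,e-b,e-c,e-d,1+e-f,1+e-g,e)^T$, $p_4\vec{x}=(1+a-e,1+b-e,1+c-e,1+d-e,1+f-e,1+g-e,2-e)^T$. Hamming type. Let $S\in GL(7,\mathbb{R})$ be the matrix with rows $(1,0,0,0,0,0,0)$, $(0,0,1,1,0,0,0)$, $(0,1,0,1,0,0,0)$, $(0,1,1,0,0,0,0)$, $(0,1,1,1,1,0,0)$, $(0,1,1,1,0,1,0)$, $(0,1,1,1,0,0,1)$; $P_{1,6}$ the group of $7\times7$ permutation matrices fixing the first coordinate; $G_K=SP_{1,6}S^{-1}$ (under which $K$ is invariant); $M_K\subset GL(7,\mathbb{R})$ the subgroup generated by $G_K$ and the permutation matrix $(12)$. For $1\le i<j\le6$, $\varepsilon=\pm1$, let $M_6^{\varepsilon}(i,j)$ be the $6\times6$ permutation matrix of the transposition $(i\,j)$ with its two off-diagonal $1$'s replaced by $\varepsilon$. There is a unique injective homomorphism $\theta:M_K\to GL(6,\mathbb{R})$ with $S(i,i+1)S^{-1}\mapsto M_6^{+}(i-1,i)$ for $2\le i\le6$ and $(12)\mapsto M_6^{-}(2,3)$. With $\omega_0=(1,1,1,1,1,1)^T$,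 the Hamming distance between $\mu,\nu\in M_K$ is the number of coordinates in which $\theta(\mu)^{-1}\omega_0$ and $\theta(\nu)^{-1}\omega_0$ differ (it depends only on the right cosets $G_K\mu,G_K\nu$). The Hamming type of a triple is the list of its three pairwise Hamming distances in nondecreasing order. *)

theory Defs
  imports "HOL-Analysis.Analysis" "HOL-Algebra.Generated_Groups"
begin

section \<open>The function \<open>K\<close> and the coefficient functions\<close>

definition VV :: "(complex^7) set" where
  "VV = {x. x$5 + x$6 + x$7 - x$1 - x$2 - x$3 - x$4 = 1}"

definition sinpi :: "complex \<Rightarrow> complex" where
  "sinpi z = sin (of_real pi * z)"

text \<open>The regularised series \<open>4F3(A,B,C,D;E,F,G;1) / (\<Gamma>(E) \<Gamma>(F) \<Gamma>(G))\<close>;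
  \<^const>\<open>rGamma\<close> is the entire function \<open>1/\<Gamma>\<close>. The series is only used where
  \<open>E + F + G - A - B - C - D = 1\<close>, and there it converges absolutely.\<close>

definition F43_reg ::
  "complex \<Rightarrow> complex \<Rightarrow> complex \<Rightarrow> complex \<Rightarrow> complex \<Rightarrow> complex \<Rightarrow> complex \<Rightarrow> complex" where
  "F43_reg A B C D E F G =
     (\<Sum>k. pochhammer A k * pochhammer B k * pochhammer C k * pochhammer D k / fact k
          * rGamma (of_nat k + E) * rGamma (of_nat k + F) * rGamma (of_nat k + G))"

definition KK :: "complex^7 \<Rightarrow> complex" where
  "KK x = (let a = x$1; b = x$2; c = x$3; d = x$4; e = x$5; f = x$6; g = x$7 in
     F43_reg a b c d e f g * rGamma (1 + a - e) * rGamma (1 + a - f) * rGamma (1 + a - g)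
   + F43_reg a (1 + a - e) (1 + a - f) (1 + a - g) (1 + a - b) (1 + a - c) (1 + a - d)
       * rGamma b * rGamma c * rGamma d)"

definition beta :: "complex^7 \<Rightarrow> complex" where
  "beta x = (let a = x$1; b = x$2; c = x$3; d = x$4; e = x$5; f = x$6; g = x$7 in
     rGamma a * rGamma (1 + b - e) * rGamma (f - c) * rGamma (f - d) * rGamma (g - c) * rGamma (g - d))"

definition VV_generic :: "(complex^7) set" where
  "VV_generic = {x \<in> VV. sinpi (x$3 - x$2) \<noteq> 0}"

text \<open>Extension by continuity to \<^const>\<open>VV\<close> of a function given on the dense subset
  \<^const>\<open>VV_generic\<close>.\<close>

definition continuous_extension :: "(complex^7 \<Rightarrow> complex) \<Rightarrow> complex^7 \<Rightarrow> complex" where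
  "continuous_extension h x =
     (if x \<in> VV_generic then h x else Lim (at x within VV_generic) h)"

definition gam :: "complex^7 \<Rightarrow> complex" where
  "gam = continuous_extension (\<lambda>x.
     let a = x$1; b = x$2; c = x$3; d = x$4; e = x$5; f = x$6; g = x$7 in
     sinpi (e - b) / sinpi (c - b)
     * (sinpi (a - c) * sinpi (e - a - b) * sinpi (f - b) * sinpi (g - b)
      - sinpi (a - b) * sinpi (e - a - c) * sinpi (f - c) * sinpi (g - c)))"

definition sigma_map :: "complex^7 \<Rightarrow> complex^7" where
  "sigma_map x = (let a = x$1; b = x$2; c = x$3; d = x$4; e = x$5; f = x$6; g = x$7 in
     vector [1 + b - e, b, f - c, g - c, 1 + a + b - e, 1 + b - c, 1 + b + d - e])"

definition sigma_map_inv :: "complex^7 \<Rightarrow> complex^7" where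
  "sigma_map_inv = inv_into VV sigma_map"

definition perm_12 :: "complex^7 \<Rightarrow> complex^7" where
  "perm_12 x = vector [x$2, x$1, x$3, x$4, x$5, x$6, x$7]"

definition perm_12_34 :: "complex^7 \<Rightarrow> complex^7" where
  "perm_12_34 x = vector [x$2, x$1, x$4, x$3, x$5, x$6, x$7]"

definition perm_1342 :: "complex^7 \<Rightarrow> complex^7" where
  "perm_1342 x = vector [x$3, x$1, x$4, x$2, x$5, x$6, x$7]"

definition coeff_p0 :: "complex^7 \<Rightarrow> complex" where
  "coeff_p0 = continuous_extension (\<lambda>x.
     let a = x$1; b = x$2; c = x$3; d = x$4; e = x$5; f = x$6; g = x$7 in
     sinpi (e - b) / sinpi (c - b)
     * (sinpi (f - c) * sinpi (g - c) * sinpi (e - a - c) * gam (sigma_map (perm_12_34 x))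
      - sinpi (f - b) * sinpi (g - b) * sinpi (e - a - b) * gam (sigma_map (perm_1342 x))))"


section \<open>The group \<open>M\<^sub>K\<close> and the Hamming type\<close>

definition GL :: "(real^'n^'n) monoid" where
  "GL = \<lparr>carrier = {A. invertible A}, mult = (**), one = mat 1\<rparr>"

definition perm_matrix :: "('n \<Rightarrow> 'n) \<Rightarrow> real^'n^'n" where
  "perm_matrix p = (\<chi> i j. if i = p j then 1 else 0)"

definition SS :: "real^7^7" where
  "SS = vector
    [vector [1,0,0,0,0,0,0],
     vector [0,0,1,1,0,0,0],
     vector [0,1,0,1,0,0,0],
     vector [0,1,1,0,0,0,0],
     vector [0,1,1,1,1,0,0],
     vector [0,1,1,1,0,1,0],
     vector [0,1,1,1,0,0,1]]"

definition P16 :: "(real^7^7) set" where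
  "P16 = {perm_matrix p | p. p permutes UNIV \<and> p 1 = 1}"

definition G_K :: "(real^7^7) set" where
  "G_K = (\<lambda>P. SS ** P ** matrix_inv SS) ` P16"

definition M_K :: "(real^7^7) set" where
  "M_K = generate GL (G_K \<union> {perm_matrix (Transposition.transpose 1 2)})"

definition M6 :: "real \<Rightarrow> 6 \<Rightarrow> 6 \<Rightarrow> real^6^6" where
  "M6 \<epsilon> i j = (\<chi> r s. if r \<noteq> s \<and> {r, s} = {i, j} then \<epsilon>
                       else perm_matrix (Transposition.transpose i j) $ r $ s)"

text \<open>An injective homomorphism as below is determined on \<^const>\<open>M_K\<close> only; extensionality
  pins it down outside. The index \<open>k = i - 1\<close> runs through \<open>1,\<dots>,5\<close>.\<close>

definition theta :: "real^7^7 \<Rightarrow> real^6^6" where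
  "theta = (THE h. h \<in> extensional M_K \<and> h \<in> mon (GL\<lparr>carrier := M_K\<rparr>) GL
     \<and> (\<forall>k\<in>{1..5::nat}. h (SS ** perm_matrix (Transposition.transpose (of_nat (k + 1)) (of_nat (k + 2))) ** matrix_inv SS)
                        = M6 1 (of_nat k) (of_nat (k + 1)))
     \<and> h (perm_matrix (Transposition.transpose 1 2)) = M6 (-1) 2 3)"

definition omega0 :: "real^6" where
  "omega0 = (\<chi> i. 1)"

definition hamming_dist :: "real^7^7 \<Rightarrow> real^7^7 \<Rightarrow> nat" where
  "hamming_dist \<mu> \<nu> =
     card {i. (matrix_inv (theta \<mu>) *v omega0) $ i \<noteq> (matrix_inv (theta \<nu>) *v omega0) $ i}"

definition hamming_type :: "real^7^7 \<Rightarrow> real^7^7 \<Rightarrow> real^7^7 \<Rightarrow> nat list" where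
  "hamming_type \<mu> \<nu> \<rho> = sort [hamming_dist \<mu> \<nu>, hamming_dist \<mu> \<rho>, hamming_dist \<nu> \<rho>]"


section \<open>The action on \<open>V\<close> and the three group elements\<close>

definition act :: "real^7^7 \<Rightarrow> complex^7 \<Rightarrow> complex^7" where
  "act \<mu> x = map_matrix complex_of_real \<mu> *v x"

definition K_at :: "real^7^7 \<Rightarrow> complex^7 \<Rightarrow> complex" where
  "K_at \<mu> x = KK (act \<mu> x)"

text \<open>The matrices are obtained from the affine formulas on \<open>V\<close> (see \<open>act_p0\<close>, \<open>act_n4\<close> and
  \<open>act_p4\<close> below) by replacing the constant 1 by the linear form
  \<open>u = e + f + g - a - b - c - d\<close>. As \<open>V\<close> spans the whole space, a matrix is determined by its
  action on \<open>V\<close>.\<close>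

definition p0 :: "real^7^7" where
  "p0 = mat 1"

definition n4 :: "real^7^7" where
  "n4 = matrix (\<lambda>x. let a = x$1; b = x$2; c = x$3; d = x$4; e = x$5; f = x$6; g = x$7;
                        u = e + f + g - a - b - c - d in
     vector [e - a, e - b, e - c, e - d, u + e - f, u + e - g, e])"

definition p4 :: "real^7^7" where
  "p4 = matrix (\<lambda>x. let a = x$1; b = x$2; c = x$3; d = x$4; e = x$5; f = x$6; g = x$7;
                        u = e + f + g - a - b - c - d in
     vector [u + a - e, u + b - e, u + c - e, u + d - e, u + f - e, u + g - e, 2 * u - e])"

lemma vector_7_nth [simp]:
  "(vector [a,b,c,d,e,f,g] :: 'a::zero^7) $ 1 = a"
  "(vector [a,b,c,d,e,f,g] :: 'a::zero^7) $ 2 = b"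
  "(vector [a,b,c,d,e,f,g] :: 'a::zero^7) $ 3 = c"
  "(vector [a,b,c,d,e,f,g] :: 'a::zero^7) $ 4 = d"
  "(vector [a,b,c,d,e,f,g] :: 'a::zero^7) $ 5 = e"
  "(vector [a,b,c,d,e,f,g] :: 'a::zero^7) $ 6 = f"
  "(vector [a,b,c,d,e,f,g] :: 'a::zero^7) $ 7 = g"
  unfolding vector_def by simp_all

lemma exhaust_7: "(x::7) = 1 \<or> x = 2 \<or> x = 3 \<or> x = 4 \<or> x = 5 \<or> x = 6 \<or> x = 7"
proof (induct x)
  case (of_int z)
  then have "0 \<le> z" and "z < 7" by simp_all
  then have "z = 0 \<or> z = 1 \<or> z = 2 \<or> z = 3 \<or> z = 4 \<or> z = 5 \<or> z = 6" by arith
  then show ?case by auto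
qed

lemma UNIV_7: "(UNIV :: 7 set) = {1, 2, 3, 4, 5, 6, 7}"
  using exhaust_7 by auto

lemma vec_eq_7_iff:
  "(x :: 'a^7) = y \<longleftrightarrow> x$1 = y$1 \<and> x$2 = y$2 \<and> x$3 = y$3 \<and> x$4 = y$4 \<and> x$5 = y$5 \<and> x$6 = y$6 \<and> x$7 = y$7"
proof -
  have "x = y \<longleftrightarrow> (\<forall>i\<in>UNIV. x$i = y$i)"
    by (simp only: vec_eq_iff ball_UNIV)
  also have "\<dots> \<longleftrightarrow> (\<forall>i\<in>{1,2,3,4,5,6,7}. x$i = y$i)"
    by (simp only: UNIV_7)
  finally show ?thesis
    by (simp only: ball_simps simp_thms)
qed

lemma sum_7: "(\<Sum>i\<in>UNIV. h (i::7)) = h 1 + h 2 + h 3 + h 4 + h 5 + h 6 + h 7"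
  unfolding UNIV_7 by (simp add: ac_simps)

lemma act_p0: "act p0 x = x"
  by (simp add: act_def p0_def vec_eq_7_iff matrix_vector_mult_def mat_def sum_7)

lemma act_n4:
  assumes "x \<in> VV"
  shows "act n4 x = vector [x$5 - x$1, x$5 - x$2, x$5 - x$3, x$5 - x$4,
                            1 + x$5 - x$6, 1 + x$5 - x$7, x$5]"
  using assms
  by (simp add: act_def n4_def VV_def vec_eq_7_iff matrix_vector_mult_def matrix_def sum_7
      axis_def Let_def, simp add: algebra_simps)

lemma act_p4:
  assumes "x \<in> VV"
  shows "act p4 x = vector [1 + x$1 - x$5, 1 + x$2 - x$5, 1 + x$3 - x$5, 1 + x$4 - x$5,
                            1 + x$6 - x$5, 1 + x$7 - x$5, 2 - x$5]"
proof -
  have u: "x$7 = 1 + x$1 + x$2 + x$3 + x$4 - x$5 - x$6"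
    using assms by (simp add: VV_def algebra_simps)
  show ?thesis
    by (simp add: act_def p4_def vec_eq_7_iff matrix_vector_mult_def matrix_def sum_7
        axis_def Let_def u)
qed

lemma sigma_map_in_VV: "x \<in> VV \<Longrightarrow> sigma_map x \<in> VV"
  by (simp add: VV_def sigma_map_def Let_def algebra_simps)

lemma sigma_map_cubed:
  assumes "x \<in> VV"
  shows "sigma_map (sigma_map (sigma_map x)) = x"
proof -
  have u: "x$7 = 1 + x$1 + x$2 + x$3 + x$4 - x$5 - x$6"
    using assms by (simp add: VV_def algebra_simps)
  show ?thesis
    by (simp add: sigma_map_def Let_def vec_eq_7_iff u)
qed

lemma sigma_map_inv_eq:
  assumes "x \<in> VV"
  shows "sigma_map_inv x = sigma_map (sigma_map x)"
  unfolding sigma_map_inv_def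
proof (rule inv_into_f_eq)
  show "inj_on sigma_map VV"
    by (rule inj_on_inverseI[where g = "\<lambda>x. sigma_map (sigma_map x)"]) (rule sigma_map_cubed)
qed (use assms in \<open>simp_all add: sigma_map_in_VV sigma_map_cubed\<close>)

end

theory Submission
  imports Defs "HOL-Complex_Analysis.Conformal_Mappings" "HOL-Real_Asymp.Real_Asymp"
begin

text \<open>
  Put \<open>\<rho> = b + c - e\<close>. For suitable real parameters, \<open>sin \<pi>\<rho> K(a;b,c,d;e,f,g)\<close> is up to Gamma factors the integral over
  \<open>(0, 1)\<close> of a combination of two functions \<open>P\<close> and \<open>Q\<close>, each a power of \<open>t\<close> times a product of two \<open>2F1(1 - t)\<close>: both
  \<open>4F3\<close> series in \<open>K\<close> are integrals of products of a \<open>2F1(t)\<close> and a \<open>2F1(1 - t)\<close>, and when the \<open>2F1(t)\<close> are expanded by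
  the connection formula the two mixed terms cancel. By Euler's transformation \<open>P\<close> and \<open>Q\<close> are unchanged when \<open>a\<close> and
  \<open>d\<close> are exchanged and when \<open>p4\<close> is applied, so three values of \<open>K\<close> are combinations of the two integrals of \<open>P\<close> and \<open>Q\<close>,
  which gives a linear relation. Exchanging \<open>P\<close> and \<open>Q\<close> yields the invariance of \<open>K\<close> under the substitution
  \<open>(b, c, f, g) \<mapsto> (e - c, e - b, 1 + a + d - g, 1 + a + d - f)\<close> from \<open>G_K\<close>.

  Eliminating \<open>K(d;b,c,a;e,f,g)\<close> from the three-term relation at \<open>x\<close> and from its image under an element of \<open>M_K\<close> leaves
  \<open>K_p0\<close>, \<open>K_n4\<close> and \<open>K_p4\<close>; the coefficients agree with the asserted ones by trigonometric identities. The left-hand side is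
  entire in the coordinates \<open>t1, \<dots>, t6\<close> of \<open>VV\<close>, so the relation extends from small real \<open>t\<close> to all of \<open>VV\<close>.
\<close>

subsection \<open>Regularised Gauss hypergeometric functions\<close>

text \<open>The coordinates \<open>t1\<close>, ..., \<open>t6\<close> shape the argument. Elements
  of \<open>M_K\<close> act on them by signed permutations, so the region |t1| + ... + |t6| < 1 is
  stable under the group, and on it every parameter whose positivity the integrals need is positive.
  All image points used are therefore admissible for one and the same reason, and nonnegative
  integrands allow series and integrals to be exchanged by monotone convergence.

  In these coordinates \<rho> = t4 - t3. It is unchanged by the exchange of \<open>a\<close> and
  \<open>d\<close> and by \<open>p4\<close>, which explains why three values of \<open>K\<close>
  share the same pair of kernels. The substitution from \<open>G_K\<close> is the transposition of
  \<open>t3\<close> and \<open>t4\<close>, the only adjacent transposition that is not a visible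
  permutation of \<open>b, c, d\<close> or of \<open>e, f, g\<close>.

  The divisions by sin pi\<rho> and by sin pi(a - d) exclude t3 = t4, t5 = t6 and t1 + t2 = 0; a
  small box avoiding these suffices for the continuation. The separate obstacle is the denominator
  sin pi(c - b): gamma and the coefficient of \<open>K_p0\<close> must first be rewritten as entire
  functions.\<close>

lemma rGamma_reflection_real: "rGamma (z::real) * rGamma (1 - z) = sin (pi * z) / pi"
proof -
  have "complex_of_real (rGamma z * rGamma (1 - z)) = rGamma (of_real z) * rGamma (1 - of_real z)"
    using rGamma_complex_of_real[of z] rGamma_complex_of_real[of "1 - z"] by simp
  also have "\<dots> = sin (of_real (pi * z)) / of_real pi"
    by (simp add: rGamma_reflection_complex)
  also have "\<dots> = of_real (sin (pi * z) / pi)"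
    by (simp only: sin_of_real of_real_divide)
  finally show ?thesis by (simp only: of_real_eq_iff)
qed

lemma rGamma_pos: "0 < (z::real) \<Longrightarrow> 0 < rGamma z"
  using Gamma_real_pos[of z] by (simp add: rGamma_inverse_Gamma)

lemma Gamma_rGamma: "0 < (z::real) \<Longrightarrow> Gamma z * rGamma z = 1"
  using Gamma_real_pos[of z] by (simp add: rGamma_inverse_Gamma del: Gamma_real_pos)

lemma pochhammer_rGamma: "0 < (z::real) \<Longrightarrow> pochhammer z n = Gamma (z + of_nat n) * rGamma z"
  by (subst pochhammer_Gamma) (auto simp: rGamma_inverse_Gamma divide_inverse dest: nonpos_Ints_nonpos)

text \<open>Multiplying by \<open>rGamma (c + n)\<close> instead of dividing by the Pochhammer
  symbol of \<open>c\<close> keeps the coefficients defined for every real \<open>c\<close>,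
  including the poles of \<open>2F1\<close>.\<close>

definition hcoeff where
  "hcoeff a b c n = pochhammer a n * pochhammer b n / fact n * rGamma (c + of_nat n)"
  for a :: real

text \<open>The function \<open>2F1(a,b;c;z) / \<Gamma>(c)\<close>.\<close>

definition F21 where
  "F21 a b c z = (\<Sum>n. hcoeff a b c n * z ^ n)"
  for a :: real

lemma hcoeff_commute: "hcoeff a b c = hcoeff b a c"
  by (simp add: hcoeff_def fun_eq_iff)

lemma F21_commute: "F21 a b c = F21 b a c"
  by (simp add: F21_def fun_eq_iff hcoeff_commute[of a b])

lemma hcoeff_Suc: "(real n + 1) * (c + real n) * hcoeff a b c (Suc n) = (a + real n) * (b + real n) * hcoeff a b c n"
proof -
  have alg: "m * Z * (P * X * (Q * Y) / (m * F) * R) = X * Y * (P * Q / F * (Z * R))"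
    if "m \<noteq> 0" "F \<noteq> 0" for m P Q F R X Y Z :: real
    using that by (simp add: field_simps)
  have R: "rGamma (c + real n) = (c + real n) * rGamma (c + real n + 1)"
    by (simp add: rGamma_plus1)
  have S: "c + real (Suc n) = c + real n + 1" and F: "fact (Suc n) = (real n + 1) * fact n" by simp_all
  show ?thesis
    unfolding hcoeff_def pochhammer_Suc R S F by (rule alg) (simp_all add: add_eq_0_iff2)
qed

lemma hcoeff_0: "hcoeff a b c 0 = rGamma c"
  by (simp add: hcoeff_def)

lemma hcoeff_pos: "0 < a \<Longrightarrow> 0 < b \<Longrightarrow> 0 < c \<Longrightarrow> 0 < hcoeff a b c n"
  unfolding hcoeff_def by (intro mult_pos_pos divide_pos_pos pochhammer_pos rGamma_pos add_pos_nonneg) simp_all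

text \<open>The ratio of consecutive coefficients tends to 1. It is formed only from the index on
  where c + n > 0, so the parameters are unrestricted.\<close>

lemma summable_hcoeff:
  assumes "\<bar>z\<bar> < 1" shows "summable (\<lambda>n. hcoeff a b c n * z ^ n)"
proof -
  obtain r where r: "\<bar>z\<bar> < r" "r < 1" using assms dense by blast
  have "((\<lambda>n. \<bar>(a + real n) * (b + real n) / ((real n + 1) * (c + real n))\<bar> * \<bar>z\<bar>) \<longlongrightarrow> \<bar>1\<bar> * \<bar>z\<bar>) sequentially"
    by (intro tendsto_intros) real_asymp
  hence "eventually (\<lambda>n. \<bar>(a + real n) * (b + real n) / ((real n + 1) * (c + real n))\<bar> * \<bar>z\<bar> < r) sequentially"
    using r(1) by (intro order_tendstoD) simp_all
  moreover have "eventually (\<lambda>n. c + real n > 0) sequentially"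
    by real_asymp
  ultimately have "eventually (\<lambda>n. norm (hcoeff a b c (Suc n) * z ^ Suc n) \<le> r * norm (hcoeff a b c n * z ^ n)) sequentially"
  proof eventually_elim
    case (elim n)
    define q where "q = (a + real n) * (b + real n) / ((real n + 1) * (c + real n))"
    have "hcoeff a b c (Suc n) = q * hcoeff a b c n"
      unfolding q_def times_divide_eq_left
      by (rule eq_divide_imp) (use hcoeff_Suc[of n c a b] elim(2) in \<open>simp_all add: mult_ac\<close>)
    hence "norm (hcoeff a b c (Suc n) * z ^ Suc n) = (\<bar>q\<bar> * \<bar>z\<bar>) * norm (hcoeff a b c n * z ^ n)"
      by (simp add: abs_mult power_abs)
    also have "\<dots> \<le> r * norm (hcoeff a b c n * z ^ n)"
      using elim(1) by (intro mult_right_mono) (auto simp: q_def)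
    finally show ?case .
  qed
  then obtain N where "\<And>n. n \<ge> N \<Longrightarrow> norm (hcoeff a b c (Suc n) * z ^ Suc n) \<le> r * norm (hcoeff a b c n * z ^ n)"
    by (auto simp: eventually_sequentially)
  thus ?thesis using r(2) by (intro summable_ratio_test[of r N]) auto
qed

lemma diffs_hcoeff: "diffs (hcoeff a b c) = (\<lambda>n. a * b * hcoeff (a + 1) (b + 1) (c + 1) n)"
proof
  fix n
  have alg: "m * (a * P * (b * Q) / (m * F) * R) = a * b * (P * Q / F * R)"
    if "m \<noteq> 0" "F \<noteq> 0" for m P Q F R :: real
    using that by (simp add: field_simps)
  have S: "c + real (Suc n) = c + 1 + real n" and F: "fact (Suc n) = (real n + 1) * fact n"
    and T: "real (Suc n) = real n + 1" by simp_all
  show "diffs (hcoeff a b c) n = a * b * hcoeff (a + 1) (b + 1) (c + 1) n"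
    unfolding diffs_def hcoeff_def pochhammer_rec S F unfolding T by (rule alg) (simp_all add: add_eq_0_iff2)
qed

lemma F21_deriv:
  assumes "\<bar>z\<bar> < 1"
  shows "(F21 a b c has_real_derivative a * b * F21 (a + 1) (b + 1) (c + 1) z) (at z)"
proof -
  have "((\<lambda>z. \<Sum>n. hcoeff a b c n * z ^ n) has_real_derivative (\<Sum>n. diffs (hcoeff a b c) n * z ^ n)) (at z)"
    by (rule termdiffs_strong'[where K = 1]) (use assms summable_hcoeff in auto)
  also have "(\<Sum>n. diffs (hcoeff a b c) n * z ^ n) = a * b * F21 (a + 1) (b + 1) (c + 1) z"
    unfolding diffs_hcoeff F21_def
    using suminf_mult[OF summable_hcoeff[OF assms, of "a+1" "b+1" "c+1"], of "a * b"] by (simp add: mult.assoc)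
  finally show ?thesis by (simp add: F21_def[abs_def])
qed

text \<open>Coefficient form of the Euler operator z d/dz: \<open>diffs g\<close> belongs to the
  derivative, and multiplication by z shifts it back.\<close>

lemma sums_diffs_shift:
  fixes g :: "nat \<Rightarrow> real"
  assumes "(\<lambda>n. diffs g n * z ^ n) sums s"
  shows "(\<lambda>n. n * g n * z ^ n) sums (z * s)"
proof -
  have "(\<lambda>n. of_nat n * g n * z ^ (n - Suc 0)) sums s"
    using diffs_equiv[OF sums_summable[OF assms]] sums_unique[OF assms] by simp
  from sums_mult[OF this, of z] show ?thesis
    by (rule back_subst[where P = "\<lambda>f. f sums _"]) (auto simp: fun_eq_iff power_eq_if mult_ac)
qed

text \<open>The differential equation is the recurrence \<open>hcoeff_Suc\<close> read as an
  identity of power series.\<close>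

lemma F21_ode:
  assumes "\<bar>z\<bar> < 1"
  shows "z * (1 - z) * (a * b * ((a + 1) * (b + 1) * F21 (a + 2) (b + 2) (c + 2) z))
         + (c - (a + b + 1) * z) * (a * b * F21 (a + 1) (b + 1) (c + 1) z) - a * b * F21 a b c z = 0"
proof -
  define h where "h = hcoeff a b c"
  define y0 y1 y2 where "y0 = F21 a b c z" and "y1 = a * b * F21 (a + 1) (b + 1) (c + 1) z"
    and "y2 = a * b * ((a + 1) * (b + 1) * F21 (a + 2) (b + 2) (c + 2) z)"
  have FFs: "(\<lambda>n. hcoeff a b c n * z ^ n) sums F21 a b c z" for a b c
    using summable_hcoeff[OF assms] by (simp add: F21_def summable_sums)
  have 0: "(\<lambda>n. h n * z ^ n) sums y0"
    unfolding h_def y0_def by (rule FFs)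
  have 1: "(\<lambda>n. diffs h n * z ^ n) sums y1"
    unfolding h_def diffs_hcoeff y1_def using sums_mult[OF FFs, of "a * b"] by (simp add: mult.assoc)
  have "diffs (diffs h) = (\<lambda>n. a * b * ((a + 1) * (b + 1) * hcoeff (a + 2) (b + 2) (c + 2) n))"
  proof -
    have "diffs (diffs h) = (\<lambda>n. a * b * diffs (hcoeff (a + 1) (b + 1) (c + 1)) n)"
      unfolding h_def diffs_hcoeff[of a b c] by (simp add: diffs_def fun_eq_iff mult_ac)
    thus ?thesis unfolding diffs_hcoeff by (simp add: add.assoc)
  qed
  hence 2: "(\<lambda>n. diffs (diffs h) n * z ^ n) sums y2"
    unfolding y2_def using sums_mult[OF FFs, of "a * b * ((a + 1) * (b + 1))"] by (simp add: mult.assoc)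
  note 3 = sums_diffs_shift[OF 1]
  note 4 = sums_diffs_shift[OF 2]
  \<comment> \<open>The sequence (n - 1) h(n) has \<open>diffs\<close> equal to n times
    \<open>diffs h\<close>, the coefficients of z y''. One further shift then produces z^2
    y''.\<close>
  have "(\<lambda>n. diffs (\<lambda>n. (real n - 1) * h n) n * z ^ n) sums (z * y2)"
    by (rule back_subst[where P = "\<lambda>f. f sums _", OF 4]) (auto simp: fun_eq_iff diffs_def)
  note 5 = sums_diffs_shift[OF this]
  have "(\<lambda>n. n * diffs h n * z ^ n - n * ((real n - 1) * h n) * z ^ n + c * (diffs h n * z ^ n)
           - (a + b + 1) * (n * h n * z ^ n) - a * b * (h n * z ^ n)) sums
        (z * y2 - z * (z * y2) + c * y1 - (a + b + 1) * (z * y1) - a * b * y0)"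
    by (intro sums_diff sums_add sums_mult 0 1 3 4 5)
  moreover have "n * diffs h n * z ^ n - n * ((real n - 1) * h n) * z ^ n + c * (diffs h n * z ^ n)
           - (a + b + 1) * (n * h n * z ^ n) - a * b * (h n * z ^ n) = 0" for n
  proof -
    have "n * diffs h n - n * ((real n - 1) * h n) + c * diffs h n - (a + b + 1) * (n * h n) - a * b * h n
       = (real n + 1) * (c + n) * h (Suc n) - (a + n) * (b + n) * h n"
      by (simp add: diffs_def algebra_simps)
    also have "\<dots> = 0" by (simp add: h_def hcoeff_Suc)
    finally have "(n * diffs h n - n * ((real n - 1) * h n) + c * diffs h n - (a + b + 1) * (n * h n) - a * b * h n) * z ^ n = 0"
      by simp
    thus ?thesis by (simp add: algebra_simps)
  qed
  ultimately have "(\<lambda>n. 0) sums (z * y2 - z * (z * y2) + c * y1 - (a + b + 1) * (z * y1) - a * b * y0)"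
    by simp
  hence "z * y2 - z * (z * y2) + c * y1 - (a + b + 1) * (z * y1) - a * b * y0 = 0"
    using sums_unique2 sums_zero by blast
  thus ?thesis unfolding y0_def[symmetric] y1_def[symmetric] y2_def[symmetric] by (simp add: algebra_simps)
qed

section \<open>Solutions of the hypergeometric equation on (0, 1) and their Wronskians\<close>

definition hyp_sol :: "real \<Rightarrow> real \<Rightarrow> real \<Rightarrow> (real \<Rightarrow> real) \<Rightarrow> (real \<Rightarrow> real) \<Rightarrow> (real \<Rightarrow> real) \<Rightarrow> bool" where
  "hyp_sol a b c y y1 y2 \<longleftrightarrow> (\<forall>z\<in>{0<..<1}. (y has_real_derivative y1 z) (at z) \<and>
      (y1 has_real_derivative y2 z) (at z) \<and>
      z * (1 - z) * y2 z + (c - (a + b + 1) * z) * y1 z - a * b * y z = 0)"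

lemma hyp_sol_FF:
  "hyp_sol a b c (F21 a b c) (\<lambda>z. a * b * F21 (a + 1) (b + 1) (c + 1) z)
     (\<lambda>z. a * b * ((a + 1) * (b + 1) * F21 (a + 2) (b + 2) (c + 2) z))"
  unfolding hyp_sol_def
proof (intro ballI conjI, goal_cases)
  case (1 z)
  thus ?case by (intro F21_deriv) auto
next
  case (2 z)
  thus ?case using F21_deriv[of z "a+1" "b+1" "c+1"] by (intro DERIV_cmult) (auto simp: add.assoc)
next
  case (3 z)
  thus ?case by (intro F21_ode) auto
qed

text \<open>Replacing z by 1 - z exchanges the singular points 0 and 1 and with them
  \<open>c\<close> and \<open>a + b + 1 - c\<close>.\<close>

lemma hyp_sol_reflect:
  assumes "hyp_sol a b c' y y1 y2" and "c' = a + b + 1 - c"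
  shows "hyp_sol a b c (\<lambda>z. y (1 - z)) (\<lambda>z. - y1 (1 - z)) (\<lambda>z. y2 (1 - z))"
  unfolding hyp_sol_def
proof (intro ballI, goal_cases)
  case (1 z)
  hence "1 - z \<in> {0<..<1}" by auto
  with assms(1) have *: "(y has_real_derivative y1 (1 - z)) (at (1 - z))"
    "(y1 has_real_derivative y2 (1 - z)) (at (1 - z))"
    "(1 - z) * (1 - (1 - z)) * y2 (1 - z) + (c' - (a + b + 1) * (1 - z)) * y1 (1 - z) - a * b * y (1 - z) = 0"
    unfolding hyp_sol_def by blast+
  have d: "((\<lambda>z. f (1 - z)) has_real_derivative - f') (at z)" if "(f has_real_derivative f') (at (1 - z))" for f f'
  proof -
    have "((\<lambda>z. f (1 - z)) has_real_derivative f' * (- 1)) (at z)"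
      by (rule DERIV_chain2[where g = "\<lambda>z. 1 - z", OF that]) (auto intro!: derivative_eq_intros)
    thus ?thesis by simp
  qed
  have "z * (1 - z) * y2 (1 - z) + (c - (a + b + 1) * z) * - y1 (1 - z) - a * b * y (1 - z) = 0"
    using *(3) unfolding assms(2) by (simp add: algebra_simps)
  thus ?case
    using d[OF *(1)] DERIV_minus[OF d[OF *(2)]] by simp
qed

text \<open>With parameters \<open>c - a\<close>, \<open>c - b\<close>, \<open>c\<close> the
  exponents at 1 are 0 and -d. Multiplication by (1 - z)^d turns them into d and 0, the exponents of
  the equation with parameters \<open>a\<close>, \<open>b\<close>, \<open>c\<close>.\<close>

lemma hyp_sol_mult:
  assumes "hyp_sol (c - a) (c - b) c y y1 y2" and "d = c - a - b"
  shows "hyp_sol a b c (\<lambda>z. (1 - z) powr d * y z)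
     (\<lambda>z. (1 - z) powr d * y1 z - d * (1 - z) powr (d - 1) * y z)
     (\<lambda>z. (1 - z) powr d * y2 z - 2 * d * (1 - z) powr (d - 1) * y1 z + d * (d - 1) * (1 - z) powr (d - 2) * y z)"
  unfolding hyp_sol_def
proof (intro ballI, goal_cases)
  case z: (1 z)
  with assms(1) have *: "(y has_real_derivative y1 z) (at z)"
    "(y1 has_real_derivative y2 z) (at z)"
    "z * (1 - z) * y2 z + (c - (c - a + (c - b) + 1) * z) * y1 z - (c - a) * (c - b) * y z = 0"
    unfolding hyp_sol_def by blast+
  define u where "u = (1 - z) powr (d - 2)"
  have u1: "(1 - z) powr (d - 1) = u * (1 - z)" "(1 - z) powr d = u * (1 - z)\<^sup>2"
    using z powr_add[of "1 - z" "d - 2" 1] powr_add[of "1 - z" "d - 2" 2]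
    by (auto simp: u_def powr_numeral)
  have p: "((\<lambda>z. (1 - z) powr r) has_real_derivative - r * (1 - z) powr (r - 1)) (at z)" for r
    using z by (auto intro!: derivative_eq_intros)
  have e: "z * (1 - z) * (u * (1 - z)\<^sup>2 * y2 z - 2 * d * (u * (1 - z)) * y1 z + d * (d - 1) * u * y z)
      + (c - (a + b + 1) * z) * (u * (1 - z)\<^sup>2 * y1 z - d * (u * (1 - z)) * y z) - a * b * (u * (1 - z)\<^sup>2 * y z)
     = u * (1 - z)\<^sup>2 * (z * (1 - z) * y2 z + (c - (c - a + (c - b) + 1) * z) * y1 z - (c - a) * (c - b) * y z)"
    unfolding assms(2) by (simp add: algebra_simps power2_eq_square)
  have 1: "((\<lambda>z. (1 - z) powr d * y z) has_real_derivative (1 - z) powr d * y1 z - d * (1 - z) powr (d - 1) * y z) (at z)"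
    by (rule DERIV_cong[OF DERIV_mult[OF p *(1)]]) simp
  have 2: "((\<lambda>z. (1 - z) powr d * y1 z - d * (1 - z) powr (d - 1) * y z) has_real_derivative
          (1 - z) powr d * y2 z - 2 * d * (1 - z) powr (d - 1) * y1 z + d * (d - 1) * (1 - z) powr (d - 2) * y z) (at z)"
    unfolding mult.assoc[of d "(1 - _) powr (d - 1)" "y _"]
    by (rule DERIV_cong[OF DERIV_diff[OF DERIV_mult[OF p *(2)] DERIV_cmult[OF DERIV_mult[OF p *(1)]]]])
       (simp add: algebra_simps)
  have 3: "z * (1 - z) * ((1 - z) powr d * y2 z - 2 * d * (1 - z) powr (d - 1) * y1 z + d * (d - 1) * (1 - z) powr (d - 2) * y z) +
        (c - (a + b + 1) * z) * ((1 - z) powr d * y1 z - d * (1 - z) powr (d - 1) * y z) - a * b * ((1 - z) powr d * y z) = 0"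
    using e *(3) by (simp add: u1 u_def[symmetric] mult.assoc)
  show ?case
    using 1 2 3 by blast
qed

text \<open>The weight is the integrating factor from Abel's identity, so the product is constant
  for two solutions.\<close>

definition wronskian :: "real \<Rightarrow> real \<Rightarrow> real \<Rightarrow> (real \<Rightarrow> real) \<Rightarrow> (real \<Rightarrow> real) \<Rightarrow> (real \<Rightarrow> real) \<Rightarrow> (real \<Rightarrow> real) \<Rightarrow> real \<Rightarrow> real" where
  "wronskian a b c y y1 Y Y1 z = z powr c * (1 - z) powr (a + b + 1 - c) * (y z * Y1 z - Y z * y1 z)"

lemma wronskian_const:
  assumes "hyp_sol a b c y y1 y2" "hyp_sol a b c Y Y1 Y2"
  shows "\<exists>k. \<forall>z\<in>{0<..<1}. wronskian a b c y y1 Y Y1 z = k"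
proof (rule has_field_derivative_zero_constant)
  fix z :: real assume z: "z \<in> {0<..<1}"
  from z assms have *: "(y has_real_derivative y1 z) (at z)" "(y1 has_real_derivative y2 z) (at z)"
    "z * (1 - z) * y2 z + (c - (a + b + 1) * z) * y1 z - a * b * y z = 0"
    "(Y has_real_derivative Y1 z) (at z)" "(Y1 has_real_derivative Y2 z) (at z)"
    "z * (1 - z) * Y2 z + (c - (a + b + 1) * z) * Y1 z - a * b * Y z = 0"
    unfolding hyp_sol_def by blast+
  define m where "m = a + b + 1 - c"
  define u v where "u = z powr (c - 1)" and "v = (1 - z) powr (m - 1)"
  have u: "z powr c = u * z" and v: "(1 - z) powr m = v * (1 - z)"
    using z powr_add[of z "c - 1" 1] powr_add[of "1 - z" "m - 1" 1] by (auto simp: u_def v_def)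
  have pu: "((\<lambda>z. z powr c) has_real_derivative c * u) (at z)"
    using z by (auto intro!: derivative_eq_intros simp: u_def)
  have pv: "((\<lambda>z. (1 - z) powr m) has_real_derivative - m * v) (at z)"
    using z by (auto intro!: derivative_eq_intros simp: v_def)
  have pw: "((\<lambda>z. y z * Y1 z - Y z * y1 z) has_real_derivative y z * Y2 z - Y z * y2 z) (at z)"
    by (rule DERIV_cong[OF DERIV_diff[OF DERIV_mult[OF *(1) *(5)] DERIV_mult[OF *(4) *(2)]]]) simp
  have "((\<lambda>z. z powr c * (1 - z) powr m * (y z * Y1 z - Y z * y1 z)) has_real_derivative
     (c * u * (v * (1 - z)) - m * v * (u * z)) * (y z * Y1 z - Y z * y1 z) + u * z * (v * (1 - z)) * (y z * Y2 z - Y z * y2 z)) (at z)"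
    by (rule DERIV_cong[OF DERIV_mult[OF DERIV_mult[OF pu pv] pw]]) (simp add: u v)
  also have "(c * u * (v * (1 - z)) - m * v * (u * z)) * (y z * Y1 z - Y z * y1 z) + u * z * (v * (1 - z)) * (y z * Y2 z - Y z * y2 z)
    = u * v * (y z * (z * (1 - z) * Y2 z + (c - (a + b + 1) * z) * Y1 z - a * b * Y z)
       - Y z * (z * (1 - z) * y2 z + (c - (a + b + 1) * z) * y1 z - a * b * y z))"
    unfolding m_def by (simp add: algebra_simps)
  also have "\<dots> = 0" using * by simp
  finally show "(wronskian a b c y y1 Y Y1 has_field_derivative 0) (at z within {0<..<1})"
    unfolding wronskian_def[abs_def] m_def by (rule has_field_derivative_at_within)
qed auto

text \<open>The constant is read off at an end of the interval: \<open>F\<close> will be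
  \<open>at_right 0\<close> or \<open>at_left 1\<close>. Connection coefficients thereby become
  limits.\<close>

lemma wronskian_eq:
  assumes "hyp_sol a b c y y1 y2" "hyp_sol a b c Y Y1 Y2" "(wronskian a b c y y1 Y Y1 \<longlongrightarrow> L) F" "F \<noteq> bot"
    and F: "eventually (\<lambda>z. z \<in> {0<..<1}) F" and z: "z \<in> {0<..<1}"
  shows "wronskian a b c y y1 Y Y1 z = L"
proof -
  obtain k where k: "\<forall>z\<in>{0<..<1}. wronskian a b c y y1 Y Y1 z = k" using wronskian_const[OF assms(1,2)] by blast
  from F have "eventually (\<lambda>z. k = wronskian a b c y y1 Y Y1 z) F"
    by eventually_elim (use k in auto)
  hence "(wronskian a b c y y1 Y Y1 \<longlongrightarrow> k) F" by (rule Lim_transform_eventually[OF tendsto_const])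
  with assms(3) have "k = L" by (intro tendsto_unique[OF assms(4)])
  thus ?thesis using k z by auto
qed

lemma eventually_unit_interval:
  "eventually (\<lambda>z::real. z \<in> {0<..<1}) (at_right 0)" "eventually (\<lambda>z::real. z \<in> {0<..<1}) (at_left 1)"
  by (rule eventually_at_right_real eventually_at_left_real; simp)+

lemma F21_0: "F21 a b c 0 = rGamma c"
  unfolding F21_def by (subst powser_zero) (rule hcoeff_0)

lemma F21_tendsto_0: "(F21 a b c \<longlongrightarrow> rGamma c) (at_right 0)"
proof -
  have "(F21 a b c \<longlongrightarrow> F21 a b c 0) (at 0)"
    using DERIV_isCont[OF F21_deriv[of 0]] by (simp add: isCont_def)
  thus ?thesis unfolding F21_0 by (rule filterlim_mono) (simp_all add: at_le)
qed

lemma F21_tendsto_1: "((\<lambda>z. F21 a b c (1 - z)) \<longlongrightarrow> rGamma c) (at_left 1)"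
proof -
  have "filterlim (\<lambda>z::real. 1 - z) (at_right 0) (at_left 1)" by real_asymp
  from filterlim_compose[OF F21_tendsto_0 this] show ?thesis .
qed

lemma F21_pos:
  assumes "0 < a" "0 < b" "0 < c" "0 < z" "z < 1" shows "0 < F21 a b c z"
  unfolding F21_def by (rule suminf_pos) (use assms in \<open>auto intro!: summable_hcoeff mult_pos_pos hcoeff_pos\<close>)

lemma one_minus_powr_tendsto_0: "((\<lambda>z::real. (1 - z) powr r) \<longlongrightarrow> 1) (at_right 0)"
proof -
  have "((\<lambda>z::real. (1 - z) powr r) \<longlongrightarrow> (1 - 0) powr r) (at_right 0)"
    by (intro tendsto_powr tendsto_diff tendsto_const tendsto_ident_at) auto
  thus ?thesis by simp
qed

lemma powr_tendsto_0: "0 < r \<Longrightarrow> ((\<lambda>z::real. z powr r) \<longlongrightarrow> 0) (at_right 0)"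
  using tendsto_powr'[of "\<lambda>z. z" 0 "at_right 0" "\<lambda>_. r" r]
  by (auto simp: eventually_at_filter)

text \<open>Both sides solve the same equation, and their weighted Wronskian tends to 0 at 0 because
  of the factor z^c with c > 0. Hence they are proportional, and their limits at 0 agree. Positivity
  of \<open>a\<close>, \<open>b\<close>, \<open>c\<close> makes the left side nonzero, so that the
  quotient can be formed.\<close>

theorem F21_Euler:
  assumes "0 < a" "0 < b" "0 < c" "0 < z" "z < 1"
  shows "F21 a b c z = (1 - z) powr (c - a - b) * F21 (c - a) (c - b) c z"
proof -
  define d where "d = c - a - b"
  define y1 where "y1 = (\<lambda>z. a * b * F21 (a + 1) (b + 1) (c + 1) z)"
  define Y1 where "Y1 = (\<lambda>z. (1 - z) powr d * ((c - a) * (c - b) * F21 (c - a + 1) (c - b + 1) (c + 1) z)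
     - d * (1 - z) powr (d - 1) * F21 (c - a) (c - b) c z)"
  define Y where "Y = (\<lambda>z. (1 - z) powr d * F21 (c - a) (c - b) c z)"
  note s1 = hyp_sol_FF[of a b c, folded y1_def]
  note s2 = hyp_sol_mult[OF hyp_sol_FF d_def, folded Y1_def Y_def]
  note one = one_minus_powr_tendsto_0
  have "((\<lambda>z. z powr c * (1 - z) powr (a + b + 1 - c) * (F21 a b c z * Y1 z - Y z * y1 z)) \<longlongrightarrow>
     0 * 1 * (rGamma c * (1 * ((c - a) * (c - b) * rGamma (c + 1)) - d * 1 * rGamma c) - 1 * rGamma c * (a * b * rGamma (c + 1)))) (at_right 0)"
    unfolding Y1_def Y_def y1_def
    by (intro tendsto_mult tendsto_diff tendsto_const F21_tendsto_0 one powr_tendsto_0 assms(3))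
  hence lim: "(wronskian a b c (F21 a b c) y1 Y Y1 \<longlongrightarrow> 0) (at_right 0)"
    unfolding wronskian_def[abs_def] by simp
  have w0: "F21 a b c z * Y1 z - Y z * y1 z = 0" if "z \<in> {0<..<1}" for z
    using wronskian_eq[OF s1 s2 lim _ eventually_unit_interval(1) that] that by (simp add: wronskian_def)
  have "\<exists>k. \<forall>z\<in>{0<..<1}. Y z / F21 a b c z = k"
  proof (rule has_field_derivative_zero_constant)
    fix z :: real assume z: "z \<in> {0<..<1}"
    have pos: "F21 a b c z > 0" using z assms by (intro F21_pos) auto
    have "((\<lambda>z. Y z / F21 a b c z) has_real_derivative (Y1 z * F21 a b c z - Y z * y1 z) / (F21 a b c z * F21 a b c z)) (at z)"
      using s1 s2 z pos unfolding hyp_sol_def by (intro DERIV_divide) auto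
    thus "((\<lambda>z. Y z / F21 a b c z) has_real_derivative 0) (at z within {0<..<1})"
      using w0[OF z] by (simp add: mult.commute has_field_derivative_at_within)
  qed auto
  then obtain k where k: "\<forall>z\<in>{0<..<1}. Y z / F21 a b c z = k" by blast
  have "((\<lambda>z. Y z / F21 a b c z) \<longlongrightarrow> 1 * rGamma c / rGamma c) (at_right 0)"
    unfolding Y_def using rGamma_pos[OF assms(3)]
    by (intro tendsto_mult tendsto_divide F21_tendsto_0 one) auto
  hence 1: "((\<lambda>z. Y z / F21 a b c z) \<longlongrightarrow> 1) (at_right 0)" using rGamma_pos[OF assms(3)] by simp
  from eventually_unit_interval(1) have "eventually (\<lambda>z. k = Y z / F21 a b c z) (at_right 0)"
    by eventually_elim (use k in auto)
  hence "((\<lambda>z. Y z / F21 a b c z) \<longlongrightarrow> k) (at_right 0)" by (rule Lim_transform_eventually[OF tendsto_const])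
  with 1 have "k = 1" by (intro tendsto_unique[of "at_right 0"]) auto
  with k assms F21_pos[of a b c z] show ?thesis by (auto simp: Y_def d_def)
qed

subsection \<open>The representation \<open>\<theta>\<close> and the Hamming type\<close>

abbreviation tr :: "'a \<Rightarrow> 'a \<Rightarrow> 'a \<Rightarrow> 'a" where
  "tr \<equiv> Transposition.transpose"

abbreviation s12 :: "real^7^7" where
  "s12 \<equiv> perm_matrix (tr 1 2)"

lemma exhaust_6: "(x::6) = 1 \<or> x = 2 \<or> x = 3 \<or> x = 4 \<or> x = 5 \<or> x = 6"
proof (induct x)
  case (of_int z)
  then have "0 \<le> z" and "z < 6" by simp_all
  then have "z = 0 \<or> z = 1 \<or> z = 2 \<or> z = 3 \<or> z = 4 \<or> z = 5" by arith
  then show ?case by auto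
qed

lemma UNIV_6: "(UNIV :: 6 set) = {1, 2, 3, 4, 5, 6}"
  using exhaust_6 by auto

lemma sum_6: "(\<Sum>i\<in>UNIV. h (i::6)) = h 1 + h 2 + h 3 + h 4 + h 5 + h 6"
  unfolding UNIV_6 by (simp add: ac_simps)

lemma vec_eq_6_iff:
  "(x :: 'a^6) = y \<longleftrightarrow> x$1 = y$1 \<and> x$2 = y$2 \<and> x$3 = y$3 \<and> x$4 = y$4 \<and> x$5 = y$5 \<and> x$6 = y$6"
proof -
  have "x = y \<longleftrightarrow> (\<forall>i\<in>UNIV. x$i = y$i)"
    by (simp only: vec_eq_iff ball_UNIV)
  also have "\<dots> \<longleftrightarrow> (\<forall>i\<in>{1,2,3,4,5,6}. x$i = y$i)"
    by (simp only: UNIV_6)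
  finally show ?thesis
    by (simp only: ball_simps simp_thms)
qed

lemma vector_6_nth [simp]:
  "(vector [a,b,c,d,e,f] :: 'a::zero^6) $ 1 = a"
  "(vector [a,b,c,d,e,f] :: 'a::zero^6) $ 2 = b"
  "(vector [a,b,c,d,e,f] :: 'a::zero^6) $ 3 = c"
  "(vector [a,b,c,d,e,f] :: 'a::zero^6) $ 4 = d"
  "(vector [a,b,c,d,e,f] :: 'a::zero^6) $ 5 = e"
  "(vector [a,b,c,d,e,f] :: 'a::zero^6) $ 6 = f"
  unfolding vector_def by simp_all

lemma matrix_eqI: "(\<And>x. A *v x = B *v x) \<Longrightarrow> A = (B :: real^'n^'m)"
  by (simp add: matrix_eq)

lemma SS_mult: "SS *v x = vector [x$1, x$3 + x$4, x$2 + x$4, x$2 + x$3,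
    x$2 + x$3 + x$4 + x$5, x$2 + x$3 + x$4 + x$6, x$2 + x$3 + x$4 + x$7]"
  by (simp add: vec_eq_7_iff SS_def matrix_vector_mult_def sum_7)

definition SSi :: "real^7^7" where
  "SSi = matrix (\<lambda>x. vector [x$1, (x$3 + x$4 - x$2) / 2, (x$2 + x$4 - x$3) / 2, (x$2 + x$3 - x$4) / 2,
     x$5 - (x$2 + x$3 + x$4) / 2, x$6 - (x$2 + x$3 + x$4) / 2, x$7 - (x$2 + x$3 + x$4) / 2])"

lemma SSi_mult: "SSi *v x = vector [x$1, (x$3 + x$4 - x$2) / 2, (x$2 + x$4 - x$3) / 2, (x$2 + x$3 - x$4) / 2,
     x$5 - (x$2 + x$3 + x$4) / 2, x$6 - (x$2 + x$3 + x$4) / 2, x$7 - (x$2 + x$3 + x$4) / 2]"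
  by (simp add: SSi_def vec_eq_7_iff matrix_vector_mult_def matrix_def sum_7 axis_def, simp add: field_simps)

lemma SS_inv: "SS ** SSi = mat 1" "SSi ** SS = mat 1"
  by (rule matrix_eqI, simp add: matrix_vector_mul_assoc[symmetric] SS_mult SSi_mult vec_eq_7_iff field_simps)+

lemma
  fixes A :: "real^'n^'n"
  assumes "invertible A"
  shows matrix_inv_right: "A ** matrix_inv A = mat 1" and matrix_inv_left: "matrix_inv A ** A = mat 1"
  using someI_ex[OF assms[unfolded invertible_def]] by (simp_all add: matrix_inv_def)

lemma matrix_inv_eqI:
  fixes A B :: "real^'n^'n"
  assumes "A ** B = mat 1" "B ** A = mat 1" shows "matrix_inv A = B"
proof -
  have "invertible A" using assms invertible_def by blast
  hence "matrix_inv A ** A = mat 1" by (rule matrix_inv_left)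
  hence "matrix_inv A ** (A ** B) = B" by (simp add: matrix_mul_assoc)
  thus ?thesis using assms by simp
qed

lemma matrix_inv_SS: "matrix_inv SS = SSi"
  by (rule matrix_inv_eqI[OF SS_inv])

definition conjS :: "(7 \<Rightarrow> 7) \<Rightarrow> real^7^7" where
  "conjS p = SS ** perm_matrix p ** matrix_inv SS"

lemma perm_matrix_mult: "p permutes UNIV \<Longrightarrow> perm_matrix p *v x = (\<chi> i. x $ inv_into UNIV p i)"
proof -
  assume p: "p permutes UNIV"
  have "i = p j \<longleftrightarrow> j = inv_into UNIV p i" for i j
    using permutes_inverses[OF p] by metis
  thus ?thesis
    by (simp add: vec_eq_iff matrix_vector_mult_def perm_matrix_def if_distrib[of "\<lambda>u. u * _"] cong: if_cong)
qed

lemma perm_matrix_transpose_mult: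
  "perm_matrix (tr i j) *v x = (\<chi> k. x $ tr i j k)"
  by (subst perm_matrix_mult) (simp_all add: permutes_swap_id)

lemma conjS_comp:
  assumes "p permutes UNIV" "q permutes UNIV"
  shows "conjS (p \<circ> q) = conjS p ** conjS q"
proof -
  have "perm_matrix (p \<circ> q) = perm_matrix p ** (perm_matrix q :: real^7^7)"
    by (rule matrix_eqI) (simp add: matrix_vector_mul_assoc[symmetric] perm_matrix_mult assms
        permutes_compose o_inv_distrib permutes_bij[OF assms(1)] permutes_bij[OF assms(2)])
  moreover have "(SS ** P ** SSi) ** (SS ** Q ** SSi) = SS ** (P ** Q) ** SSi" for P Q
  proof -
    have "(SS ** P ** SSi) ** (SS ** Q ** SSi) = SS ** P ** (SSi ** SS) ** Q ** SSi"
      by (simp add: matrix_mul_assoc)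
    thus ?thesis by (simp add: SS_inv matrix_mul_assoc)
  qed
  ultimately show ?thesis by (simp add: conjS_def matrix_inv_SS)
qed

lemma conjS_id: "conjS id = mat 1"
proof -
  have "perm_matrix id = (mat 1 :: real^7^7)"
    by (simp add: vec_eq_iff perm_matrix_def mat_def)
  thus ?thesis by (simp add: conjS_def matrix_inv_SS SS_inv)
qed

text \<open>\<open>TT\<close> and \<open>YY\<close> are mutually inverse between the linear hyperplane \<open>uu = 0\<close> and \<open>\<real>\<^sup>6\<close>. In these coordinates \<open>M_K\<close>,
  which fixes \<open>ww\<close> and \<open>uu\<close>, acts by signed permutations, and this action is \<open>\<theta>\<close>.\<close>

definition TT :: "real^7^6" where
  "TT = matrix (\<lambda>x. vector [(x$1 + x$2 - x$3 - x$4) / 2, (x$1 - x$2 + x$3 - x$4) / 2, (x$1 - x$2 - x$3 + x$4) / 2,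
     (x$1 + x$2 + x$3 + x$4) / 2 - x$5, (x$1 + x$2 + x$3 + x$4) / 2 - x$6, (x$1 + x$2 + x$3 + x$4) / 2 - x$7])"

definition YY :: "real^6^7" where
  "YY = matrix (\<lambda>t. vector [(t$1 + t$2 + t$3 + t$4 + t$5 + t$6) / 2, (t$1 - t$2 - t$3 + t$4 + t$5 + t$6) / 2,
     (- t$1 + t$2 - t$3 + t$4 + t$5 + t$6) / 2, (- t$1 - t$2 + t$3 + t$4 + t$5 + t$6) / 2,
     t$5 + t$6, t$4 + t$6, t$4 + t$5])"

lemma TT_mult: "TT *v x = vector [(x$1 + x$2 - x$3 - x$4) / 2, (x$1 - x$2 + x$3 - x$4) / 2, (x$1 - x$2 - x$3 + x$4) / 2,
     (x$1 + x$2 + x$3 + x$4) / 2 - x$5, (x$1 + x$2 + x$3 + x$4) / 2 - x$6, (x$1 + x$2 + x$3 + x$4) / 2 - x$7]"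
  by (simp add: TT_def vec_eq_6_iff matrix_vector_mult_def matrix_def sum_7 axis_def)

lemma YY_mult: "YY *v t = vector [(t$1 + t$2 + t$3 + t$4 + t$5 + t$6) / 2, (t$1 - t$2 - t$3 + t$4 + t$5 + t$6) / 2,
     (- t$1 + t$2 - t$3 + t$4 + t$5 + t$6) / 2, (- t$1 - t$2 + t$3 + t$4 + t$5 + t$6) / 2,
     t$5 + t$6, t$4 + t$6, t$4 + t$5]"
  by (simp add: YY_def vec_eq_7_iff matrix_vector_mult_def matrix_def sum_6 axis_def)

definition uu :: "real^7 \<Rightarrow> real" where
  "uu x = x$5 + x$6 + x$7 - x$1 - x$2 - x$3 - x$4"

text \<open>The point where \<open>uu\<close> is 1 and all six t-coordinates vanish. It spans a
  complement of the hyperplane \<open>uu = 0\<close>, and \<open>M_K\<close> fixes it.\<close>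

definition ww :: "real^7" where
  "ww = vector [1/2, 1/2, 1/2, 1/2, 1, 1, 1]"

lemma YY_TT: "YY *v (TT *v x) = x - uu x *\<^sub>R ww"
  by (simp add: YY_mult TT_mult uu_def ww_def vec_eq_7_iff field_simps)

lemma TT_YY: "TT ** YY = mat 1"
  by (rule matrix_eqI) (simp add: matrix_vector_mul_assoc[symmetric] TT_mult YY_mult vec_eq_6_iff field_simps)

lemma TT_ww: "TT *v ww = 0"
  by (simp add: TT_mult ww_def vec_eq_6_iff)

lemma uu_YY: "uu (YY *v t) = 0"
  by (simp add: uu_def YY_mult field_simps)

text \<open>Exactly what is needed for \<open>theta0\<close> to be multiplicative and injective: the
  splitting of the space into the hyperplane \<open>uu = 0\<close> and the line through
  \<open>ww\<close> is respected, with trivial action on the line.\<close>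

definition good :: "real^7^7 \<Rightarrow> bool" where
  "good A \<longleftrightarrow> A *v ww = ww \<and> (\<forall>x. uu (A *v x) = uu x)"

definition theta0 :: "real^7^7 \<Rightarrow> real^6^6" where
  "theta0 A = TT ** A ** YY"

lemma theta0_mult:
  assumes "good A" "good B" shows "theta0 (A ** B) = theta0 A ** theta0 B"
proof (rule matrix_eqI)
  fix t
  have "theta0 A ** theta0 B *v t = TT *v (A *v (YY *v (TT *v (B *v (YY *v t)))))"
    by (simp add: theta0_def matrix_vector_mul_assoc matrix_mul_assoc)
  also have "\<dots> = TT *v (A *v (B *v (YY *v t)))"
    using assms uu_YY[of t] unfolding YY_TT by (simp add: good_def)
  finally show "theta0 (A ** B) *v t = theta0 A ** theta0 B *v t"
    by (simp add: theta0_def matrix_vector_mul_assoc matrix_mul_assoc)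
qed

lemma good_mult: "good A \<Longrightarrow> good B \<Longrightarrow> good (A ** B)"
  by (simp add: good_def matrix_vector_mul_assoc[symmetric])

text \<open>A good matrix can be rebuilt: on the hyperplane \<open>uu = 0\<close> it is
  \<open>theta0\<close> transported by \<open>TT\<close> and \<open>YY\<close>, and on
  \<open>ww\<close> it is the identity.\<close>

lemma theta0_inj:
  assumes "good A" "good B" "theta0 A = theta0 B" shows "A = B"
proof (rule matrix_eqI)
  have dec: "C *v x = YY *v (theta0 C *v (TT *v x)) + uu x *\<^sub>R ww" if "good C" for C x
  proof -
    have "YY *v (theta0 C *v (TT *v x)) = YY *v (TT *v (C *v (YY *v (TT *v x))))"
      by (simp add: theta0_def matrix_vector_mul_assoc[symmetric])
    also have "C *v (YY *v (TT *v x)) = C *v x - uu x *\<^sub>R ww"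
      using that by (simp add: YY_TT matrix_vector_mult_diff_distrib good_def matrix_vector_mult_scaleR)
    also have "YY *v (TT *v (C *v x - uu x *\<^sub>R ww)) = C *v x - uu x *\<^sub>R ww"
      using that unfolding matrix_vector_mult_diff_distrib
      by (simp add: YY_TT matrix_vector_mult_scaleR TT_ww good_def)
    finally show ?thesis by simp
  qed
  show "A *v x = B *v x" for x
    unfolding dec[OF assms(1)] dec[OF assms(2)] assms(3) ..
qed

lemma theta0_one: "theta0 (mat 1) = mat 1"
  by (simp add: theta0_def TT_YY)

lemma good_one: "good (mat 1)"
  by (simp add: good_def)

lemma good_inverse:
  assumes "good A" "A ** B = mat 1" "B ** A = mat 1" shows "good B"
proof -
  have "B *v (A *v x) = x" "A *v (B *v x) = x" for x
    using assms(2,3) by (simp_all add: matrix_vector_mul_assoc)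
  thus ?thesis using assms(1) unfolding good_def by metis
qed

lemma UNIV_7_minus: "UNIV - {1::7} = {2, 3, 4, 5, 6, 7}"
  using exhaust_7 by auto

text \<open>In the coordinates \<open>SSi *v x\<close> the vector \<open>ww\<close> is constant on
  the last six entries, and \<open>uu\<close> is the sum of all entries minus twice the first.
  Permutations fixing the first index preserve both.\<close>

lemma good_conjS:
  assumes "p permutes UNIV" "p 1 = 1"
  shows "good (conjS p)"
proof -
  have fix1: "inv_into UNIV p 1 = 1"
    using permutes_inverses(2)[OF assms(1), of 1] assms(2) by simp
  have act: "conjS p *v x = SS *v (\<chi> i. (SSi *v x) $ inv_into UNIV p i)" for x
    by (simp add: conjS_def matrix_inv_SS matrix_vector_mul_assoc[symmetric] perm_matrix_mult[OF assms(1)])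
  have w: "SSi *v ww = (\<chi> i. if i = 1 then 1 / 2 else 1 / 4)"
    by (simp add: SSi_mult ww_def vec_eq_7_iff)
  have "inv_into UNIV p i = 1 \<longleftrightarrow> i = 1" for i
    using fix1 permutes_inverses[OF assms(1)] assms(2) by metis
  hence "(\<chi> i. (SSi *v ww) $ inv_into UNIV p i) = SSi *v ww"
    by (simp add: w vec_eq_iff)
  hence 1: "conjS p *v ww = ww"
    using SS_inv(1) unfolding act by (simp add: matrix_vector_mul_assoc)
  have uS: "uu (SS *v y) = (\<Sum>i\<in>UNIV. y $ i) - 2 * y $ 1" for y
    by (simp add: uu_def SS_mult sum_7)
  have "uu (conjS p *v x) = uu x" for x
  proof -
    have "uu (conjS p *v x) = (\<Sum>i\<in>UNIV. (SSi *v x) $ inv_into UNIV p i) - 2 * (SSi *v x) $ 1"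
      by (simp add: act uS fix1)
    also have "(\<Sum>i\<in>UNIV. (SSi *v x) $ inv_into UNIV p i) = (\<Sum>i\<in>UNIV. (SSi *v x) $ i)"
      using sum.permute[OF permutes_inv[OF assms(1)], of "\<lambda>i. (SSi *v x) $ i"] by (simp add: o_def)
    also have "(\<Sum>i\<in>UNIV. (SSi *v x) $ i) - 2 * (SSi *v x) $ 1 = uu (SS *v (SSi *v x))"
      by (simp add: uS)
    also have "\<dots> = uu x" using SS_inv(1) by (simp add: matrix_vector_mul_assoc)
    finally show ?thesis .
  qed
  with 1 show ?thesis by (simp add: good_def)
qed

lemma conjS_inv:
  assumes "p permutes UNIV"
  shows "conjS p ** conjS (inv_into UNIV p) = mat 1" "conjS (inv_into UNIV p) ** conjS p = mat 1"
  using conjS_comp[OF assms permutes_inv[OF assms]] conjS_comp[OF permutes_inv[OF assms] assms]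
  by (simp_all add: permutes_inv_o[OF assms] conjS_id)

lemma s12_mult: "s12 *v x = vector [x$2, x$1, x$3, x$4, x$5, x$6, x$7]"
  by (simp add: perm_matrix_transpose_mult vec_eq_7_iff Transposition.transpose_def)

lemma good_s12: "good (s12)"
  by (simp add: good_def s12_mult ww_def vec_eq_7_iff uu_def)

lemma s12_s12: "s12 ** s12 = mat 1"
  by (rule matrix_eqI) (simp add: matrix_vector_mul_assoc[symmetric] s12_mult vec_eq_7_iff)

lemma invertibleI_mult: "A ** B = mat 1 \<Longrightarrow> B ** A = mat 1 \<Longrightarrow> invertible (A :: real^'n^'n)"
  by (auto simp: invertible_def)

lemma G_K_eq: "G_K = conjS ` {p. p permutes UNIV \<and> p 1 = 1}"
  by (auto simp: G_K_def P16_def conjS_def)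

lemma gens_good: "A \<in> G_K \<union> {s12} \<Longrightarrow> good A \<and> invertible A"
  by (auto simp: G_K_eq good_s12 intro!: good_conjS invertibleI_mult[OF conjS_inv] invertibleI_mult[OF s12_s12 s12_s12])

lemma group_GL: "group (GL :: (real^'n^'n) monoid)"
proof (rule groupI)
  fix x :: "real^'n^'n" assume "x \<in> carrier GL"
  thus "\<exists>y\<in>carrier GL. y \<otimes>\<^bsub>GL\<^esub> x = \<one>\<^bsub>GL\<^esub>"
    by (auto simp: GL_def invertible_def)
qed (auto simp: GL_def invertible_mult matrix_mul_assoc intro: invertibleI_mult)

lemma inv_GL:
  assumes "invertible (A :: real^'n^'n)"
  shows "inv\<^bsub>GL\<^esub> A = matrix_inv A"
proof -
  have "invertible (matrix_inv A)"
    using matrix_inv_left[OF assms] matrix_inv_right[OF assms] by (rule invertibleI_mult)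
  thus ?thesis
    using matrix_inv_left[OF assms] assms by (intro group.inv_equality[OF group_GL]) (auto simp: GL_def)
qed

lemma M_K_good: "A \<in> M_K \<Longrightarrow> good A \<and> invertible A"
  unfolding M_K_def
proof (induction rule: generate.induct)
  case one
  show ?case by (auto simp: GL_def good_one intro: invertibleI_mult)
next
  case (incl h) thus ?case by (rule gens_good)
next
  case (inv h)
  from gens_good[OF inv] have h: "good h" "invertible h" by auto
  have "good (matrix_inv h)" "invertible (matrix_inv h)"
    using good_inverse[OF h(1)] matrix_inv_left[OF h(2)] matrix_inv_right[OF h(2)] by (auto intro: invertibleI_mult)
  thus ?case using inv_GL[OF h(2)] by simp
next
  case (eng h1 h2)
  thus ?case by (auto simp: GL_def good_mult invertible_mult)
qed

lemma M_K_mult: "A \<in> M_K \<Longrightarrow> B \<in> M_K \<Longrightarrow> A ** B \<in> M_K"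
  using generate.eng[of A GL _ B] by (auto simp: M_K_def GL_def)

lemma M_K_one: "mat 1 \<in> M_K"
  using generate.one[of GL] by (auto simp: M_K_def GL_def)

lemma M_K_conjS: "p permutes UNIV \<Longrightarrow> p 1 = 1 \<Longrightarrow> conjS p \<in> M_K"
  unfolding M_K_def G_K_eq by (rule generate.incl) auto

lemma M_K_s12: "s12 \<in> M_K"
  unfolding M_K_def by (rule generate.incl) auto

lemma M_K_inv:
  assumes "A \<in> M_K" shows "matrix_inv A \<in> M_K"
proof -
  have "G_K \<union> {s12} \<subseteq> carrier GL"
    using gens_good by (auto simp: GL_def)
  from group.generate_m_inv_closed[OF group_GL this, of A] assms M_K_good[OF assms] show ?thesis
    by (simp add: M_K_def inv_GL)
qed

abbreviation gen :: "7 \<Rightarrow> 7 \<Rightarrow> real^7^7" where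
  "gen i j \<equiv> conjS (tr i j)"

lemma gen_mult: "gen i j *v x = SS *v (\<chi> k. (SSi *v x) $ tr i j k)"
  by (simp add: conjS_def matrix_inv_SS matrix_vector_mul_assoc[symmetric] perm_matrix_transpose_mult)

lemma M_K_gen: "i \<noteq> 1 \<Longrightarrow> j \<noteq> 1 \<Longrightarrow> gen i j \<in> M_K"
  by (rule M_K_conjS) (auto simp: permutes_swap_id Transposition.transpose_def)

lemma M6_mult:
  assumes "i \<noteq> j"
  shows "M6 \<epsilon> i j *v t = (\<chi> r. if r = i then \<epsilon> * t $ j else if r = j then \<epsilon> * t $ i else t $ r)"
proof -
  have "(\<Sum>s\<in>UNIV. M6 \<epsilon> i j $ r $ s * t $ s) = (if r = i then \<epsilon> * t $ j else if r = j then \<epsilon> * t $ i else t $ r)" for r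
  proof -
    have "M6 \<epsilon> i j $ r $ s = (if s = tr i j r then (if r = i \<or> r = j then \<epsilon> else 1) else 0)" for s
      using assms by (auto simp: M6_def perm_matrix_def Transposition.transpose_def doubleton_eq_iff)
    thus ?thesis using assms
      by (simp add: if_distrib[of "\<lambda>u. u * _"] Transposition.transpose_def cong: if_cong)
  qed
  thus ?thesis by (simp add: vec_eq_iff matrix_vector_mult_def)
qed

lemma theta0_apply: "theta0 A *v t = TT *v (A *v (YY *v t))"
  by (simp add: theta0_def matrix_vector_mul_assoc[symmetric])

lemma theta0_s12: "theta0 (s12) = M6 (-1) 2 3"
  by (rule matrix_eqI) (simp add: theta0_apply M6_mult s12_mult TT_mult YY_mult vec_eq_6_iff field_simps)

lemma theta0_CC:
  "theta0 (gen 2 3) = M6 1 1 2" "theta0 (gen 3 4) = M6 1 2 3" "theta0 (gen 4 5) = M6 1 3 4"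
  "theta0 (gen 5 6) = M6 1 4 5" "theta0 (gen 6 7) = M6 1 5 6"
  by (rule matrix_eqI, simp add: theta0_apply M6_mult gen_mult SS_mult SSi_mult TT_mult YY_mult vec_eq_6_iff
       Transposition.transpose_def field_simps)+

definition theta_spec :: "(real^7^7 \<Rightarrow> real^6^6) \<Rightarrow> bool" where
  "theta_spec h \<longleftrightarrow> h \<in> extensional M_K \<and> h \<in> mon (GL\<lparr>carrier := M_K\<rparr>) GL
     \<and> (\<forall>k\<in>{1..5::nat}. h (SS ** perm_matrix (tr (of_nat (k + 1)) (of_nat (k + 2))) ** matrix_inv SS)
                        = M6 1 (of_nat k) (of_nat (k + 1)))
     \<and> h (s12) = M6 (-1) 2 3"

lemma ball_1_5: "(\<forall>k\<in>{1..5::nat}. P k) \<longleftrightarrow> P 1 \<and> P 2 \<and> P 3 \<and> P 4 \<and> P 5"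
proof -
  have "{1..5::nat} = {1, 2, 3, 4, 5}" by auto
  thus ?thesis by simp
qed

lemma theta_spec_iff:
  "theta_spec h \<longleftrightarrow> h \<in> extensional M_K \<and> (\<forall>A\<in>M_K. invertible (h A)) \<and> (\<forall>A\<in>M_K. \<forall>B\<in>M_K. h (A ** B) = h A ** h B)
     \<and> inj_on h M_K \<and> h (gen 2 3) = M6 1 1 2 \<and> h (gen 3 4) = M6 1 2 3 \<and> h (gen 4 5) = M6 1 3 4 \<and>
     h (gen 5 6) = M6 1 4 5 \<and> h (gen 6 7) = M6 1 5 6 \<and> h (s12) = M6 (-1) 2 3"
  unfolding theta_spec_def ball_1_5 conjS_def mon_def hom_def by (auto simp: GL_def)

lemma theta_spec_theta0: "theta_spec (restrict theta0 M_K)"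
proof -
  have "invertible (theta0 A)" if "A \<in> M_K" for A
  proof -
    from M_K_good[OF that] M_K_good[OF M_K_inv[OF that]] have "good A" "invertible A" "good (matrix_inv A)" by auto
    thus ?thesis
      using theta0_mult[of A "matrix_inv A"] theta0_mult[of "matrix_inv A" A] matrix_inv_left[of A] matrix_inv_right[of A]
      by (intro invertibleI_mult[of _ "theta0 (matrix_inv A)"]) (simp_all add: theta0_one)
  qed
  moreover have "inj_on theta0 M_K"
    using theta0_inj M_K_good by (auto simp: inj_on_def)
  ultimately show ?thesis
    by (auto simp: theta_spec_iff M_K_mult theta0_mult M_K_good M_K_gen M_K_s12 theta0_s12 theta0_CC inj_on_def)
qed

text \<open>The specification prescribes \<open>h\<close> only on five adjacent transpositions and
  on \<open>s12\<close>, whereas \<open>G_K\<close> contains all permutations fixing 1. The property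
  \<open>Q\<close> is therefore carried from adjacent transpositions to all transpositions and then
  to all permutations.\<close>

lemma theta_spec_unique:
  assumes h: "theta_spec h" and A: "A \<in> M_K"
  shows "h A = theta0 A"
proof -
  note h = h[unfolded theta_spec_iff]
  have theta0: "theta0 (A ** B) = theta0 A ** theta0 B" if "A \<in> M_K" "B \<in> M_K" for A B
    using that M_K_good theta0_mult by blast
  have hm: "h (A ** B) = h A ** h B" if "A \<in> M_K" "B \<in> M_K" for A B
    using h that by blast
  have comp: "h (A ** B) = theta0 (A ** B)" if "A \<in> M_K" "B \<in> M_K" "h A = theta0 A" "h B = theta0 B" for A B
    using that by (simp add: theta0 hm)
  have hone: "h (mat 1) = mat 1"
  proof -
    have "h (mat 1) ** h (mat 1) = h (mat 1)"
      using hm[OF M_K_one M_K_one] by simp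
    moreover have i: "invertible (h (mat 1))" using h M_K_one by blast
    ultimately have "matrix_inv (h (mat 1)) ** h (mat 1) ** h (mat 1) = matrix_inv (h (mat 1)) ** h (mat 1)"
      by (metis matrix_mul_assoc)
    thus ?thesis using matrix_inv_left[OF i] by simp
  qed
  have hinv: "h (matrix_inv A) = theta0 (matrix_inv A)" if "A \<in> M_K" "h A = theta0 A" for A
  proof -
    have i: "invertible A" using M_K_good that by blast
    have "h (matrix_inv A) ** h A = mat 1"
      using hm[OF M_K_inv[OF that(1)] that(1)] matrix_inv_left[OF i] hone by simp
    moreover have "theta0 A ** theta0 (matrix_inv A) = mat 1"
      using theta0[OF that(1) M_K_inv[OF that(1)]] matrix_inv_right[OF i] theta0_one by simp
    ultimately show ?thesis
      using that(2) by (metis matrix_mul_assoc matrix_mul_lid matrix_mul_rid)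
  qed
  define Q where "Q = (\<lambda>p. p permutes UNIV \<and> p 1 = 1 \<and> h (conjS p) = theta0 (conjS p))"
  have Qc: "Q (p \<circ> q)" if "Q p" "Q q" for p q
    using that comp[of "conjS p" "conjS q"] by (auto simp: Q_def permutes_compose conjS_comp M_K_conjS)
  \<comment> \<open>The conjugation (a b)(b c)(a b) = (a c) reaches transpositions at distance 2, 3,
    4 and 5 in turn.\<close>
  have Qtr: "Q (tr a c)" if "Q (tr a b)" "Q (tr b c)" "a \<noteq> c" "b \<noteq> c" for a b c
    using Qc[OF Qc[OF that(1,2)] that(1)] transpose_comp_triple[OF that(3,4)] by (simp add: o_assoc)
  have t: "tr i j permutes UNIV" for i j :: 7 by (rule permutes_swap_id) auto
  have Q1: "Q (tr 2 3)" "Q (tr 3 4)" "Q (tr 4 5)"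
    "Q (tr 5 6)" "Q (tr 6 7)"
    using h theta0_CC by (simp_all add: Q_def t Transposition.transpose_def)
  have Q2: "Q (tr 2 4)" "Q (tr 3 5)" "Q (tr 4 6)"
    "Q (tr 5 7)"
    by (rule Qtr[OF Q1(1) Q1(2)] Qtr[OF Q1(2) Q1(3)] Qtr[OF Q1(3) Q1(4)] Qtr[OF Q1(4) Q1(5)]; simp)+
  have Q3: "Q (tr 2 5)" "Q (tr 3 6)" "Q (tr 4 7)"
    by (rule Qtr[OF Q2(1) Q1(3)] Qtr[OF Q2(2) Q1(4)] Qtr[OF Q2(3) Q1(5)]; simp)+
  have Q4: "Q (tr 2 6)" "Q (tr 3 7)"
    by (rule Qtr[OF Q3(1) Q1(4)] Qtr[OF Q3(2) Q1(5)]; simp)+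
  have Q5: "Q (tr 2 7)"
    by (rule Qtr[OF Q4(1) Q1(5)]; simp)
  have Qall: "Q (tr a b)" if "a \<in> {2,3,4,5,6,7}" "b \<in> {2,3,4,5,6,7}" "a \<noteq> b" for a b
    using that Q1 Q2 Q3 Q4 Q5 by (auto simp: transpose_commute)
  have Qid: "Q id"
    by (simp add: Q_def conjS_id hone theta0_one)
  have Qp: "Q p" if "p permutes {2,3,4,5,6,7}" for p
    using that by (rule permutes_induct[where P = Q]) (auto simp: Qid intro!: Qc Qall)
  have gen: "h B = theta0 B" if "B \<in> G_K \<union> {s12}" for B
  proof -
    have "h (conjS p) = theta0 (conjS p)" if "p permutes UNIV" "p 1 = 1" for p
    proof -
      have "p permutes (UNIV - {1})"
        using that unfolding permutes_def by auto
      hence "p permutes {2,3,4,5,6,7}" by (simp only: UNIV_7_minus)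
      from Qp[OF this] show ?thesis by (simp add: Q_def)
    qed
    thus ?thesis using that h theta0_s12 by (auto simp: G_K_eq)
  qed
  show ?thesis using A unfolding M_K_def
  proof (induction rule: generate.induct)
    case one thus ?case using hone theta0_one by (simp add: GL_def)
  next
    case (incl B) thus ?case by (rule gen)
  next
    case (inv B)
    hence "B \<in> M_K" unfolding M_K_def by (rule generate.incl)
    with hinv[OF _ gen, of B] inv_GL[of B] M_K_good[of B] \<open>B \<in> _ \<union> _\<close> show ?case by simp
  next
    case (eng B C)
    hence "B \<in> M_K" "C \<in> M_K" by (simp_all add: M_K_def)
    with comp eng show ?case by (simp add: GL_def)
  qed
qed

lemma theta_eq: "A \<in> M_K \<Longrightarrow> theta A = theta0 A"
proof -
  assume A: "A \<in> M_K"
  have "theta = (THE h. theta_spec h)" by (simp add: theta_def theta_spec_def)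
  also have "\<dots> = restrict theta0 M_K"
  proof (rule the_equality)
    show "theta_spec (restrict theta0 M_K)" by (rule theta_spec_theta0)
  next
    fix h assume h: "theta_spec h"
    show "h = restrict theta0 M_K"
      by (rule extensionalityI[of _ M_K]) (use h in \<open>auto simp: theta_spec_iff theta_spec_unique[OF h]\<close>)
  qed
  finally have "theta A = restrict theta0 M_K A" by (rule fun_cong)
  thus ?thesis using A by (simp only: restrict_apply if_True)
qed

section \<open>The elements \<open>n4\<close> and \<open>p4\<close> as words in the generators, and
  their Hamming distances\<close>

lemma n4_mult: "n4 *v x = vector [x$5 - x$1, x$5 - x$2, x$5 - x$3, x$5 - x$4,
    uu x + x$5 - x$6, uu x + x$5 - x$7, x$5]"
  by (simp add: n4_def Let_def uu_def vec_eq_7_iff matrix_vector_mult_def matrix_def sum_7 axis_def)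

lemma p4_mult: "p4 *v x = vector [uu x + x$1 - x$5, uu x + x$2 - x$5, uu x + x$3 - x$5, uu x + x$4 - x$5,
    uu x + x$6 - x$5, uu x + x$7 - x$5, 2 * uu x - x$5]"
  by (simp add: p4_def Let_def uu_def vec_eq_7_iff matrix_vector_mult_def matrix_def sum_7 axis_def)

text \<open>Under \<open>theta0\<close> the product \<open>s12 ** gen 3 4\<close> changes the signs
  of t2 and t3, and \<open>gen i j\<close> is the transposition (i - 1, j - 1). The conjugation
  moves the sign changes to t5 and t6; the leading factor then exchanges t4 and t6.\<close>

lemma p4_eq: "p4 = gen 5 7 ** ((gen 3 6 ** gen 4 7) ** (s12 ** gen 3 4) ** (gen 4 7 ** gen 3 6))"
  by (rule matrix_eqI) (simp add: matrix_vector_mul_assoc[symmetric] p4_mult uu_def gen_mult s12_mult SS_mult SSi_mult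
      Transposition.transpose_def vec_eq_7_iff, simp add: field_simps)

text \<open>The two conjugates change the signs of t1, t2 and of t3, t4; the leading factor
  exchanges t4 and t6.\<close>

lemma n4_eq: "n4 = gen 5 7 ** (gen 2 4 ** (s12 ** gen 3 4) ** gen 2 4) **
   (gen 3 5 ** (s12 ** gen 3 4) ** gen 3 5)"
  by (rule matrix_eqI) (simp add: matrix_vector_mul_assoc[symmetric] n4_mult uu_def gen_mult s12_mult SS_mult SSi_mult
      Transposition.transpose_def vec_eq_7_iff, simp add: field_simps)

lemma p0_n4_p4_in_M_K: "{p0, n4, p4} \<subseteq> M_K"
proof -
  have "p4 \<in> M_K" unfolding p4_eq by (intro M_K_mult M_K_gen M_K_s12) simp_all
  moreover have "n4 \<in> M_K" unfolding n4_eq by (intro M_K_mult M_K_gen M_K_s12) simp_all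
  ultimately show ?thesis by (simp add: p0_def M_K_one)
qed

text \<open>Exhibiting a preimage of \<open>omega0\<close> spares the computation of inverse
  matrices. For \<open>n4\<close> and \<open>p4\<close> the preimage carries -1 exactly at the
  coordinates whose sign is changed.\<close>

lemma theta_inv_omega0:
  assumes "A \<in> M_K" "theta0 A *v v = omega0"
  shows "matrix_inv (theta A) *v omega0 = v"
proof -
  have "invertible (theta0 A)"
    using theta_spec_theta0 assms(1) by (auto simp: theta_spec_iff)
  hence "matrix_inv (theta0 A) *v (theta0 A *v v) = v"
    by (simp add: matrix_vector_mul_assoc matrix_inv_left)
  thus ?thesis using assms by (simp add: theta_eq)
qed

lemma hamming_type_246: "hamming_type p0 n4 p4 = [2, 4, 6]"
proof -
  have o: "omega0 = vector [1, 1, 1, 1, 1, 1]"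
    by (simp add: omega0_def vec_eq_6_iff)
  note M = p0_n4_p4_in_M_K
  have 0: "matrix_inv (theta p0) *v omega0 = vector [1, 1, 1, 1, 1, 1]"
    by (rule theta_inv_omega0) (use M in \<open>simp_all add: p0_def theta0_one o\<close>)
  have 1: "matrix_inv (theta n4) *v omega0 = vector [-1, -1, -1, -1, 1, 1]"
    by (rule theta_inv_omega0)
       (use M in \<open>simp_all add: theta0_apply n4_mult uu_YY, simp_all add: TT_mult YY_mult vec_eq_6_iff o\<close>)
  have 2: "matrix_inv (theta p4) *v omega0 = vector [1, 1, 1, 1, -1, -1]"
    by (rule theta_inv_omega0)
       (use M in \<open>simp_all add: theta0_apply p4_mult uu_YY, simp_all add: TT_mult YY_mult vec_eq_6_iff o\<close>)
  have card6: "card {i::6. P i} = (if P 1 then 1 else 0) + (if P 2 then 1 else 0) + (if P 3 then 1 else 0)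
     + (if P 4 then 1 else 0) + (if P 5 then 1 else 0) + (if P 6 then 1 else 0)" for P
  proof -
    have "card {i::6. P i} = (\<Sum>i\<in>UNIV. if P i then 1 else 0)"
      by (simp add: sum.If_cases)
    thus ?thesis by (simp only: sum_6)
  qed
  have "hamming_dist p0 n4 = 4" "hamming_dist p0 p4 = 2" "hamming_dist n4 p4 = 6"
    unfolding hamming_dist_def 0 1 2 card6 by simp_all
  thus ?thesis by (simp add: hamming_type_def)
qed

subsection \<open>The connection formula between 0 and 1\<close>

lemma nn_integral_Beta:
  assumes "0 < a" "0 < b"
  shows "(\<integral>\<^sup>+t\<in>{0<..<1}. ennreal (t powr (a - 1) * (1 - t) powr (b - 1)) \<partial>lborel) = ennreal (Beta a b)"
proof (rule nn_integral_has_integral_lebesgue')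
  show "((\<lambda>t. t powr (a - 1) * (1 - t) powr (b - 1)) has_integral Beta a b) {0<..<1}"
    using has_integral_Beta_real[OF assms] by (simp only: has_integral_Icc_iff_Ioo)
qed simp

lemma measurable_mult_indicator:
  fixes g :: "real \<Rightarrow> real"
  assumes "g \<in> borel_measurable borel"
  shows "(\<lambda>t. ennreal (g t) * indicator {0<..<1} t) \<in> borel_measurable lborel"
proof -
  have "(\<lambda>t. ennreal (g t)) \<in> borel_measurable borel"
    using assms by (rule measurable_compose) (rule measurable_ennreal)
  moreover have "(indicator {0<..<1::real} :: real \<Rightarrow> ennreal) \<in> borel_measurable borel"
    by (rule borel_measurable_indicator) simp
  ultimately have "(\<lambda>t. ennreal (g t) * indicator {0<..<1} t) \<in> borel_measurable borel"
    by (rule borel_measurable_times_ennreal)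
  thus ?thesis by simp
qed

lemma nn_integral_scale:
  fixes g :: "real \<Rightarrow> real"
  assumes "0 \<le> k" "g \<in> borel_measurable borel" "(\<integral>\<^sup>+t\<in>{0<..<1}. ennreal (g t) \<partial>lborel) = ennreal B"
  shows "(\<integral>\<^sup>+t\<in>{0<..<1}. ennreal (k * g t) \<partial>lborel) = ennreal (k * B)"
proof -
  have "(\<integral>\<^sup>+t\<in>{0<..<1}. ennreal (k * g t) \<partial>lborel) = (\<integral>\<^sup>+t. ennreal k * (ennreal (g t) * indicator {0<..<1} t) \<partial>lborel)"
    by (simp only: ennreal_mult'[OF assms(1)] mult.assoc)
  also have "\<dots> = ennreal k * ennreal B"
  proof (subst nn_integral_cmult)
    show "(\<lambda>t. ennreal (g t) * indicator {0<..<1} t) \<in> borel_measurable lborel"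
      by (rule measurable_mult_indicator) fact
  qed (simp only: assms(3))
  finally show ?thesis by (simp only: ennreal_mult'[OF assms(1)])
qed

text \<open>Monotone convergence: with nonnegative terms no integrability has to be known in
  advance.\<close>

lemma nn_integral_sums:
  fixes f :: "nat \<Rightarrow> real \<Rightarrow> real" and S :: "real \<Rightarrow> real"
  assumes "\<And>n. f n \<in> borel_measurable borel" "\<And>n t. 0 < t \<Longrightarrow> t < 1 \<Longrightarrow> 0 \<le> f n t"
    and "\<And>t. 0 < t \<Longrightarrow> t < 1 \<Longrightarrow> (\<lambda>n. f n t) sums S t"
    and "\<And>n. (\<integral>\<^sup>+t\<in>{0<..<1}. ennreal (f n t) \<partial>lborel) = ennreal (I n)"
  shows "(\<integral>\<^sup>+t\<in>{0<..<1}. ennreal (S t) \<partial>lborel) = (\<Sum>n. ennreal (I n))"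
proof -
  have "(\<integral>\<^sup>+t\<in>{0<..<1}. ennreal (S t) \<partial>lborel) = (\<integral>\<^sup>+t. (\<Sum>n. ennreal (f n t) * indicator {0<..<1} t) \<partial>lborel)"
  proof (rule nn_integral_cong)
    fix t :: real
    show "ennreal (S t) * indicator {0<..<1} t = (\<Sum>n. ennreal (f n t) * indicator {0<..<1} t)"
    proof (cases "t \<in> {0<..<1}")
      case True
      hence "(\<Sum>n. ennreal (f n t)) = ennreal (S t)"
        by (intro suminf_ennreal_eq assms(2,3)) simp_all
      thus ?thesis by (simp only: indicator_simps True mult_1_right)
    next
      case False
      hence "indicator {0<..<1} t = (0 :: ennreal)" by (rule indicator_simps)
      thus ?thesis by (simp only: mult_zero_right suminf_zero)
    qed
  qed
  also have "\<dots> = (\<Sum>n. \<integral>\<^sup>+t\<in>{0<..<1}. ennreal (f n t) \<partial>lborel)"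
    by (intro nn_integral_suminf measurable_mult_indicator assms(1))
  finally show ?thesis by (simp only: assms(4))
qed

lemma suminf_ennreal_imp_sums:
  assumes "\<And>n. 0 \<le> I n" "(\<Sum>n. ennreal (I n)) = ennreal L" "0 \<le> L"
  shows "I sums L"
proof -
  have s: "summable I"
    by (rule summable_suminf_not_top) (simp_all only: assms(1,2) ennreal_neq_top not_False_eq_True)
  have "ennreal (suminf I) = ennreal L"
    using suminf_ennreal2[OF assms(1) s] assms(2) by (rule trans[OF sym])
  hence "suminf I = L"
    by (simp only: ennreal_inj[OF suminf_nonneg[OF s assms(1)] assms(3)])
  with s show ?thesis by (simp add: sums_iff)
qed

lemma binomial_series:
  fixes a t :: real
  assumes "0 < t" "t < 1"
  shows "(\<lambda>n. pochhammer a n / fact n * t ^ n) sums (1 - t) powr (- a)"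
proof -
  have "(\<lambda>n. ((- a) gchoose n) * (- t) ^ n) sums (1 + - t) powr (- a)"
    using assms by (intro gen_binomial_real) auto
  moreover have "((- a) gchoose n) * (- t) ^ n = pochhammer a n / fact n * t ^ n" for n
  proof -
    have "((- a) gchoose n) * (- t) ^ n = ((- 1) ^ n * (- 1) ^ n) * (pochhammer a n / fact n * t ^ n)"
      unfolding gbinomial_pochhammer minus_minus power_minus[of t] by simp
    also have "(- 1) ^ n * (- 1) ^ n = (1 :: real)"
      by (simp add: power_mult_distrib[symmetric])
    finally show ?thesis by simp
  qed
  ultimately show ?thesis by simp
qed

text \<open>The binomial series of (1 - t)^(-a) is integrated termwise against t^(b-1) (1 -
  t)^(c-b-1). Each term gives a Beta value, and the sum is the single Beta value B(b, c - a -
  b).\<close>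

theorem Gauss_sums:
  assumes "0 < a" "0 < b" "b < c" "a + b < c"
  shows "hcoeff a b c sums (Gamma (c - a - b) * rGamma (c - a) * rGamma (c - b))"
proof -
  define I where "I = (\<lambda>n. pochhammer a n / fact n * Beta (b + real n) (c - b))"
  have pa: "0 \<le> pochhammer a n / fact n" for n
    using assms pochhammer_pos[of a n] by simp
  have B: "0 < Beta x y" if "0 < x" "0 < y" for x y :: real
    using that by (simp add: Beta_def Gamma_real_pos add_pos_pos)
  have "(\<Sum>n. ennreal (I n)) = (\<integral>\<^sup>+t\<in>{0<..<1}. ennreal (t powr (b - 1) * (1 - t) powr (c - a - b - 1)) \<partial>lborel)"
  proof (rule nn_integral_sums[symmetric, where f = "\<lambda>n t. pochhammer a n / fact n * (t powr (b + real n - 1) * (1 - t) powr (c - b - 1))"])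
    fix t :: real assume t: "0 < t" "t < 1"
    have "(\<lambda>n. pochhammer a n / fact n * t ^ n * (t powr (b - 1) * (1 - t) powr (c - b - 1))) sums
        ((1 - t) powr (- a) * (t powr (b - 1) * (1 - t) powr (c - b - 1)))"
      by (intro sums_mult2 binomial_series t)
    moreover have "t powr (b + real n - 1) = t ^ n * t powr (b - 1)" for n
      using t powr_add[of t "real n" "b - 1"] by (simp add: powr_realpow algebra_simps)
    moreover have "(1 - t) powr (- a) * (1 - t) powr (c - b - 1) = (1 - t) powr (c - a - b - 1)"
      by (simp add: powr_add[symmetric] algebra_simps)
    ultimately show "(\<lambda>n. pochhammer a n / fact n * (t powr (b + real n - 1) * (1 - t) powr (c - b - 1))) sums
        (t powr (b - 1) * (1 - t) powr (c - a - b - 1))"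
      by (simp add: mult_ac)
  next
    fix n
    show "(\<integral>\<^sup>+t\<in>{0<..<1}. ennreal (pochhammer a n / fact n * (t powr (b + real n - 1) * (1 - t) powr (c - b - 1))) \<partial>lborel) = ennreal (I n)"
      unfolding I_def by (rule nn_integral_scale[OF pa _ nn_integral_Beta]) (use assms in auto)
    fix t :: real
    show "0 \<le> pochhammer a n / fact n * (t powr (b + real n - 1) * (1 - t) powr (c - b - 1))"
      by (intro mult_nonneg_nonneg pa) auto
  qed auto
  also have "\<dots> = ennreal (Beta b (c - a - b))"
    by (rule nn_integral_Beta) (use assms in auto)
  finally have eq: "(\<Sum>n. ennreal (I n)) = ennreal (Beta b (c - a - b))" .
  have "I sums Beta b (c - a - b)"
  proof (rule suminf_ennreal_imp_sums[OF _ eq])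
    show "0 \<le> I n" for n
      unfolding I_def using assms by (intro mult_nonneg_nonneg pa less_imp_le[OF B]) auto
  qed (use assms B in \<open>auto intro!: less_imp_le[OF B]\<close>)
  from sums_mult2[OF this, of "rGamma b * rGamma (c - b)"]
  have "(\<lambda>n. I n * (rGamma b * rGamma (c - b))) sums (Beta b (c - a - b) * (rGamma b * rGamma (c - b)))" .
  moreover have "I n * (rGamma b * rGamma (c - b)) = hcoeff a b c n" for n
  proof -
    have "I n * (rGamma b * rGamma (c - b)) =
        pochhammer a n / fact n * (Gamma (b + real n) * rGamma b) * rGamma (c + real n) * (Gamma (c - b) * rGamma (c - b))"
      by (simp add: I_def Beta_altdef algebra_simps)
    also have "\<dots> = hcoeff a b c n"
      using assms by (simp add: Gamma_rGamma pochhammer_rGamma[of b, symmetric] hcoeff_def)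
    finally show ?thesis .
  qed
  moreover have "Beta b (c - a - b) * (rGamma b * rGamma (c - b)) = Gamma (c - a - b) * rGamma (c - a) * rGamma (c - b)"
  proof -
    have "Beta b (c - a - b) * (rGamma b * rGamma (c - b)) = (Gamma b * rGamma b) * Gamma (c - a - b) * rGamma (c - a) * rGamma (c - b)"
      by (simp add: Beta_altdef algebra_simps)
    thus ?thesis using assms by (simp add: Gamma_rGamma)
  qed
  ultimately show ?thesis by simp
qed

text \<open>The easy case of Abel's theorem: nonnegative summable coefficients are themselves a
  majorant on [0, 1].\<close>

lemma powser_tendsto_1:
  fixes h :: "nat \<Rightarrow> real"
  assumes "summable h" "\<And>n. 0 \<le> h n"
  shows "((\<lambda>z. \<Sum>n. h n * z ^ n) \<longlongrightarrow> suminf h) (at_left 1)"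
proof -
  have "uniform_limit {0..1} (\<lambda>n z. \<Sum>i<n. h i * z ^ i) (\<lambda>z. \<Sum>n. h n * z ^ n) sequentially"
    using assms by (intro Weierstrass_m_test[of _ _ h]) (auto simp: abs_mult power_abs intro!: mult_left_le power_le_one)
  hence "continuous_on {0..1} (\<lambda>z. \<Sum>n. h n * z ^ n)"
    by (rule uniform_limit_theorem[rotated]) (auto intro!: always_eventually continuous_intros)
  hence "((\<lambda>z. \<Sum>n. h n * z ^ n) \<longlongrightarrow> (\<Sum>n. h n * 1 ^ n)) (at 1 within {0..1})"
    unfolding continuous_on_def by (rule bspec) simp
  thus ?thesis by (simp add: at_within_Icc_at_left)
qed

lemma F21_tendsto_Gauss:
  assumes "0 < a" "0 < b" "b < c" "a + b < c"
  shows "(F21 a b c \<longlongrightarrow> Gamma (c - a - b) * rGamma (c - a) * rGamma (c - b)) (at_left 1)"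
proof -
  have "((\<lambda>z. \<Sum>n. hcoeff a b c n * z ^ n) \<longlongrightarrow> suminf (hcoeff a b c)) (at_left 1)"
    using assms Gauss_sums[OF assms] by (intro powser_tendsto_1) (auto simp: sums_iff intro!: less_imp_le[OF hcoeff_pos])
  thus ?thesis using Gauss_sums[OF assms] by (simp add: sums_iff F21_def[abs_def])
qed

text \<open>Three solutions \<open>y\<close>, \<open>Y\<close>, \<open>Z\<close> of a second-order
  equation satisfy y W(Y,Z) - Y W(y,Z) + Z W(y,Y) = 0. The connection coefficients are thus the
  three pairwise Wronskians, each evaluated as a limit at 1.\<close>

lemma F21_connection_pos:
  assumes "0 < a" "0 < b" "0 < c" "0 < c - a" "0 < c - b" and d: "d = c - a - b" "0 < d" "d < 1" and z: "0 < z" "z < 1"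
  shows "sin (pi * d) / pi * F21 a b c z = rGamma (c - a) * rGamma (c - b) * F21 a b (1 - d) (1 - z)
     - rGamma a * rGamma b * ((1 - z) powr d * F21 (c - a) (c - b) (1 + d) (1 - z))"
proof -
  define y1 where "y1 = (\<lambda>z. a * b * F21 (a + 1) (b + 1) (c + 1) z)"
  define Y where "Y = (\<lambda>z. F21 a b (1 - d) (1 - z))"
  define Y1 where "Y1 = (\<lambda>z. - (a * b * F21 (a + 1) (b + 1) (1 - d + 1) (1 - z)))"
  define Z0 where "Z0 = (\<lambda>z. F21 (c - a) (c - b) (1 + d) (1 - z))"
  define Z01 where "Z01 = (\<lambda>z. - ((c - a) * (c - b) * F21 (c - a + 1) (c - b + 1) (1 + d + 1) (1 - z)))"
  define Z where "Z = (\<lambda>z. (1 - z) powr d * Z0 z)"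
  define Z1 where "Z1 = (\<lambda>z. (1 - z) powr d * Z01 z - d * (1 - z) powr (d - 1) * Z0 z)"
  define gy where "gy = Gamma d * rGamma (c - a) * rGamma (c - b)"
  define g1 where "g1 = Gamma (1 - d) * rGamma a * rGamma b"
  define p where "p = z powr c * (1 - z) powr (1 - d)"
  have m: "a + b + 1 - c = 1 - d" by (simp add: d)
  note sy = hyp_sol_FF[of a b c, folded y1_def]
  have "1 - d = a + b + 1 - c" by (simp add: d)
  note sY = hyp_sol_reflect[OF hyp_sol_FF this, folded Y_def Y1_def]
  have "1 + d = c - a + (c - b) + 1 - c" by (simp add: d)
  note sZ = hyp_sol_mult[OF hyp_sol_reflect[OF hyp_sol_FF this, folded Z0_def Z01_def] d(1), folded Z_def Z1_def]
  note near = eventually_unit_interval(2)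
  have p0: "((\<lambda>z::real. (1 - z) powr r) \<longlongrightarrow> 0) (at_left 1)" if "0 < r" for r
  proof -
    have "filterlim (\<lambda>z::real. 1 - z) (at_right 0) (at_left 1)" by real_asymp
    from filterlim_compose[OF powr_tendsto_0[OF that] this] show ?thesis .
  qed
  have id0: "((\<lambda>z::real. 1 - z) \<longlongrightarrow> 0) (at_left 1)" by real_asymp
  have zc: "((\<lambda>z::real. z powr c) \<longlongrightarrow> 1) (at_left 1)"
  proof -
    have "((\<lambda>z::real. z powr c) \<longlongrightarrow> 1 powr c) (at_left 1)"
      by (intro tendsto_powr tendsto_const tendsto_ident_at) auto
    thus ?thesis by simp
  qed
  have ly: "(F21 a b c \<longlongrightarrow> gy) (at_left 1)"
    using F21_tendsto_Gauss[of a b c] assms by (simp add: gy_def)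
  \<comment> \<open>The derivative of the left-hand function is unbounded at 1. Euler's
    transformation extracts its power (1 - z)^(d-1) and leaves a \<open>2F1\<close> with a finite
    Gauss value.\<close>
  have ly1: "((\<lambda>z. (1 - z) powr (1 - d) * y1 z) \<longlongrightarrow> g1) (at_left 1)"
  proof (rule Lim_transform_eventually)
    have "((\<lambda>z. a * b * F21 (c - a) (c - b) (c + 1) z) \<longlongrightarrow>
       a * b * (Gamma (c + 1 - (c - a) - (c - b)) * rGamma (c + 1 - (c - a)) * rGamma (c + 1 - (c - b)))) (at_left 1)"
      using assms by (intro tendsto_mult tendsto_const F21_tendsto_Gauss) auto
    also have "a * b * (Gamma (c + 1 - (c - a) - (c - b)) * rGamma (c + 1 - (c - a)) * rGamma (c + 1 - (c - b)))
       = Gamma (1 - d) * (a * rGamma (a + 1)) * (b * rGamma (b + 1))"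
      by (simp add: d algebra_simps)
    also have "\<dots> = g1"
      by (simp only: rGamma_plus1 g1_def)
    finally show "((\<lambda>z. a * b * F21 (c - a) (c - b) (c + 1) z) \<longlongrightarrow> g1) (at_left 1)" .
    show "\<forall>\<^sub>F z in at_left 1. a * b * F21 (c - a) (c - b) (c + 1) z = (1 - z) powr (1 - d) * y1 z"
      using near
    proof eventually_elim
      case (elim z)
      have "F21 (a + 1) (b + 1) (c + 1) z = (1 - z) powr (c + 1 - (a + 1) - (b + 1)) * F21 (c + 1 - (a + 1)) (c + 1 - (b + 1)) (c + 1) z"
        by (rule F21_Euler) (use elim assms in auto)
      also have "c + 1 - (a + 1) - (b + 1) = d - 1" by (simp add: d)
      finally have "F21 (a + 1) (b + 1) (c + 1) z = (1 - z) powr (d - 1) * F21 (c - a) (c - b) (c + 1) z" by simp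
      moreover have "(1 - z) powr (1 - d) * (1 - z) powr (d - 1) = 1"
        using elim by (simp add: powr_add[symmetric])
      moreover have "P * (a * b * (Q * u)) = a * b * ((P * Q) * u)" for P Q u
        by (simp add: algebra_simps)
      ultimately show ?case unfolding y1_def by simp
    qed
  qed
  have lY: "(Y \<longlongrightarrow> rGamma (1 - d)) (at_left 1)" and lZ0: "(Z0 \<longlongrightarrow> rGamma (1 + d)) (at_left 1)"
    unfolding Y_def Z0_def by (rule F21_tendsto_1)+
  have lY1: "(Y1 \<longlongrightarrow> - (a * b * rGamma (1 - d + 1))) (at_left 1)"
    unfolding Y1_def by (intro tendsto_minus tendsto_mult tendsto_const F21_tendsto_1)
  have lZ01: "(Z01 \<longlongrightarrow> - ((c - a) * (c - b) * rGamma (1 + d + 1))) (at_left 1)"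
    unfolding Z01_def by (intro tendsto_minus tendsto_mult tendsto_const F21_tendsto_1)
  have lZ: "(Z \<longlongrightarrow> 0) (at_left 1)"
    using tendsto_mult[OF p0[OF d(2)] lZ0] by (simp add: Z_def[abs_def])
  have lZ1: "((\<lambda>z. (1 - z) powr (1 - d) * Z1 z) \<longlongrightarrow> - rGamma d) (at_left 1)"
  proof (rule Lim_transform_eventually)
    have "((\<lambda>z. (1 - z) * Z01 z - d * Z0 z) \<longlongrightarrow> 0 * - ((c - a) * (c - b) * rGamma (1 + d + 1)) - d * rGamma (1 + d)) (at_left 1)"
      by (intro tendsto_diff tendsto_mult tendsto_const id0 lZ0 lZ01)
    thus "((\<lambda>z. (1 - z) * Z01 z - d * Z0 z) \<longlongrightarrow> - rGamma d) (at_left 1)"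
      using rGamma_plus1[of d] by (simp add: add.commute)
    show "\<forall>\<^sub>F z in at_left 1. (1 - z) * Z01 z - d * Z0 z = (1 - z) powr (1 - d) * Z1 z"
      using near
    proof eventually_elim
      case (elim z)
      have "(1 - z) powr (1 - d) * (1 - z) powr d = 1 - z" "(1 - z) powr (1 - d) * (1 - z) powr (d - 1) = 1"
        using elim by (simp_all add: powr_add[symmetric])
      moreover have "P * (Q * u - d * R * v) = (P * Q) * u - d * (P * R) * v" for P Q R u v :: real
        by (simp add: algebra_simps)
      ultimately show ?case unfolding Z1_def by simp
    qed
  qed
  have "((\<lambda>z. z powr c * (F21 a b c z * ((1 - z) powr (1 - d) * Y1 z) - Y z * ((1 - z) powr (1 - d) * y1 z))) \<longlongrightarrow>
      1 * (gy * (0 * - (a * b * rGamma (1 - d + 1))) - rGamma (1 - d) * g1)) (at_left 1)"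
    using d by (intro tendsto_mult tendsto_diff zc ly p0 lY1 lY ly1) auto
  moreover have "rGamma (1 - d) * g1 = rGamma a * rGamma b"
  proof -
    have "rGamma (1 - d) * g1 = (Gamma (1 - d) * rGamma (1 - d)) * (rGamma a * rGamma b)"
      by (simp add: g1_def)
    moreover have "Gamma (1 - d) * rGamma (1 - d) = 1" by (rule Gamma_rGamma) (use d(3) in simp)
    ultimately show ?thesis by (simp only: mult_1_left)
  qed
  ultimately have l1: "(wronskian a b c (F21 a b c) y1 Y Y1 \<longlongrightarrow> - (rGamma a * rGamma b)) (at_left 1)"
    unfolding wronskian_def[abs_def] m by (simp add: algebra_simps)
  have "((\<lambda>z. z powr c * (F21 a b c z * ((1 - z) powr (1 - d) * Z1 z) - Z z * ((1 - z) powr (1 - d) * y1 z))) \<longlongrightarrow>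
      1 * (gy * (- rGamma d) - 0 * g1)) (at_left 1)"
    by (intro tendsto_mult tendsto_diff zc ly lZ lZ1 ly1)
  moreover have "gy * rGamma d = rGamma (c - a) * rGamma (c - b)"
  proof -
    have "gy * rGamma d = (Gamma d * rGamma d) * (rGamma (c - a) * rGamma (c - b))"
      by (simp add: gy_def)
    thus ?thesis by (simp only: Gamma_rGamma[OF d(2)] mult_1_left)
  qed
  ultimately have l2: "(wronskian a b c (F21 a b c) y1 Z Z1 \<longlongrightarrow> - (rGamma (c - a) * rGamma (c - b))) (at_left 1)"
    unfolding wronskian_def[abs_def] m by (simp add: algebra_simps)
  have "((\<lambda>z. z powr c * (Y z * ((1 - z) powr (1 - d) * Z1 z) - Z z * ((1 - z) powr (1 - d) * Y1 z))) \<longlongrightarrow>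
      1 * (rGamma (1 - d) * (- rGamma d) - 0 * (0 * - (a * b * rGamma (1 - d + 1))))) (at_left 1)"
    using d by (intro tendsto_mult tendsto_diff zc lY p0 lZ lZ1 lY1) auto
  hence l3: "(wronskian a b c Y Y1 Z Z1 \<longlongrightarrow> - (sin (pi * d) / pi)) (at_left 1)"
    using rGamma_reflection_real[of d] unfolding wronskian_def[abs_def] m by (simp add: algebra_simps)
  have z': "z \<in> {0<..<1}" using z by simp
  note w1 = wronskian_eq[OF sy sY l1 trivial_limit_at_left_real eventually_unit_interval(2) z', unfolded wronskian_def m, folded p_def]
  note w2 = wronskian_eq[OF sy sZ l2 trivial_limit_at_left_real eventually_unit_interval(2) z', unfolded wronskian_def m, folded p_def]
  note w3 = wronskian_eq[OF sY sZ l3 trivial_limit_at_left_real eventually_unit_interval(2) z', unfolded wronskian_def m, folded p_def]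
  have "F21 a b c z * (p * (Y z * Z1 z - Z z * Y1 z)) - Y z * (p * (F21 a b c z * Z1 z - Z z * y1 z))
     + Z z * (p * (F21 a b c z * Y1 z - Y z * y1 z)) = 0"
    by (simp add: algebra_simps)
  hence "F21 a b c z * (sin (pi * d) / pi) = Y z * (rGamma (c - a) * rGamma (c - b)) - Z z * (rGamma a * rGamma b)"
    unfolding w1 w2 w3 by simp
  thus ?thesis by (simp add: Y_def Z_def Z0_def mult_ac)
qed

text \<open>At d = 0 the left side vanishes and the two terms on the right cancel. For d < 0 the
  positive case is applied to \<open>c - a\<close>, \<open>c - b\<close>, whose exponent is -d, and
  Euler's transformation converts back.\<close>

theorem F21_connection:
  assumes "0 < a" "0 < b" "0 < c" "0 < c - a" "0 < c - b" and d: "d = c - a - b" "\<bar>d\<bar> < 1" and z: "0 < z" "z < 1"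
  shows "sin (pi * d) / pi * F21 a b c z = rGamma (c - a) * rGamma (c - b) * F21 a b (1 - d) (1 - z)
     - rGamma a * rGamma b * ((1 - z) powr d * F21 (c - a) (c - b) (1 + d) (1 - z))"
proof -
  consider "d > 0" | "d = 0" | "d < 0" by linarith
  thus ?thesis
  proof cases
    case 1 thus ?thesis using assms by (intro F21_connection_pos) auto
  next
    case 2
    hence "c = a + b" using d by auto
    thus ?thesis using 2 z by (simp add: F21_commute[of a b])
  next
    case 3
    define F G H U V where "F = F21 (c - a) (c - b) c z" and "G = F21 (c - a) (c - b) (1 + d) (1 - z)"
      and "H = F21 a b (1 - d) (1 - z)" and "U = (1 - z) powr d" and "V = (1 - z) powr (- d)"
    note fold = F_def[symmetric] G_def[symmetric] H_def[symmetric] U_def[symmetric] V_def[symmetric]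
    have "sin (pi * (- d)) / pi * F21 (c - a) (c - b) c z = rGamma (c - (c - a)) * rGamma (c - (c - b)) * F21 (c - a) (c - b) (1 - - d) (1 - z)
      - rGamma (c - a) * rGamma (c - b) * ((1 - z) powr (- d) * F21 (c - (c - a)) (c - (c - b)) (1 + - d) (1 - z))"
      using assms 3 by (intro F21_connection_pos) auto
    hence neg: "- (sin (pi * d) / pi * F) = rGamma a * rGamma b * G - rGamma (c - a) * rGamma (c - b) * (V * H)"
      by (simp add: fold)
    have "sin (pi * d) / pi * (U * F) = - U * (- (sin (pi * d) / pi * F))" by simp
    also have "\<dots> = U * V * (rGamma (c - a) * rGamma (c - b) * H) - rGamma a * rGamma b * (U * G)"
      unfolding neg by (simp add: algebra_simps)
    finally have "sin (pi * d) / pi * (U * F) = U * V * (rGamma (c - a) * rGamma (c - b) * H) - rGamma a * rGamma b * (U * G)" .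
    moreover have "U * V = 1" using z by (simp add: U_def V_def powr_add[symmetric])
    moreover have "F21 a b c z = U * F"
      unfolding d U_def F_def by (rule F21_Euler) (use assms in auto)
    ultimately show ?thesis unfolding fold by simp
  qed
qed

section \<open>Integral representation of the \<open>4F3\<close> series\<close>

lemma F21_moment:
  assumes "0 < r" "0 < q" "0 < a" "0 < b" "a + b < r + q"
  shows "(\<integral>\<^sup>+t\<in>{0<..<1}. ennreal (t powr (r - 1) * ((1 - t) powr (q - 1) * F21 a b q (1 - t))) \<partial>lborel)
     = ennreal (Gamma r * (Gamma (r + q - a - b) * rGamma (r + q - a) * rGamma (r + q - b)))"
proof -
  have "(\<integral>\<^sup>+t\<in>{0<..<1}. ennreal (t powr (r - 1) * ((1 - t) powr (q - 1) * F21 a b q (1 - t))) \<partial>lborel)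
     = (\<Sum>n. ennreal (hcoeff a b q n * Beta r (q + real n)))"
  proof (rule nn_integral_sums[where f = "\<lambda>n t. hcoeff a b q n * (t powr (r - 1) * (1 - t) powr (q + real n - 1))"])
    fix t :: real assume t: "0 < t" "t < 1"
    have "(\<lambda>n. hcoeff a b q n * (1 - t) ^ n * (t powr (r - 1) * (1 - t) powr (q - 1))) sums
       (F21 a b q (1 - t) * (t powr (r - 1) * (1 - t) powr (q - 1)))"
      unfolding F21_def by (intro sums_mult2 summable_sums summable_hcoeff) (use t in auto)
    moreover have "(1 - t) powr (q + real n - 1) = (1 - t) ^ n * (1 - t) powr (q - 1)" for n
      using t powr_add[of "1 - t" "real n" "q - 1"] by (simp add: powr_realpow algebra_simps)
    ultimately show "(\<lambda>n. hcoeff a b q n * (t powr (r - 1) * (1 - t) powr (q + real n - 1))) sums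
        (t powr (r - 1) * ((1 - t) powr (q - 1) * F21 a b q (1 - t)))"
      by (simp add: mult_ac)
  next
    fix n
    show "(\<integral>\<^sup>+t\<in>{0<..<1}. ennreal (hcoeff a b q n * (t powr (r - 1) * (1 - t) powr (q + real n - 1))) \<partial>lborel)
      = ennreal (hcoeff a b q n * Beta r (q + real n))"
      by (rule nn_integral_scale[OF _ _ nn_integral_Beta]) (use assms less_imp_le[OF hcoeff_pos[of a b q n]] in auto)
  qed (use assms in \<open>auto intro!: mult_nonneg_nonneg less_imp_le[OF hcoeff_pos]\<close>)
  also have "(\<lambda>n. hcoeff a b q n * Beta r (q + real n)) = (\<lambda>n. Gamma r * hcoeff a b (r + q) n)"
  proof
    fix n
    have "hcoeff a b q n * Beta r (q + real n) = Gamma r * (pochhammer a n * pochhammer b n / fact n * rGamma (r + q + real n))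
        * (Gamma (q + real n) * rGamma (q + real n))"
      by (simp add: hcoeff_def Beta_altdef algebra_simps)
    thus "hcoeff a b q n * Beta r (q + real n) = Gamma r * hcoeff a b (r + q) n" using assms by (simp add: Gamma_rGamma hcoeff_def)
  qed
  also have "(\<Sum>n. ennreal (Gamma r * hcoeff a b (r + q) n)) = ennreal (Gamma r * (Gamma (r + q - a - b) * rGamma (r + q - a) * rGamma (r + q - b)))"
    using assms by (intro suminf_ennreal_eq sums_mult Gauss_sums mult_nonneg_nonneg less_imp_le[OF hcoeff_pos] less_imp_le[OF Gamma_real_pos]) auto
  finally show ?thesis .
qed

definition F43_termR where
  "F43_termR A B C D E F G k = pochhammer A k * pochhammer B k * pochhammer C k * pochhammer D k / fact k
          * rGamma (of_nat k + E) * rGamma (of_nat k + F) * rGamma (of_nat k + G)"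
  for A :: real

text \<open>By \<open>F21_moment\<close> with r = a + n, the (1 - t)-factor has moments Gamma(a+n)
  Gamma(d+n) / (Gamma(f+n) Gamma(g+n)). Integrating the powers of t in \<open>F21 b c e t\<close>
  termwise thus attaches the upper parameters \<open>a\<close>, \<open>d\<close> and the lower
  parameters \<open>f\<close>, \<open>g\<close> to the series.\<close>

lemma F43_integral:
  assumes pos: "0 < a" "0 < b" "0 < c" "0 < d" "0 < e" "0 < f" "0 < g" "0 < f - d" "0 < g - d" "0 < q"
    and q: "q = f + g - a - d" and s: "summable (F43_termR a b c d e f g)"
  shows "(\<integral>\<^sup>+t\<in>{0<..<1}. ennreal (t powr (a - 1) * F21 b c e t * ((1 - t) powr (q - 1) * F21 (f - d) (g - d) q (1 - t))) \<partial>lborel)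
    = ennreal (Gamma a * Gamma d * suminf (F43_termR a b c d e f g))"
proof -
  have [measurable]: "(\<lambda>t. F21 a b c (1 - t)) \<in> borel_measurable borel" "F21 a b c \<in> borel_measurable borel" for a b c
    unfolding F21_def by measurable
  have "(\<integral>\<^sup>+t\<in>{0<..<1}. ennreal (t powr (a - 1) * F21 b c e t * ((1 - t) powr (q - 1) * F21 (f - d) (g - d) q (1 - t))) \<partial>lborel)
     = (\<Sum>n. ennreal (hcoeff b c e n * (Gamma (a + real n) * (Gamma (d + real n) * rGamma (g + real n) * rGamma (f + real n)))))"
  proof (rule nn_integral_sums[where f = "\<lambda>n t. hcoeff b c e n * (t powr (a + real n - 1) * ((1 - t) powr (q - 1) * F21 (f - d) (g - d) q (1 - t)))"])
    fix t :: real assume t: "0 < t" "t < 1"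
    have "(\<lambda>n. hcoeff b c e n * t ^ n * (t powr (a - 1) * ((1 - t) powr (q - 1) * F21 (f - d) (g - d) q (1 - t)))) sums
       (F21 b c e t * (t powr (a - 1) * ((1 - t) powr (q - 1) * F21 (f - d) (g - d) q (1 - t))))"
      unfolding F21_def[of b] by (intro sums_mult2 summable_sums summable_hcoeff) (use t in auto)
    moreover have "t powr (a + real n - 1) = t ^ n * t powr (a - 1)" for n
      using t powr_add[of t "real n" "a - 1"] by (simp add: powr_realpow algebra_simps)
    ultimately show "(\<lambda>n. hcoeff b c e n * (t powr (a + real n - 1) * ((1 - t) powr (q - 1) * F21 (f - d) (g - d) q (1 - t)))) sums
        (t powr (a - 1) * F21 b c e t * ((1 - t) powr (q - 1) * F21 (f - d) (g - d) q (1 - t)))"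
      by (simp add: mult_ac)
    fix n
    show "0 \<le> hcoeff b c e n * (t powr (a + real n - 1) * ((1 - t) powr (q - 1) * F21 (f - d) (g - d) q (1 - t)))"
      using t pos by (intro mult_nonneg_nonneg less_imp_le[OF hcoeff_pos] less_imp_le[OF F21_pos]) auto
  next
    fix n
    have "(\<integral>\<^sup>+t\<in>{0<..<1}. ennreal (t powr (a + real n - 1) * ((1 - t) powr (q - 1) * F21 (f - d) (g - d) q (1 - t))) \<partial>lborel)
      = ennreal (Gamma (a + real n) * (Gamma (a + real n + q - (f - d) - (g - d)) * rGamma (a + real n + q - (f - d)) * rGamma (a + real n + q - (g - d))))"
      using pos by (intro F21_moment) (auto simp: q)
    moreover have "a + real n + q - (f - d) - (g - d) = d + real n" "a + real n + q - (f - d) = g + real n" "a + real n + q - (g - d) = f + real n"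
      by (simp_all add: q)
    ultimately have "(\<integral>\<^sup>+t\<in>{0<..<1}. ennreal (t powr (a + real n - 1) * ((1 - t) powr (q - 1) * F21 (f - d) (g - d) q (1 - t))) \<partial>lborel)
      = ennreal (Gamma (a + real n) * (Gamma (d + real n) * rGamma (g + real n) * rGamma (f + real n)))"
      by (simp only:)
    thus "(\<integral>\<^sup>+t\<in>{0<..<1}. ennreal (hcoeff b c e n * (t powr (a + real n - 1) * ((1 - t) powr (q - 1) * F21 (f - d) (g - d) q (1 - t)))) \<partial>lborel)
     = ennreal (hcoeff b c e n * (Gamma (a + real n) * (Gamma (d + real n) * rGamma (g + real n) * rGamma (f + real n))))"
      by (intro nn_integral_scale less_imp_le[OF hcoeff_pos] pos) measurable
  qed measurable
  also have "(\<lambda>n. hcoeff b c e n * (Gamma (a + real n) * (Gamma (d + real n) * rGamma (g + real n) * rGamma (f + real n)))) =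
      (\<lambda>n. Gamma a * Gamma d * F43_termR a b c d e f g n)"
  proof
    fix n
    have "Gamma (a + real n) = Gamma a * pochhammer a n" "Gamma (d + real n) = Gamma d * pochhammer d n"
      using pos Gamma_rGamma[of a] Gamma_rGamma[of d] by (simp_all add: pochhammer_rGamma mult_ac)
    thus "hcoeff b c e n * (Gamma (a + real n) * (Gamma (d + real n) * rGamma (g + real n) * rGamma (f + real n))) = Gamma a * Gamma d * F43_termR a b c d e f g n"
      by (simp add: hcoeff_def F43_termR_def add.commute)
  qed
  also have "(\<Sum>n. ennreal (Gamma a * Gamma d * F43_termR a b c d e f g n)) = ennreal (Gamma a * Gamma d * suminf (F43_termR a b c d e f g))"
  proof (rule suminf_ennreal_eq)
    show "0 \<le> Gamma a * Gamma d * F43_termR a b c d e f g n" for n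
      unfolding F43_termR_def using pos
      by (intro mult_nonneg_nonneg divide_nonneg_pos less_imp_le[OF pochhammer_pos] less_imp_le[OF rGamma_pos] less_imp_le[OF Gamma_real_pos] add_nonneg_pos) auto
    show "(\<lambda>n. Gamma a * Gamma d * F43_termR a b c d e f g n) sums (Gamma a * Gamma d * suminf (F43_termR a b c d e f g))"
      using s by (intro sums_mult summable_sums)
  qed
  finally show ?thesis .
qed

subsection \<open>The series \<open>4F3(1)\<close> as an entire function\<close>

definition F43_term where
  "F43_term A B C D E F G k = pochhammer A k * pochhammer B k * pochhammer C k * pochhammer D k / fact k
          * rGamma (of_nat k + E) * rGamma (of_nat k + F) * rGamma (of_nat k + G)"
  for A :: complex

text \<open>Cross-multiplied, so that it remains valid where a factor k + E, k + F or k + G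
  vanishes.\<close>

lemma F43_term_Suc:
  "F43_term A B C D E F G (Suc k) * ((of_nat k + 1) * (of_nat k + E) * (of_nat k + F) * (of_nat k + G)) =
   F43_term A B C D E F G k * ((of_nat k + A) * (of_nat k + B) * (of_nat k + C) * (of_nat k + D))"
proof -
  have alg: "(P * a * (Q * b) * (R * c) * (S * d) / (m * F) * u * v * w) * (m * e * f * g)
      = (P * Q * R * S / F * (e * u) * (f * v) * (g * w)) * (a * b * c * d)"
    if "m \<noteq> 0" "F \<noteq> 0" for P Q R S F a b c d e f g u v w m :: complex
    using that by (simp add: field_simps)
  have r: "rGamma (of_nat k + z) = (of_nat k + z) * rGamma (of_nat (Suc k) + z)" for z :: complex
    using rGamma_plus1[of "of_nat k + z"] by (simp add: add_ac)
  have f: "fact (Suc k) = (of_nat k + 1) * (fact k :: complex)" by simp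
  have "of_nat k + 1 \<noteq> (0::complex)" by (metis of_nat_Suc of_nat_eq_0_iff nat.simps(3) add.commute)
  moreover have "z + of_nat k = of_nat k + z" for z :: complex by simp
  ultimately show ?thesis
    unfolding F43_term_def pochhammer_Suc f r[of E] r[of F] r[of G] by (simp only: alg fact_nonzero not_False_eq_True)
qed

text \<open>The ratio has the form 1 - 2/k + O(1/k^2). Comparing with the smaller exponent 3/2
  leaves slack to absorb the error, while the majorant is still summable.\<close>

lemma F43_term_locally_bounded:
  fixes A B C D E F G :: "complex \<Rightarrow> complex" and S :: "complex set"
  assumes S: "compact S"
    and cont: "continuous_on S A" "continuous_on S B" "continuous_on S C" "continuous_on S D"
      "continuous_on S E" "continuous_on S F" "continuous_on S G"
    and saal: "\<And>z. z \<in> S \<Longrightarrow> E z + F z + G z - A z - B z - C z - D z = 1"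
  shows "\<exists>c. eventually (\<lambda>k. \<forall>z\<in>S. norm (F43_term (A z) (B z) (C z) (D z) (E z) (F z) (G z) k) \<le> c * real k powr (- 3 / 2)) sequentially"
proof -
  define T where "T = (\<lambda>k z. F43_term (A z) (B z) (C z) (D z) (E z) (F z) (G z) k)"
  have bd: "\<exists>M\<ge>0. \<forall>z\<in>S. norm (f z) \<le> M" if "continuous_on S f" for f :: "complex \<Rightarrow> complex"
  proof -
    have "bounded (f ` S)" using that S by (intro compact_imp_bounded compact_continuous_image)
    then obtain M where "\<forall>z\<in>S. norm (f z) \<le> M" by (auto simp: bounded_iff)
    thus ?thesis by (intro exI[of _ "\<bar>M\<bar>"]) (auto intro: order.trans)
  qed
  define s2 where "s2 = (\<lambda>z. A z * B z + A z * C z + A z * D z + B z * C z + B z * D z + C z * D z)"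
  define s3 where "s3 = (\<lambda>z. A z * B z * C z + A z * B z * D z + A z * C z * D z + B z * C z * D z)"
  define s4 where "s4 = (\<lambda>z. A z * B z * C z * D z)"
  define d1 where "d1 = (\<lambda>z. 1 + E z + F z + G z)"
  define d2 where "d2 = (\<lambda>z. E z + F z + G z + E z * F z + E z * G z + F z * G z)"
  define d3 where "d3 = (\<lambda>z. E z * F z + E z * G z + F z * G z + E z * F z * G z)"
  define d4 where "d4 = (\<lambda>z. E z * F z * G z)"
  define c3 c2 c1 c0 where "c3 = (\<lambda>z. s2 z - d2 z + 2 * d1 z)" and "c2 = (\<lambda>z. s3 z - d3 z + 2 * d2 z)"
    and "c1 = (\<lambda>z. s4 z - d4 z + 2 * d3 z)" and "c0 = (\<lambda>z. 2 * d4 z)"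
  note defs = c3_def c2_def c1_def c0_def s2_def s3_def s4_def d1_def d2_def d3_def d4_def
  define N where "N = (\<lambda>x z. (x + A z) * (x + B z) * (x + C z) * (x + D z))"
  define L where "L = (\<lambda>x z. (x + 1) * (x + E z) * (x + F z) * (x + G z))"
  \<comment> \<open>As \<open>E + F + G - A - B - C - D = 1\<close>, the ratio of consecutive terms is \<open>1 - 2 / k + O(1 / k\<^sup>2)\<close>, uniformly on \<open>S\<close>.\<close>
  have poly: "x * N x z = (x - 2) * L x z + (c3 z * x ^ 3 + c2 z * x ^ 2 + c1 z * x + c0 z)" if "z \<in> S" for x z
  proof -
    have E: "E z = 1 - F z - G z + A z + B z + C z + D z" using saal[OF that] by (simp add: algebra_simps)
    show ?thesis unfolding N_def L_def defs E
      by (simp add: algebra_simps power2_eq_square power3_eq_cube)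
  qed
  have "continuous_on S c3" "continuous_on S c2" "continuous_on S c1" "continuous_on S c0"
    unfolding defs by (intro continuous_intros cont)+
  then obtain M3 M2 M1 M0 where M: "\<And>z. z \<in> S \<Longrightarrow> norm (c3 z) \<le> M3" "\<And>z. z \<in> S \<Longrightarrow> norm (c2 z) \<le> M2"
    "\<And>z. z \<in> S \<Longrightarrow> norm (c1 z) \<le> M1" "\<And>z. z \<in> S \<Longrightarrow> norm (c0 z) \<le> M0" "M3 \<ge> 0" "M2 \<ge> 0" "M1 \<ge> 0" "M0 \<ge> 0"
    using bd by metis
  obtain ME MF MG where ME: "\<And>z. z \<in> S \<Longrightarrow> norm (E z) \<le> ME" "\<And>z. z \<in> S \<Longrightarrow> norm (F z) \<le> MF" "\<And>z. z \<in> S \<Longrightarrow> norm (G z) \<le> MG"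
    using bd cont by metis
  \<comment> \<open>The constants fit together as follows: |L| is at least k^4/8, since three of its
    factors may lose one half each. The cubic remainder, at most K k^3, is to be at most |L|/4,
    whence 32 K. The ratio is then at most 1 - (2 - 1/4)/k = 1 - 7/(4k), and 7/4 > 3/2 lets the
    quotient of the powers k^(-3/2) dominate it.\<close>
  define K where "K = M3 + M2 + M1 + M0"
  have "eventually (\<lambda>k. real k \<ge> 2 * ME \<and> real k \<ge> 2 * MF \<and> real k \<ge> 2 * MG \<and> real k \<ge> 32 * K \<and> real k \<ge> 2
     \<and> 1 - 7 / (4 * real k) \<le> (real (Suc k) powr (- 3 / 2)) / (real k powr (- 3 / 2))) sequentially"
  proof -
    have "eventually (\<lambda>k. real k \<ge> r) sequentially" for r
      using filterlim_real_sequentially by (simp add: filterlim_at_top)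
    moreover have "eventually (\<lambda>k. 1 - 7 / (4 * real k) \<le> (real (Suc k) powr (- 3 / 2)) / (real k powr (- 3 / 2))) sequentially"
      by real_asymp
    ultimately show ?thesis by (intro eventually_conj)
  qed
  then obtain k0 where k0: "\<And>k. k \<ge> k0 \<Longrightarrow> real k \<ge> 2 * ME \<and> real k \<ge> 2 * MF \<and> real k \<ge> 2 * MG \<and> real k \<ge> 32 * K \<and> real k \<ge> 2
     \<and> 1 - 7 / (4 * real k) \<le> (real (Suc k) powr (- 3 / 2)) / (real k powr (- 3 / 2))"
    unfolding eventually_sequentially by blast
  have step: "norm (T (Suc k) z) \<le> norm (T k z) * (real (Suc k) powr (- 3 / 2) / real k powr (- 3 / 2))" if k: "k \<ge> k0" and z: "z \<in> S" for k z
  proof -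
    define x :: complex where "x = of_nat k"
    have nx: "norm x = real k" by (simp add: x_def)
    have kk: "real k \<ge> 2" using k0[OF k] by simp
    have half: "norm (x + w) \<ge> real k / 2" if "norm w \<le> m" "real k \<ge> 2 * m" for w m
      using norm_diff_ineq[of x w] nx that by linarith
    have x1: "norm (x + 1) \<ge> real k"
    proof -
      have "x + 1 = of_nat (Suc k)" by (simp add: x_def)
      hence "norm (x + 1) = real (Suc k)" by (simp only: norm_of_nat)
      thus ?thesis by simp
    qed
    have "real k * (real k / 2) * (real k / 2) * (real k / 2) \<le> norm (x + 1) * norm (x + E z) * norm (x + F z) * norm (x + G z)"
      using x1 half[OF ME(1)[OF z]] half[OF ME(2)[OF z]] half[OF ME(3)[OF z]] k0[OF k]
      by (intro mult_mono mult_nonneg_nonneg) auto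
    hence L1: "real k ^ 4 / 8 \<le> norm (L x z)"
      by (simp add: L_def norm_mult power4_eq_xxxx)
    have Lpos: "0 < norm (L x z)" using L1 kk by (smt (verit) divide_pos_pos zero_less_power)
    have "norm (c3 z * x ^ 3 + c2 z * x ^ 2 + c1 z * x + c0 z) \<le> norm (c3 z * x ^ 3) + norm (c2 z * x ^ 2) + norm (c1 z * x) + norm (c0 z)"
      by (intro norm_triangle_le add_mono order.refl norm_triangle_ineq)
    also have "\<dots> \<le> M3 * real k ^ 3 + M2 * real k ^ 3 + M1 * real k ^ 3 + M0 * real k ^ 3"
    proof (intro add_mono)
      show "norm (c3 z * x ^ 3) \<le> M3 * real k ^ 3"
        using M z by (simp add: norm_mult norm_power nx mult_right_mono)
      have "norm (c2 z) * real k ^ 2 \<le> M2 * real k ^ 3"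
        using M z kk by (intro mult_mono power_increasing) auto
      thus "norm (c2 z * x ^ 2) \<le> M2 * real k ^ 3" by (simp add: norm_mult norm_power nx)
      have "norm (c1 z) * real k ^ 1 \<le> M1 * real k ^ 3"
        using M z kk by (intro mult_mono power_increasing) auto
      thus "norm (c1 z * x) \<le> M1 * real k ^ 3" by (simp add: norm_mult norm_power nx)
      have "norm (c0 z) * real k ^ 0 \<le> M0 * real k ^ 3"
        using M z kk by (intro mult_mono power_increasing) auto
      thus "norm (c0 z) \<le> M0 * real k ^ 3" by simp
    qed
    also have "\<dots> = K * real k ^ 3" by (simp add: K_def algebra_simps)
    finally have rest: "norm (c3 z * x ^ 3 + c2 z * x ^ 2 + c1 z * x + c0 z) \<le> K * real k ^ 3" .
    have "K * real k ^ 3 \<le> (real k / 32) * real k ^ 3"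
      using k0[OF k] by (intro mult_right_mono) auto
    also have "\<dots> = (real k ^ 4 / 8) / 4" by (simp add: power4_eq_xxxx power3_eq_cube)
    also have "\<dots> \<le> norm (L x z) / 4" using L1 by simp
    finally have rest2: "K * real k ^ 3 \<le> norm (L x z) / 4" .
    have "real k * norm (N x z) = norm (x * N x z)" by (simp add: norm_mult nx)
    also have "\<dots> \<le> norm ((x - 2) * L x z) + norm (c3 z * x ^ 3 + c2 z * x ^ 2 + c1 z * x + c0 z)"
      unfolding poly[OF z] by (rule norm_triangle_ineq)
    also have "norm ((x - 2) * L x z) = (real k - 2) * norm (L x z)"
    proof -
      have "x - 2 = of_real (real k - 2)" by (simp add: x_def)
      hence "norm (x - 2) = \<bar>real k - 2\<bar>" by (simp only: norm_of_real)
      thus ?thesis using kk by (simp add: norm_mult)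
    qed
    also have "(real k - 2) * norm (L x z) + norm (c3 z * x ^ 3 + c2 z * x ^ 2 + c1 z * x + c0 z) \<le> (real k - 2) * norm (L x z) + norm (L x z) / 4"
      using rest rest2 by linarith
    also have "\<dots> = real k * ((1 - 7 / (4 * real k)) * norm (L x z))"
      using kk by (simp add: field_simps)
    finally have "norm (N x z) \<le> (1 - 7 / (4 * real k)) * norm (L x z)" using kk by simp
    also have "\<dots> \<le> (real (Suc k) powr (- 3 / 2) / real k powr (- 3 / 2)) * norm (L x z)"
      using k0[OF k] by (intro mult_right_mono) auto
    finally have NL: "norm (N x z) \<le> (real (Suc k) powr (- 3 / 2) / real k powr (- 3 / 2)) * norm (L x z)" .
    have "norm (T (Suc k) z) * norm (L x z) = norm (T k z) * norm (N x z)"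
      using F43_term_Suc[of "A z" "B z" "C z" "D z" "E z" "F z" "G z" k]
      unfolding T_def L_def N_def x_def norm_mult[symmetric] by (simp only: mult.assoc)
    also have "\<dots> \<le> norm (T k z) * ((real (Suc k) powr (- 3 / 2) / real k powr (- 3 / 2)) * norm (L x z))"
      by (intro mult_left_mono NL) auto
    finally have "norm (T (Suc k) z) * norm (L x z) \<le> (norm (T k z) * (real (Suc k) powr (- 3 / 2) / real k powr (- 3 / 2))) * norm (L x z)"
      by (simp only: mult.assoc)
    thus ?thesis using Lpos by (rule mult_right_le_imp_le)
  qed
  have "continuous_on S (T k0)"
    unfolding T_def F43_term_def pochhammer_prod
    by (intro continuous_intros cont continuous_on_compose2[OF continuous_on_rGamma[of UNIV]]) auto
  then obtain M where M: "M \<ge> 0" "\<And>z. z \<in> S \<Longrightarrow> norm (T k0 z) \<le> M" using bd by blast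
  define c where "c = M / real k0 powr (- 3 / 2)"
  have "norm (T k z) \<le> c * real k powr (- 3 / 2)" if "k \<ge> k0" "z \<in> S" for k z
    using that(1)
  proof (induction k rule: dec_induct)
    case base
    have "real k0 > 0" using k0[of k0] by simp
    thus ?case using M(2)[OF that(2)] by (simp add: c_def)
  next
    case (step k)
    have "real k > 0" using k0[of k] step by simp
    have "norm (T (Suc k) z) \<le> norm (T k z) * (real (Suc k) powr (- 3 / 2) / real k powr (- 3 / 2))"
      using step(1) that(2) by (rule \<open>\<And>k z. k0 \<le> k \<Longrightarrow> z \<in> S \<Longrightarrow> norm (T (Suc k) z) \<le> _ k z\<close>)
    also have "\<dots> \<le> (c * real k powr (- 3 / 2)) * (real (Suc k) powr (- 3 / 2) / real k powr (- 3 / 2))"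
      using step by (intro mult_right_mono) auto
    also have "\<dots> = c * real (Suc k) powr (- 3 / 2)" using \<open>real k > 0\<close> by simp
    finally show ?case .
  qed
  thus ?thesis unfolding eventually_sequentially T_def by blast
qed

lemma summable_three_halves: "summable (\<lambda>k. c * real k powr (- 3 / 2))"
  by (intro summable_mult) (simp add: summable_real_powr_iff)

lemma summable_F43_term:
  assumes "E + F + G - A - B - C - D = 1"
  shows "summable (F43_term A B C D E F G)"
proof -
  obtain c where "eventually (\<lambda>k. \<forall>z\<in>{0::complex}. norm (F43_term A B C D E F G k) \<le> c * real k powr (- 3 / 2)) sequentially"
    using F43_term_locally_bounded[of "{0}" "\<lambda>_. A" "\<lambda>_. B" "\<lambda>_. C" "\<lambda>_. D" "\<lambda>_. E" "\<lambda>_. F" "\<lambda>_. G"] assms by auto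
  hence "eventually (\<lambda>k. norm (F43_term A B C D E F G k) \<le> c * real k powr (- 3 / 2)) sequentially" by simp
  thus ?thesis using summable_three_halves by (rule summable_comparison_test_ev)
qed

lemma F43_reg_eq: "F43_reg A B C D E F G = suminf (F43_term A B C D E F G)"
  unfolding F43_reg_def F43_term_def ..

text \<open>Stated along one-variable families of parameters, because the continuation to
  \<open>VV\<close> frees one coordinate at a time.\<close>

theorem F43_reg_holomorphic:
  assumes "A holomorphic_on UNIV" "B holomorphic_on UNIV" "C holomorphic_on UNIV" "D holomorphic_on UNIV"
    "E holomorphic_on UNIV" "F holomorphic_on UNIV" "G holomorphic_on UNIV"
    and saal: "\<And>z. E z + F z + G z - A z - B z - C z - D z = 1"
  shows "(\<lambda>z. F43_reg (A z) (B z) (C z) (D z) (E z) (F z) (G z)) holomorphic_on UNIV"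
proof (rule holomorphic_uniform_sequence[where f = "\<lambda>n z. \<Sum>k<n. F43_term (A z) (B z) (C z) (D z) (E z) (F z) (G z) k"])
  fix n
  show "(\<lambda>z. \<Sum>k<n. F43_term (A z) (B z) (C z) (D z) (E z) (F z) (G z) k) holomorphic_on UNIV"
    unfolding F43_term_def by (intro holomorphic_intros assms) auto
next
  fix x :: complex
  have c: "continuous_on (cball x 1) f" if "f holomorphic_on UNIV" for f :: "complex \<Rightarrow> complex"
    using that by (meson holomorphic_on_imp_continuous_on continuous_on_subset subset_UNIV)
  obtain c where c: "eventually (\<lambda>k. \<forall>z\<in>cball x 1. norm (F43_term (A z) (B z) (C z) (D z) (E z) (F z) (G z) k) \<le> c * real k powr (- 3 / 2)) sequentially"
    using F43_term_locally_bounded[OF compact_cball c c c c c c c, OF assms(1-7) saal] by blast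
  show "\<exists>d>0. cball x d \<subseteq> UNIV \<and> uniform_limit (cball x d) (\<lambda>n z. \<Sum>k<n. F43_term (A z) (B z) (C z) (D z) (E z) (F z) (G z) k)
      (\<lambda>z. F43_reg (A z) (B z) (C z) (D z) (E z) (F z) (G z)) sequentially"
    unfolding F43_reg_eq
    by (rule exI[of _ 1]) (use Weierstrass_m_test_ev[OF c summable_three_halves] in simp)
qed simp

subsection \<open>Trigonometric identities\<close>

lemma cos_cos_eq: "cos x * cos x = 1 - sin x * sin (x::'a::{real_normed_field,banach})"
  using sin_cos_squared_add3[of x] by (simp add: algebra_simps)

lemma cos_cos_eq': "cos x * (cos x * w) = w - sin x * (sin (x::'a::{real_normed_field,banach}) * w)"
  by (simp only: mult.assoc[symmetric] cos_cos_eq) (simp add: algebra_simps)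

text \<open>The explicit factor sin(c - b) shows that the singularities of gamma are removable and
  supplies the entire cofactor.\<close>

lemma gam_bracket:
  fixes a b c e f g :: complex
  shows "sin (a - c) * sin (e - a - b) * sin (f - b) * sin (g - b) - sin (a - b) * sin (e - a - c) * sin (f - c) * sin (g - c)
    = sin (c - b) * ((cos (f - g) * sin (2 * a - e) + sin (e + f + g - 2 * a - b - c) * cos (b - c) - cos (e - b - c) * sin (f + g - b - c)) / 2)"
proof -
  define x y where "x = a - c" and "y = c - b"
  define A B where "A = f - g" and "B = 2 * a - e"
  define h where "h = f + g - b - c"
  have 1: "sin (a - c) * sin (e - a - b) = (cos (B + (b - c)) - cos (e - (b + c))) / 2"
    "sin (a - b) * sin (e - a - c) = (cos (B - (b - c)) - cos (e - (b + c))) / 2"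
    unfolding sin_times_sin by (simp_all add: B_def algebra_simps)
  have 2: "sin (f - b) * sin (g - b) = (cos A - cos (h - (b - c))) / 2" "sin (f - c) * sin (g - c) = (cos A - cos (h + (b - c))) / 2"
    unfolding sin_times_sin by (simp_all add: A_def h_def algebra_simps)
  have 3: "e + f + g - 2 * a - b - c = h - B" "e - b - c = e - (b + c)" "f + g - b - c = h" "c - b = - (b - c)" "f - g = A" "2 * a - e = B"
    by (simp_all add: h_def A_def B_def)
  define cB sB ch sh cd sd where "cB = cos B" and "sB = sin B" and "ch = cos h" and "sh = sin h" and "cd = cos (b - c)" and "sd = sin (b - c)"
  have e: "cd * cd = 1 - sd * sd" "cd * (cd * w) = w - sd * (sd * w)" for w
    unfolding cd_def sd_def by (rule cos_cos_eq cos_cos_eq')+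
  have "(sin (a - c) * sin (e - a - b)) * (sin (f - b) * sin (g - b)) - (sin (a - b) * sin (e - a - c)) * (sin (f - c) * sin (g - c))
    = sin (c - b) * ((cos (f - g) * sin (2 * a - e) + sin (e + f + g - 2 * a - b - c) * cos (b - c) - cos (e - b - c) * sin (f + g - b - c)) / 2)"
    unfolding 1 2 3 cos_add cos_diff[of _ "b - c"] sin_diff[of h] sin_minus
      cB_def[symmetric] sB_def[symmetric] ch_def[symmetric] sh_def[symmetric] cd_def[symmetric] sd_def[symmetric]
    by (simp add: field_simps e)
  thus ?thesis by (simp add: mult.assoc)
qed

text \<open>After product-to-sum conversion this is the coefficient of the first \<open>K\<close> in
  the three-term relation. It is odd in \<rho>, so sin \<rho> splits off.\<close>

lemma connection_determinant:
  fixes p \<rho> \<epsilon> P R :: "'a::{real_normed_field,banach}"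
  shows "(R + cos (p + \<rho>)) * (P - cos (\<epsilon> - \<rho>)) - (R + cos (p - \<rho>)) * (P - cos (\<epsilon> + \<rho>))
     = - 2 * sin \<rho> * (P * sin p + R * sin \<epsilon> - cos \<rho> * sin (p - \<epsilon>))"
proof -
  note e = cos_cos_eq[of \<rho>] cos_cos_eq'[of \<rho>]
  show ?thesis unfolding cos_add cos_diff sin_diff by (simp add: algebra_simps e)
qed

text \<open>The coefficient of \<open>K_p0\<close>, divided by \<open>sin \<pi>(e - b)\<close>, in a form without removable singularities: here
  \<open>p = \<pi>(a - d)\<close>, \<open>q = \<pi>(a + d - e)\<close>, \<open>r = \<pi>(e - 1)\<close>, \<open>h = \<pi>(e - d) - \<pi>/2\<close>, and \<open>P\<close>, \<open>Q\<close>, \<open>R\<close> are the cosines of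
  \<open>\<pi>(b - c)\<close>, \<open>\<pi>(b + c - e)\<close>, \<open>\<pi>(f - g)\<close>.\<close>

definition coeff_factor :: "'a \<Rightarrow> 'a \<Rightarrow> 'a \<Rightarrow> 'a \<Rightarrow> 'a \<Rightarrow> 'a \<Rightarrow> 'a \<Rightarrow> 'a::{real_normed_field,banach}" where
  "coeff_factor p q r P Q R h = - 1 / 4 * (((Q * cos r + P) * (sin p * (R * cos q + P) + sin q * (Q + R * cos p))
        - sin r * (R + Q * cos p) * (R * cos q + P)) * cos h
      + sin r * sin q * ((R\<^sup>2 + Q\<^sup>2) * sin h + R * Q * (2 * cos p * sin h - sin p * cos h) - sin p * cos (h - p)))"

text \<open>The elimination produces the left side as the coefficient of \<open>K_p0\<close>, while
  the other coefficients carry a factor sin p. This identity supplies that factor here, with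
  \<open>coeff_factor\<close> as the quotient.\<close>

lemma elimination_identity:
  fixes p :: "'a::{real_normed_field,banach}"
  shows "- 1 / 4 * ((Q * sin (p - r) + P * sin p - R * sin r) * (R * sin (p + q) + P * sin p + Q * sin q) * cos h
     + sin r * sin q * (R\<^sup>2 + 2 * R * Q * cos p + Q\<^sup>2 - (sin p)\<^sup>2) * cos (h - p)) = sin p * coeff_factor p q r P Q R h"
proof -
  note e = cos_cos_eq[of p] cos_cos_eq'[of p]
  show ?thesis unfolding coeff_factor_def cos_add cos_diff sin_diff sin_add power2_eq_square by (simp add: algebra_simps e)
qed

subsection \<open>Three-term relations for real parameters\<close>

lemma F43_term_of_real: "F43_term (of_real A) (of_real B) (of_real C) (of_real D) (of_real E) (of_real F) (of_real G) k
   = of_real (F43_termR A B C D E F G k)"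
proof -
  have "rGamma (of_nat k + complex_of_real x) = of_real (rGamma (of_nat k + x))" for x
    using rGamma_complex_of_real[of "of_nat k + x"] by simp
  thus ?thesis by (simp add: F43_term_def F43_termR_def pochhammer_of_real)
qed

lemma summable_F43_termR:
  assumes "E + F + G - A - B - C - D = 1"
  shows "summable (F43_termR A B C D E F G)"
proof -
  have "of_real E + of_real F + of_real G - of_real A - of_real B - of_real C - of_real D = (1 :: complex)"
    using assms by (metis of_real_1 of_real_add of_real_diff)
  from summable_Re[OF summable_F43_term[OF this]] show ?thesis by (simp add: F43_term_of_real)
qed

definition KR where
  "KR a b c d e f g = suminf (F43_termR a b c d e f g) * rGamma (1 + a - e) * rGamma (1 + a - f) * rGamma (1 + a - g)
    + suminf (F43_termR a (1 + a - e) (1 + a - f) (1 + a - g) (1 + a - b) (1 + a - c) (1 + a - d)) * rGamma b * rGamma c * rGamma d"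
  for a :: real

lemma suminf_F43_termR_of_real:
  assumes "E + F + G - A - B - C - D = 1"
  shows "F43_reg (of_real A) (of_real B) (of_real C) (of_real D) (of_real E) (of_real F) (of_real G)
     = of_real (suminf (F43_termR A B C D E F G))"
  unfolding F43_reg_eq by (simp add: F43_term_of_real[abs_def] suminf_of_real summable_F43_termR[OF assms])

text \<open>The positivity under which all series and integrals below converge.\<close>

definition admissible where
  "admissible a b c d e f g \<longleftrightarrow> e + f + g - a - b - c - d = 1 \<and> 0 < a \<and> 0 < b \<and> 0 < c \<and> 0 < d \<and> 0 < e \<and> 0 < f \<and> 0 < g \<and>
     0 < 1 + a - e \<and> 0 < 1 + a - f \<and> 0 < 1 + a - g \<and> 0 < 1 + a - b \<and> 0 < 1 + a - c \<and> 0 < 1 + a - d \<and>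
     0 < e - b \<and> 0 < e - c \<and> 0 < f - d \<and> 0 < g - d \<and> \<bar>b + c - e\<bar> < 1"
  for a :: real

text \<open>With \<rho> = b + c - e, the solutions at t = 1 of the two \<open>2F1\<close> equations
  have exponents 0, -\<rho> and 0, \<rho>. \<open>kerP\<close> pairs the solution of exponent
  -\<rho> with the regular one of the other equation; \<open>kerQ\<close> pairs the regular one with
  that of exponent \<rho>.\<close>

definition kerP where
  "kerP a b c d e f g t = t powr (a - 1) * ((1 - t) powr (- (b + c - e)) * F21 (e - b) (e - c) (1 - (b + c - e)) (1 - t))
     * F21 (1 + a - f) (1 + a - g) (1 - (b + c - e)) (1 - t)"
  for a :: real

definition kerQ where
  "kerQ a b c d e f g t = t powr (a - 1) * F21 b c (1 + (b + c - e)) (1 - t)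
     * ((1 - t) powr (b + c - e) * F21 (f - d) (g - d) (1 + (b + c - e)) (1 - t))"
  for a :: real

lemma F21_measurable [measurable]: "F21 a b c \<in> borel_measurable borel"
  unfolding F21_def[abs_def] by measurable

lemma has_bochner_integral_scale:
  fixes g :: "real \<Rightarrow> real"
  assumes "(\<integral>\<^sup>+t\<in>{0<..<1}. ennreal (g t) \<partial>lborel) = ennreal B" "g \<in> borel_measurable borel"
    "\<And>t. 0 < t \<Longrightarrow> t < 1 \<Longrightarrow> 0 \<le> g t" "0 \<le> B"
  shows "has_bochner_integral lborel (\<lambda>t. k * (indicator {0<..<1} t * g t)) (k * B)"
proof (rule has_bochner_integral_mult_right)
  have ind: "(indicator {0<..<1::real} :: real \<Rightarrow> real) \<in> borel_measurable borel"
    by (rule borel_measurable_indicator) simp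
  have eq: "ennreal (indicator {0<..<1} t * g t) = ennreal (g t) * indicator {0<..<1} t" for t :: real
    by (cases "t \<in> {0<..<1}") (simp_all only: indicator_simps, simp_all)
  show "has_bochner_integral lborel (\<lambda>t. indicator {0<..<1} t * g t) B"
  proof (rule has_bochner_integral_nn_integral)
    show "(\<lambda>t. indicator {0<..<1} t * g t) \<in> borel_measurable lborel"
      using borel_measurable_times[OF ind assms(2)] by simp
    show "AE t in lborel. 0 \<le> indicator {0<..<1} t * g t"
      by (rule AE_I2) (use assms(3) in \<open>auto simp: indicator_def\<close>)
    show "integral\<^sup>N lborel (\<lambda>t. ennreal (indicator {0<..<1} t * g t)) = ennreal B"
      unfolding eq by (rule assms(1))
  qed fact
qed

lemma KR_integral:
  assumes "admissible a b c d e f g"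
  shows "has_bochner_integral lborel (\<lambda>t. indicator {0<..<1} t *
      (rGamma b * rGamma c * rGamma (f - d) * rGamma (g - d) * kerP a b c d e f g t
       - rGamma (1 + a - f) * rGamma (1 + a - g) * rGamma (e - b) * rGamma (e - c) * kerQ a b c d e f g t))
     (sin (pi * (b + c - e)) / pi * (Gamma a * Gamma d * Gamma (1 + a - e) * KR a b c d e f g))" (is "has_bochner_integral _ ?F _")
proof -
  define \<rho> where "\<rho> = b + c - e"
  define us where "us = (\<lambda>t. (1 - t) powr (- \<rho>) * F21 (e - b) (e - c) (1 - \<rho>) (1 - t))"
  define ws where "ws = (\<lambda>t. (1 - t) powr \<rho> * F21 (f - d) (g - d) (1 + \<rho>) (1 - t))"
  define gA where "gA = (\<lambda>t. t powr (a - 1) * F21 b c e t * ws t)"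
  define gB where "gB = (\<lambda>t. t powr (a - 1) * F21 (1 + a - f) (1 + a - g) (1 + a - d) t * us t)"
  define sA sB where "sA = suminf (F43_termR a b c d e f g)"
    and "sB = suminf (F43_termR a (1 + a - e) (1 + a - f) (1 + a - g) (1 + a - b) (1 + a - c) (1 + a - d))"
  have A: "e + f + g - a - b - c - d = 1" "0 < a" "0 < b" "0 < c" "0 < d" "0 < e" "0 < f" "0 < g"
     "0 < 1 + a - e" "0 < 1 + a - f" "0 < 1 + a - g" "0 < 1 + a - b" "0 < 1 + a - c" "0 < 1 + a - d"
     "0 < e - b" "0 < e - c" "0 < f - d" "0 < g - d" "\<bar>\<rho>\<bar> < 1"
    using assms unfolding admissible_def \<rho>_def by auto
  have q: "1 + \<rho> = f + g - a - d" "1 - \<rho> = (1 + a - b) + (1 + a - c) - a - (1 + a - e)"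
    using A(1) by (simp_all add: \<rho>_def)
  have df: "(1 + a - b) - (1 + a - e) = e - b" "(1 + a - c) - (1 + a - e) = e - c" by simp_all
  have nn: "0 \<le> Gamma x" "0 \<le> rGamma x" if "0 < x" for x :: real
    using Gamma_real_pos[OF that] rGamma_pos[OF that] by simp_all
  have sA0: "0 \<le> sA" unfolding sA_def F43_termR_def
    by (intro suminf_nonneg summable_F43_termR[unfolded F43_termR_def[abs_def]] A mult_nonneg_nonneg divide_nonneg_pos less_imp_le[OF pochhammer_pos] nn add_nonneg_pos) auto
  have sumB: "summable (F43_termR a (1 + a - e) (1 + a - f) (1 + a - g) (1 + a - b) (1 + a - c) (1 + a - d))"
    using A(1) by (intro summable_F43_termR) simp
  have sB0: "0 \<le> sB" unfolding sB_def
    by (intro suminf_nonneg sumB) (use A in \<open>auto simp: F43_termR_def intro!: mult_nonneg_nonneg divide_nonneg_pos less_imp_le[OF pochhammer_pos] nn add_nonneg_pos\<close>)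
  \<comment> \<open>The second series is read with \<open>1 + a - f\<close>,
    \<open>1 + a - g\<close>; \<open>1 + a - d\<close> as inner \<open>2F1\<close>. Its exponent at
    1 is then \<rho>, opposite to that of \<open>F21 b c e\<close>, as the cancellation of the mixed
    terms requires.\<close>
  have perm: "F43_termR a (1 + a - f) (1 + a - g) (1 + a - e) (1 + a - d) (1 + a - b) (1 + a - c) =
     F43_termR a (1 + a - e) (1 + a - f) (1 + a - g) (1 + a - b) (1 + a - c) (1 + a - d)"
    by (simp add: F43_termR_def fun_eq_iff mult_ac)
  have "(\<integral>\<^sup>+t\<in>{0<..<1}. ennreal (t powr (a - 1) * F21 b c e t * ((1 - t) powr (1 + \<rho> - 1) * F21 (f - d) (g - d) (1 + \<rho>) (1 - t))) \<partial>lborel)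
    = ennreal (Gamma a * Gamma d * suminf (F43_termR a b c d e f g))"
    by (rule F43_integral) (use A q summable_F43_termR[OF A(1)] in auto)
  hence iA: "(\<integral>\<^sup>+t\<in>{0<..<1}. ennreal (gA t) \<partial>lborel) = ennreal (Gamma a * Gamma d * sA)"
    by (simp add: gA_def ws_def sA_def)
  have "(\<integral>\<^sup>+t\<in>{0<..<1}. ennreal (t powr (a - 1) * F21 (1 + a - f) (1 + a - g) (1 + a - d) t * ((1 - t) powr (1 - \<rho> - 1) * F21 ((1 + a - b) - (1 + a - e)) ((1 + a - c) - (1 + a - e)) (1 - \<rho>) (1 - t))) \<partial>lborel)
    = ennreal (Gamma a * Gamma (1 + a - e) * suminf (F43_termR a (1 + a - f) (1 + a - g) (1 + a - e) (1 + a - d) (1 + a - b) (1 + a - c)))"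
    by (rule F43_integral) (use A q(2) sumB[folded perm] in auto)
  hence iB: "(\<integral>\<^sup>+t\<in>{0<..<1}. ennreal (gB t) \<partial>lborel) = ennreal (Gamma a * Gamma (1 + a - e) * sB)"
    by (simp add: gB_def us_def sB_def perm)
  define kA kB where "kA = rGamma (1 + a - f) * rGamma (1 + a - g) * (sin (pi * \<rho>) / pi)"
    and "kB = rGamma b * rGamma c * (sin (pi * \<rho>) / pi)"
  have "has_bochner_integral lborel (\<lambda>t. kA * (indicator {0<..<1} t * gA t)) (kA * (Gamma a * Gamma d * sA))"
  proof (rule has_bochner_integral_scale[OF iA])
    show "gA \<in> borel_measurable borel" unfolding gA_def ws_def by measurable
    show "0 \<le> gA t" if "0 < t" "t < 1" for t
      unfolding gA_def ws_def using that A by (intro mult_nonneg_nonneg less_imp_le[OF F21_pos]) auto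
  qed (use A sA0 in \<open>auto intro!: mult_nonneg_nonneg nn\<close>)
  moreover have "has_bochner_integral lborel (\<lambda>t. kB * (indicator {0<..<1} t * gB t)) (kB * (Gamma a * Gamma (1 + a - e) * sB))"
  proof (rule has_bochner_integral_scale[OF iB])
    show "gB \<in> borel_measurable borel" unfolding gB_def us_def by measurable
    show "0 \<le> gB t" if "0 < t" "t < 1" for t
      unfolding gB_def us_def using that A by (intro mult_nonneg_nonneg less_imp_le[OF F21_pos]) auto
  qed (use A sB0 in \<open>auto intro!: mult_nonneg_nonneg nn\<close>)
  ultimately have "has_bochner_integral lborel (\<lambda>t. kA * (indicator {0<..<1} t * gA t) + kB * (indicator {0<..<1} t * gB t))
     (kA * (Gamma a * Gamma d * sA) + kB * (Gamma a * Gamma (1 + a - e) * sB))"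
    by (rule has_bochner_integral_add)
  also have "kA * (Gamma a * Gamma d * sA) + kB * (Gamma a * Gamma (1 + a - e) * sB)
     = sin (pi * (b + c - e)) / pi * (Gamma a * Gamma d * Gamma (1 + a - e) * KR a b c d e f g)"
  proof -
    have alg: "x * y * s * (ga * gd * sa) + z * w * s * (ga * ge * sb) = s * (ga * gd * ge * (sa * re * x * y + sb * z * w * rd))"
      if "ge * re = 1" "gd * rd = 1" for x y z w s ga gd ge sa sb re rd :: real
    proof -
      have "s * (ga * gd * ge * (sa * re * x * y + sb * z * w * rd)) = (ge * re) * (x * y * s * (ga * gd * sa)) + (gd * rd) * (z * w * s * (ga * ge * sb))"
        by (simp add: algebra_simps)
      thus ?thesis using that by simp
    qed
    show ?thesis
      unfolding KR_def kA_def kB_def sA_def sB_def \<rho>_def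
      by (rule alg) (use A in \<open>auto intro!: Gamma_rGamma\<close>)
  qed
  also have "(\<lambda>t. kA * (indicator {0<..<1} t * gA t) + kB * (indicator {0<..<1} t * gB t)) = ?F"
  proof
    fix t :: real
    define B1 E1 B2 E2 s where "B1 = rGamma b * rGamma c" and "E1 = rGamma (e - b) * rGamma (e - c)"
      and "B2 = rGamma (1 + a - f) * rGamma (1 + a - g)" and "E2 = rGamma (f - d) * rGamma (g - d)" and "s = sin (pi * \<rho>) / pi"
    define ur wr' u0 w0 T where "ur = F21 b c (1 + \<rho>) (1 - t)" and "wr' = F21 (1 + a - f) (1 + a - g) (1 - \<rho>) (1 - t)"
      and "u0 = F21 b c e t" and "w0 = F21 (1 + a - f) (1 + a - g) (1 + a - d) t" and "T = t powr (a - 1)"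
    show "kA * (indicator {0<..<1} t * gA t) + kB * (indicator {0<..<1} t * gB t) = ?F t"
    proof (cases "t \<in> {0<..<1}")
      case True
      have t: "0 < t" "t < 1" using True by auto
      have "sin (pi * (- \<rho>)) / pi * F21 b c e t = rGamma (e - b) * rGamma (e - c) * F21 b c (1 - (- \<rho>)) (1 - t)
         - rGamma b * rGamma c * ((1 - t) powr (- \<rho>) * F21 (e - b) (e - c) (1 + (- \<rho>)) (1 - t))"
        by (rule F21_connection) (use A t in \<open>auto simp: \<rho>_def\<close>)
      hence 1: "- (s * u0) = E1 * ur - B1 * us t"
        by (simp add: s_def u0_def E1_def ur_def B1_def us_def)
      have "sin (pi * \<rho>) / pi * F21 (1 + a - f) (1 + a - g) (1 + a - d) t = rGamma (1 + a - d - (1 + a - f)) * rGamma (1 + a - d - (1 + a - g)) * F21 (1 + a - f) (1 + a - g) (1 - \<rho>) (1 - t)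
         - rGamma (1 + a - f) * rGamma (1 + a - g) * ((1 - t) powr \<rho> * F21 (1 + a - d - (1 + a - f)) (1 + a - d - (1 + a - g)) (1 + \<rho>) (1 - t))"
        by (rule F21_connection) (use A t in \<open>auto simp: \<rho>_def\<close>)
      hence 2: "s * w0 = E2 * wr' - B2 * ws t"
        by (simp add: s_def w0_def E2_def wr'_def B2_def ws_def)
      have "B2 * s * (T * u0 * ws t) + B1 * s * (T * w0 * us t) = T * (B1 * us t * (s * w0) - B2 * ws t * (- (s * u0)))"
        by (simp add: algebra_simps)
      also have "\<dots> = B1 * E2 * (T * us t * wr') - B2 * E1 * (T * ur * ws t)"
        unfolding 1 2 by (simp add: algebra_simps)
      finally have main: "B2 * s * (T * u0 * ws t) + B1 * s * (T * w0 * us t) = B1 * E2 * (T * us t * wr') - B2 * E1 * (T * ur * ws t)" .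
      have p: "kerP a b c d e f g t = T * us t * wr'" "kerQ a b c d e f g t = T * ur * ws t"
        by (simp_all add: kerP_def kerQ_def T_def us_def wr'_def ur_def ws_def \<rho>_def)
      have g: "gA t = T * u0 * ws t" "gB t = T * w0 * us t"
        by (simp_all add: gA_def gB_def T_def u0_def w0_def)
      have k: "kA = B2 * s" "kB = B1 * s" by (simp_all add: kA_def kB_def B1_def B2_def s_def)
      have i: "indicator {0<..<1} t = (1::real)" using True by (rule indicator_simps)
      show ?thesis unfolding i p g k using main
        by (simp add: B1_def E2_def B2_def E1_def mult.assoc)
    next
      case False
      hence i: "indicator {0<..<1} t = (0::real)" by (rule indicator_simps)
      show ?thesis unfolding i by simp
    qed
  qed
  finally show ?thesis .
qed

lemma sin_pi_nonzero:
  assumes "\<bar>x\<bar> < 1" "x \<noteq> 0" shows "sin (pi * x) \<noteq> 0"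
proof -
  have pos: "0 < sin (pi * y)" if "0 < y" "y < 1" for y
  proof (rule sin_gt_zero)
    show "0 < pi * y" using that by simp
    show "pi * y < pi" using mult_strict_left_mono[OF that(2) pi_gt_zero] by simp
  qed
  show ?thesis
  proof (cases "0 < x")
    case True
    thus ?thesis using pos[of x] assms by simp
  next
    case False
    thus ?thesis using pos[of "- x"] assms by simp
  qed
qed

text \<open>The substitution exchanges t3 and t4 and so negates \<rho>. It interchanges
  \<open>kerP\<close> and \<open>kerQ\<close> together with their Gamma factors, hence negates the
  integral; sin pi\<rho> changes sign as well.\<close>

lemma KR_swap:
  assumes "admissible a b c d e f g" "admissible a (e - c) (e - b) d e (1 + a + d - g) (1 + a + d - f)"
  shows "KR a (e - c) (e - b) d e (1 + a + d - g) (1 + a + d - f) = KR a b c d e f g"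
proof (cases "b + c - e = 0")
  \<comment> \<open>At \<rho> = 0 the integral formula carries no information, but there the
    substitution is the identity.\<close>
  case True
  have "e + f + g - a - b - c - d = 1" using assms(1) by (simp add: admissible_def)
  hence e: "e = b + c" and f: "f = 1 + a + d - g" using True by auto
  show ?thesis unfolding e f by simp
next
  case False
  define \<rho> where "\<rho> = b + c - e"
  have \<rho>: "\<bar>\<rho>\<bar> < 1" "\<rho> \<noteq> 0" using assms(1) False by (auto simp: admissible_def \<rho>_def)
  have A: "0 < a" "0 < d" "0 < 1 + a - e" using assms(1) by (auto simp: admissible_def)
  define N where "N = Gamma a * Gamma d * Gamma (1 + a - e)"
  have s: "sin (pi * \<rho>) \<noteq> 0"
    using \<rho> by (rule sin_pi_nonzero)
  have N: "N \<noteq> 0" using A by (simp add: N_def Gamma_real_pos less_imp_neq[symmetric])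
  note 1 = KR_integral[OF assms(1), folded \<rho>_def N_def]
  have \<rho>': "(e - c) + (e - b) - e = - \<rho>" "e - (e - c) = c" "e - (e - b) = b" "1 + a + d - g - d = 1 + a - g" "1 + a + d - f - d = 1 + a - f"
     "1 + a - (1 + a + d - g) = g - d" "1 + a - (1 + a + d - f) = f - d" "1 + - \<rho> = 1 - \<rho>" "1 - - \<rho> = 1 + \<rho>" "- (- \<rho>) = \<rho>"
    by (simp_all add: \<rho>_def)
  have pq: "kerP a (e - c) (e - b) d e (1 + a + d - g) (1 + a + d - f) t = kerQ a b c d e f g t"
    "kerQ a (e - c) (e - b) d e (1 + a + d - g) (1 + a + d - f) t = kerP a b c d e f g t" for t
    unfolding kerP_def kerQ_def \<rho>' \<rho>_def[symmetric] by (simp_all add: F21_commute[of c b] F21_commute[of "g - d"] F21_commute[of "1 + a - g"] F21_commute[of "e - c"] mult_ac)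
  note 2 = KR_integral[OF assms(2), unfolded pq, unfolded \<rho>', folded N_def]
  have "has_bochner_integral lborel (\<lambda>t::real. 0)
     (sin (pi * \<rho>) / pi * (N * KR a b c d e f g) + sin (pi * (- \<rho>)) / pi * (N * KR a (e - c) (e - b) d e (1 + a + d - g) (1 + a + d - f)))"
    by (rule back_subst[where P = "\<lambda>f. has_bochner_integral lborel f _", OF has_bochner_integral_add[OF 1 2]])
       (simp add: fun_eq_iff algebra_simps)
  from has_bochner_integral_eq[OF this has_bochner_integral_zero]
  have "sin (pi * \<rho>) / pi * (N * KR a b c d e f g) + sin (pi * (- \<rho>)) / pi * (N * KR a (e - c) (e - b) d e (1 + a + d - g) (1 + a + d - f)) = 0" .
  hence "sin (pi * \<rho>) / pi * N * (KR a b c d e f g - KR a (e - c) (e - b) d e (1 + a + d - g) (1 + a + d - f)) = 0"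
    by (simp add: algebra_simps)
  thus ?thesis using s N by simp
qed

text \<open>The three integrands are combinations of the same two functions \<open>P\<close> and
  \<open>Q\<close>, and their integrals carry the same factor sin pi\<rho>. Three vectors in a plane
  are linearly dependent.\<close>

lemma KR_three_term:
  assumes admissible: "admissible a b c d e f g" "admissible d b c a e f g" "admissible (1 + a - e) (1 + b - e) (1 + c - e) (1 + d - e) (2 - e) (1 + f - e) (1 + g - e)"
    and nz: "b + c - e \<noteq> 0"
  defines "s \<equiv> \<lambda>x. sin (pi * x)"
  shows "(s (f - d) * s (g - d) * s (e - b) * s (e - c) - s (f - a) * s (g - a) * s b * s c) / pi ^ 4 * rGamma (1 + d - e) * KR a b c d e f g
    + rGamma (f - d) * rGamma (g - d) * rGamma (1 + a - f) * rGamma (1 + a - g) * ((s b * s c - s (e - b) * s (e - c)) / pi ^ 2) * rGamma (1 + a - e) * KR d b c a e f g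
    + rGamma b * rGamma c * rGamma (e - b) * rGamma (e - c) * ((s (f - a) * s (g - a) - s (f - d) * s (g - d)) / pi ^ 2) * rGamma d
        * KR (1 + a - e) (1 + b - e) (1 + c - e) (1 + d - e) (2 - e) (1 + f - e) (1 + g - e) = 0"
proof -
  define \<rho> where "\<rho> = b + c - e"
  have saal: "e + f + g - a - b - c - d = 1" using admissible(1) by (simp add: admissible_def)
  have \<rho>: "\<bar>\<rho>\<bar> < 1" "\<rho> \<noteq> 0" using admissible(1) nz by (auto simp: admissible_def \<rho>_def)
  have A: "0 < a" "0 < d" "0 < 1 + a - e" "0 < 1 + d - e" "0 < 1 + d - f" "0 < 1 + d - g" "0 < f - a" "0 < g - a"
      "0 < 1 - b" "0 < 1 - c" "0 < 1 + b - e" "0 < 1 + c - e"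
    using admissible by (auto simp: admissible_def)
  have s: "sin (pi * \<rho>) \<noteq> 0"
    using \<rho> by (rule sin_pi_nonzero)
  define B1 E1 B2 E2 where "B1 = rGamma b * rGamma c" and "E1 = rGamma (e - b) * rGamma (e - c)"
      and "B2 = rGamma (1 + a - f) * rGamma (1 + a - g)" and "E2 = rGamma (f - d) * rGamma (g - d)"
  define B2' E2' where "B2' = rGamma (1 + d - f) * rGamma (1 + d - g)" and "E2' = rGamma (f - a) * rGamma (g - a)"
  define B1' E1' where "B1' = rGamma (1 + b - e) * rGamma (1 + c - e)" and "E1' = rGamma (1 - b) * rGamma (1 - c)"
  define P Q where "P = kerP a b c d e f g" and "Q = kerQ a b c d e f g"
  define I where "I = (\<lambda>t::real. indicator {0<..<1} t :: real)"
  define k1 k2 k3 where "k1 = KR a b c d e f g" and "k2 = KR d b c a e f g"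
    and "k3 = KR (1 + a - e) (1 + b - e) (1 + c - e) (1 + d - e) (2 - e) (1 + f - e) (1 + g - e)"
  define S where "S = sin (pi * \<rho>) / pi"
  have i1: "has_bochner_integral lborel (\<lambda>t. I t * (B1 * E2 * P t - B2 * E1 * Q t)) (S * (Gamma a * Gamma d * Gamma (1 + a - e) * k1))"
    using KR_integral[OF admissible(1)] unfolding I_def B1_def E1_def B2_def E2_def P_def Q_def S_def \<rho>_def k1_def by (simp only: mult.assoc)
  have dist: "x * (k * y - l * z) = k * (x * y) - l * (x * z)" for x k y l z :: real
    by (simp add: algebra_simps)
  \<comment> \<open>Euler's transformation in the variable 1 - t yields the power t^(a-d), which
    turns t^(d-1) into t^(a-1).\<close>
  have pq2: "I t * kerP d b c a e f g t = I t * P t" "I t * kerQ d b c a e f g t = I t * Q t" for t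
  proof -
    have "kerP d b c a e f g t = P t \<and> kerQ d b c a e f g t = Q t" if t: "0 < t" "t < 1"
    proof -
      have "F21 (1 + d - f) (1 + d - g) (1 - \<rho>) (1 - t) = (1 - (1 - t)) powr (1 - \<rho> - (1 + d - f) - (1 + d - g)) * F21 (1 - \<rho> - (1 + d - f)) (1 - \<rho> - (1 + d - g)) (1 - \<rho>) (1 - t)"
        by (rule F21_Euler) (use A \<rho> t in auto)
      moreover have "1 - \<rho> - (1 + d - f) - (1 + d - g) = a - d" "1 - \<rho> - (1 + d - f) = 1 + a - g" "1 - \<rho> - (1 + d - g) = 1 + a - f"
        using saal by (simp_all add: \<rho>_def)
      ultimately have 1: "F21 (1 + d - f) (1 + d - g) (1 - \<rho>) (1 - t) = t powr (a - d) * F21 (1 + a - f) (1 + a - g) (1 - \<rho>) (1 - t)"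
        by (simp add: F21_commute[of "1 + a - g"])
      have "F21 (f - a) (g - a) (1 + \<rho>) (1 - t) = (1 - (1 - t)) powr (1 + \<rho> - (f - a) - (g - a)) * F21 (1 + \<rho> - (f - a)) (1 + \<rho> - (g - a)) (1 + \<rho>) (1 - t)"
        by (rule F21_Euler) (use A \<rho> t in auto)
      moreover have "1 + \<rho> - (f - a) - (g - a) = a - d" "1 + \<rho> - (f - a) = g - d" "1 + \<rho> - (g - a) = f - d"
        using saal by (simp_all add: \<rho>_def)
      ultimately have 2: "F21 (f - a) (g - a) (1 + \<rho>) (1 - t) = t powr (a - d) * F21 (f - d) (g - d) (1 + \<rho>) (1 - t)"
        by (simp add: F21_commute[of "g - d"])
      have 3: "t powr (a - 1) = t powr (d - 1) * t powr (a - d)" by (simp add: powr_add[symmetric])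
      show ?thesis unfolding P_def Q_def kerP_def kerQ_def \<rho>_def[symmetric] 1 2 3 by (simp add: mult_ac)
    qed
    thus "I t * kerP d b c a e f g t = I t * P t" "I t * kerQ d b c a e f g t = I t * Q t"
      by (cases "t \<in> {0<..<1}"; simp add: I_def)+
  qed
  have i2: "has_bochner_integral lborel (\<lambda>t. I t * (B1 * E2' * P t - B2' * E1 * Q t)) (S * (Gamma d * Gamma a * Gamma (1 + d - e) * k2))"
  proof -
    have "I t * (B1 * E2' * P t - B2' * E1 * Q t) = I t * (B1 * E2' * kerP d b c a e f g t - B2' * E1 * kerQ d b c a e f g t)" for t
      unfolding dist pq2 ..
    thus ?thesis using KR_integral[OF admissible(2)] unfolding I_def B1_def E1_def B2'_def E2'_def S_def \<rho>_def k2_def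
      by (simp only: mult.assoc)
  qed
  define pf3 qf3 where "pf3 = kerP (1 + a - e) (1 + b - e) (1 + c - e) (1 + d - e) (2 - e) (1 + f - e) (1 + g - e)"
    and "qf3 = kerQ (1 + a - e) (1 + b - e) (1 + c - e) (1 + d - e) (2 - e) (1 + f - e) (1 + g - e)"
  have par: "(1 + b - e) + (1 + c - e) - (2 - e) = \<rho>" "2 - e - (1 + b - e) = 1 - b" "2 - e - (1 + c - e) = 1 - c"
     "1 + (1 + a - e) - (1 + f - e) = 1 + a - f" "1 + (1 + a - e) - (1 + g - e) = 1 + a - g" "(1 + f - e) - (1 + d - e) = f - d"
     "(1 + g - e) - (1 + d - e) = g - d" "1 + (1 + a - e) - (2 - e) = a" "1 + a - e - 1 = a - e"
    by (simp_all add: \<rho>_def)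
  have pq3: "I t * pf3 t = I t * P t" "I t * qf3 t = I t * Q t" for t
  proof -
    have "pf3 t = P t \<and> qf3 t = Q t" if t: "0 < t" "t < 1"
    proof -
      have "F21 (1 - b) (1 - c) (1 - \<rho>) (1 - t) = (1 - (1 - t)) powr (1 - \<rho> - (1 - b) - (1 - c)) * F21 (1 - \<rho> - (1 - b)) (1 - \<rho> - (1 - c)) (1 - \<rho>) (1 - t)"
        by (rule F21_Euler) (use A \<rho> t in auto)
      moreover have "1 - \<rho> - (1 - b) - (1 - c) = e - 1" "1 - \<rho> - (1 - b) = e - c" "1 - \<rho> - (1 - c) = e - b"
        by (simp_all add: \<rho>_def)
      ultimately have 1: "F21 (1 - b) (1 - c) (1 - \<rho>) (1 - t) = t powr (e - 1) * F21 (e - b) (e - c) (1 - \<rho>) (1 - t)"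
        by (simp add: F21_commute[of "e - c"])
      have "F21 (1 + b - e) (1 + c - e) (1 + \<rho>) (1 - t) = (1 - (1 - t)) powr (1 + \<rho> - (1 + b - e) - (1 + c - e)) * F21 (1 + \<rho> - (1 + b - e)) (1 + \<rho> - (1 + c - e)) (1 + \<rho>) (1 - t)"
        by (rule F21_Euler) (use A \<rho> t in auto)
      moreover have "1 + \<rho> - (1 + b - e) - (1 + c - e) = e - 1" "1 + \<rho> - (1 + b - e) = c" "1 + \<rho> - (1 + c - e) = b"
        by (simp_all add: \<rho>_def)
      ultimately have 2: "F21 (1 + b - e) (1 + c - e) (1 + \<rho>) (1 - t) = t powr (e - 1) * F21 b c (1 + \<rho>) (1 - t)"
        by (simp add: F21_commute[of c])
      have 3: "t powr (a - 1) = t powr (a - e) * t powr (e - 1)" by (simp add: powr_add[symmetric])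
      show ?thesis unfolding P_def Q_def pf3_def qf3_def kerP_def kerQ_def par \<rho>_def[symmetric] 1 2 3 by (simp add: mult_ac)
    qed
    thus "I t * pf3 t = I t * P t" "I t * qf3 t = I t * Q t"
      by (cases "t \<in> {0<..<1}"; simp add: I_def)+
  qed
  have i3: "has_bochner_integral lborel (\<lambda>t. I t * (B1' * E2 * P t - B2 * E1' * Q t)) (S * (Gamma (1 + a - e) * Gamma (1 + d - e) * Gamma a * k3))"
  proof -
    have "I t * (B1' * E2 * P t - B2 * E1' * Q t) = I t * (B1' * E2 * pf3 t - B2 * E1' * qf3 t)" for t
      unfolding dist pq3 ..
    thus ?thesis using KR_integral[OF admissible(3)] unfolding par pf3_def[symmetric] qf3_def[symmetric] k3_def[symmetric]
      unfolding I_def B1'_def E1'_def B2_def E2_def S_def by (simp only: mult.assoc)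
  qed
  \<comment> \<open>The 2 x 2 minors of the three coefficient rows; the reflection formula later
    turns the products of primed and unprimed Gamma factors in them into sines.\<close>
  define d1 d2 d3 where "d1 = B2' * E1 * (B1' * E2) - B1 * E2' * (B2 * E1')" and "d2 = B2 * E1' * (B1 * E2) - B1' * E2 * (B2 * E1)"
    and "d3 = B2 * E1 * (B1 * E2') - B1 * E2 * (B2' * E1)"
  have zero: "d1 * (x * (B1 * E2 * y - B2 * E1 * z)) + d2 * (x * (B1 * E2' * y - B2' * E1 * z)) + d3 * (x * (B1' * E2 * y - B2 * E1' * z)) = 0" for x y z
    unfolding d1_def d2_def d3_def by algebra
  have "has_bochner_integral lborel (\<lambda>t. d1 * (I t * (B1 * E2 * P t - B2 * E1 * Q t)) + d2 * (I t * (B1 * E2' * P t - B2' * E1 * Q t)) + d3 * (I t * (B1' * E2 * P t - B2 * E1' * Q t)))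
    (d1 * (S * (Gamma a * Gamma d * Gamma (1 + a - e) * k1)) + d2 * (S * (Gamma d * Gamma a * Gamma (1 + d - e) * k2)) + d3 * (S * (Gamma (1 + a - e) * Gamma (1 + d - e) * Gamma a * k3)))"
    by (intro has_bochner_integral_add has_bochner_integral_mult_right i1 i2 i3)
  from has_bochner_integral_eq[OF this[unfolded zero] has_bochner_integral_zero]
  have 0: "d1 * (S * (Gamma a * Gamma d * Gamma (1 + a - e) * k1)) + d2 * (S * (Gamma d * Gamma a * Gamma (1 + d - e) * k2)) + d3 * (S * (Gamma (1 + a - e) * Gamma (1 + d - e) * Gamma a * k3)) = 0" .
  have g: "Gamma a * rGamma a = 1" "Gamma d * rGamma d = 1" "Gamma (1 + a - e) * rGamma (1 + a - e) = 1" "Gamma (1 + d - e) * rGamma (1 + d - e) = 1"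
    using A by (auto intro!: Gamma_rGamma)
  have alg: "d1 * r4 * k1 + d2 * r3 * k2 + d3 * r2 * k3 = 0"
    if "d1 * (S * (g1 * g2 * g3 * k1)) + d2 * (S * (g2 * g1 * g4 * k2)) + d3 * (S * (g3 * g4 * g1 * k3)) = 0" "S \<noteq> 0"
      "g1 * r1 = 1" "g2 * r2 = 1" "g3 * r3 = 1" "g4 * r4 = 1" for d1 d2 d3 k1 k2 k3 g1 g2 g3 g4 r1 r2 r3 r4 :: real
  proof -
    have "S * (d1 * r4 * k1 + d2 * r3 * k2 + d3 * r2 * k3) =
      S * (d1 * (g1 * r1) * (g2 * r2) * (g3 * r3) * r4 * k1 + d2 * (g1 * r1) * (g2 * r2) * (g4 * r4) * r3 * k2 + d3 * (g1 * r1) * (g3 * r3) * (g4 * r4) * r2 * k3)"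
      using that by simp
    also have "\<dots> = r1 * r2 * r3 * r4 * (d1 * (S * (g1 * g2 * g3 * k1)) + d2 * (S * (g2 * g1 * g4 * k2)) + d3 * (S * (g3 * g4 * g1 * k3)))"
      by (simp add: algebra_simps)
    also have "\<dots> = 0" using that by simp
    finally show ?thesis using that(2) by simp
  qed
  have "S \<noteq> 0" using s by (simp add: S_def)
  note 1 = alg[OF 0 this g]
  have refl: "rGamma (1 + x - y) * rGamma (y - x) = sin (pi * (y - x)) / pi" for x y :: real
    using rGamma_reflection_real[of "y - x"] by (simp add: mult.commute algebra_simps)
  have refl': "rGamma (1 - x) * rGamma x = sin (pi * x) / pi" for x :: real
    using rGamma_reflection_real[of x] by (simp add: mult.commute)
  have pr: "B2' * E2 = s (f - d) * s (g - d) / pi ^ 2" "B2 * E2' = s (f - a) * s (g - a) / pi ^ 2" "B1' * E1 = s (e - b) * s (e - c) / pi ^ 2" "B1 * E1' = s b * s c / pi ^ 2"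
  proof -
    have "B2' * E2 = (rGamma (1 + d - f) * rGamma (f - d)) * (rGamma (1 + d - g) * rGamma (g - d))" by (simp add: B2'_def E2_def)
    thus "B2' * E2 = s (f - d) * s (g - d) / pi ^ 2" unfolding refl by (simp add: s_def power2_eq_square)
    have "B2 * E2' = (rGamma (1 + a - f) * rGamma (f - a)) * (rGamma (1 + a - g) * rGamma (g - a))" by (simp add: B2_def E2'_def)
    thus "B2 * E2' = s (f - a) * s (g - a) / pi ^ 2" unfolding refl by (simp add: s_def power2_eq_square)
    have "B1' * E1 = (rGamma (1 + b - e) * rGamma (e - b)) * (rGamma (1 + c - e) * rGamma (e - c))" by (simp add: B1'_def E1_def)
    thus "B1' * E1 = s (e - b) * s (e - c) / pi ^ 2" unfolding refl by (simp add: s_def power2_eq_square)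
    have "B1 * E1' = (rGamma (1 - b) * rGamma b) * (rGamma (1 - c) * rGamma c)" by (simp add: B1_def E1'_def)
    thus "B1 * E1' = s b * s c / pi ^ 2" unfolding refl' by (simp add: s_def power2_eq_square)
  qed
  have "d1 = (B2' * E2) * (B1' * E1) - (B2 * E2') * (B1 * E1')" "d2 = E2 * B2 * (B1 * E1' - B1' * E1)" "d3 = B1 * E1 * (B2 * E2' - B2' * E2)"
    by (simp_all add: d1_def d2_def d3_def algebra_simps)
  hence d: "d1 = (s (f - d) * s (g - d) * s (e - b) * s (e - c) - s (f - a) * s (g - a) * s b * s c) / pi ^ 4"
    "d2 = E2 * B2 * ((s b * s c - s (e - b) * s (e - c)) / pi ^ 2)" "d3 = B1 * E1 * ((s (f - a) * s (g - a) - s (f - d) * s (g - d)) / pi ^ 2)"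
    unfolding pr by (simp_all add: diff_divide_distrib power4_eq_xxxx power2_eq_square)
  show ?thesis using 1 unfolding d k1_def k2_def k3_def B1_def E1_def B2_def E2_def by (simp only: mult.assoc)
qed

text \<open>In terms of \<open>ep\<close> and \<open>em\<close> a trigonometric identity becomes an
  identity of Laurent polynomials, which can be checked by normalisation.\<close>

definition ep :: "complex \<Rightarrow> complex" where "ep x = exp (\<i> * x)"
definition em :: "complex \<Rightarrow> complex" where "em x = exp (- (\<i> * x))"

lemma ep_add: "ep (x + y) = ep x * ep y" and em_add: "em (x + y) = em x * em y"
  and ep_diff: "ep (x - y) = ep x * em y" and em_diff: "em (x - y) = em x * ep y"
  by (simp_all add: ep_def em_def exp_add[symmetric] exp_minus[symmetric] exp_diff algebra_simps)

lemma ep_em: "ep x * em x = 1" "ep x * (em x * w) = w"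
proof -
  show 1: "ep x * em x = 1" by (simp add: ep_def em_def exp_add[symmetric])
  show "ep x * (em x * w) = w" using 1 by (simp add: mult.assoc[symmetric])
qed

lemma sin_ep: "sin x = (em x - ep x) * (\<i> / 2)"
  by (simp add: sin_exp_eq ep_def em_def field_simps)

lemma cos_ep: "cos x = (ep x + em x) * (1 / 2)"
  by (simp add: cos_exp_eq ep_def em_def)

lemma half_i: "(\<i> / 2) * (\<i> / 2) = - ((1 / 2) * (1 / 2))" "(\<i> / 2) * ((\<i> / 2) * w) = - ((1 / 2) * ((1 / 2) * w))"
  by simp_all

text \<open>The bracket defining the coefficient of \<open>K_p0\<close> is quadratic in \<open>R\<close>; these are its linear and its constant coefficient.\<close>

lemma coeff_bracket_coeffs:
  fixes t1 t2 t3 t4 h :: complex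
  assumes "r = h + h - (t1 + t2) + (t3 + t4)" "P = cos (t1 - t2)" "Q = cos (t3 - t4)"
  shows "sin (t2 - t1) * ((Q * cos r + P) * sin (t1 + t2 + (t3 + t4)) * cos h - sin r * P * cos h
        - sin r * Q * (cos (t1 + t2) * cos (t3 + t4) * cos h - 2 * sin (t3 + t4) * cos (t1 + t2) * sin h + sin (t3 + t4) * sin (t1 + t2) * cos h))
    = sin (t2 + t4) * cos (h - t1 + t3) * (cos (t1 - t4) * sin (t2 + t3 - r) + sin (t2 + t3) * cos (t2 - t3) - cos (t1 - t2 + (t3 + t4)) * sin r)
    - sin (t1 + t4) * cos (h - t2 + t3) * (cos (t2 - t4) * sin (t1 + t3 - r) + sin (t1 + t3) * cos (t1 - t3) - cos (t2 - t1 + (t3 + t4)) * sin r)" (is ?L1)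
    and "sin (t2 - t1) * ((Q * cos r + P) * (sin (t1 + t2) * P + sin (t3 + t4) * Q) * cos h - sin r * Q * P * cos (t1 + t2) * cos h
        + sin r * sin (t3 + t4) * (Q * Q * sin h - sin (t1 + t2) * cos (h - (t1 + t2))))
    = sin (t2 + t4) * cos (h - t1 + t3) * cos (t1 - t2 + (t3 + t4)) * (cos (t1 - t4) * sin (t2 + t3 - r) + sin (t2 + t3) * cos (t2 - t3))
    - sin (t1 + t4) * cos (h - t2 + t3) * cos (t2 - t1 + (t3 + t4)) * (cos (t2 - t4) * sin (t1 + t3 - r) + sin (t1 + t3) * cos (t1 - t3))" (is ?L0)
proof -
  define ax ay bx by' cx cy dx dy ex ey where "ax = ep t1" and "ay = em t1" and "bx = ep t2" and "by' = em t2"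
    and "cx = ep t3" and "cy = em t3" and "dx = ep t4" and "dy = em t4" and "ex = ep h" and "ey = em h"
  \<comment> \<open>Both constants stay opaque while monomials are collected, and \<open>kk\<close>
    rewrites products of two sine factors with \<open>m\<close>. They are unfolded only at the
    end.\<close>
  define k m where "k = \<i> / 2" and "m = 1 / (2::complex)"
  have kk: "k * k = - (m * m)" "k * (k * w) = - (m * (m * w))" for w
    unfolding k_def m_def by (rule half_i)+
  note e = ep_em[of t1, folded ax_def ay_def] ep_em[of t2, folded bx_def by'_def] ep_em[of t3, folded cx_def cy_def]
     ep_em[of t4, folded dx_def dy_def] ep_em[of h, folded ex_def ey_def]
  have two: "2 = 1 + (1::complex)" by simp
  show ?L1 and ?L0
    unfolding assms two sin_ep cos_ep ep_add em_add ep_diff em_diff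
    ax_def[symmetric] ay_def[symmetric] bx_def[symmetric] by'_def[symmetric] cx_def[symmetric] cy_def[symmetric]
    dx_def[symmetric] dy_def[symmetric] ex_def[symmetric] ey_def[symmetric] k_def[symmetric] m_def[symmetric]
    by (simp add: algebra_simps kk e, simp add: k_def m_def algebra_simps add_divide_distrib diff_divide_distrib)+
qed

lemma sin_sin_pi: "sin (pi * x) * sin (pi * y) = (cos (pi * (x - y)) - cos (pi * (x + y))) / 2"
  by (simp add: sin_times_sin algebra_simps)

text \<open>All three coefficients of \<open>KR_three_term\<close> contain sin pi\<rho>; dividing it
  out gives coefficients of the degree needed for the elimination.\<close>

lemma KR_three_term_factored:
  assumes admissible: "admissible a b c d e f g" "admissible d b c a e f g" "admissible (1 + a - e) (1 + b - e) (1 + c - e) (1 + d - e) (2 - e) (1 + f - e) (1 + g - e)"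
    and nz: "b + c - e \<noteq> 0"
  shows "- (cos (pi * (b - c)) * sin (pi * (a - d)) + cos (pi * (f - g)) * sin (pi * e) - cos (pi * (b + c - e)) * sin (pi * (a - d - e)))
        / (2 * pi ^ 2) * rGamma (1 + d - e) * KR a b c d e f g
    + sin (pi * e) * (rGamma (f - d) * rGamma (g - d) * rGamma (1 + a - f) * rGamma (1 + a - g)) * rGamma (1 + a - e) * KR d b c a e f g
    + sin (pi * (a - d)) * (rGamma b * rGamma c * rGamma (e - b) * rGamma (e - c)) * rGamma d
        * KR (1 + a - e) (1 + b - e) (1 + c - e) (1 + d - e) (2 - e) (1 + f - e) (1 + g - e) = 0"
proof -
  define \<rho> where "\<rho> = b + c - e"
  have saal: "e + f + g - a - b - c - d = 1" and "\<bar>\<rho>\<bar> < 1" using admissible(1) by (simp_all add: admissible_def \<rho>_def)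
  have "\<rho> \<noteq> 0" using nz by (simp add: \<rho>_def)
  with \<open>\<bar>\<rho>\<bar> < 1\<close> have s: "sin (pi * \<rho>) \<noteq> 0" by (rule sin_pi_nonzero)
  define P R where "P = cos (pi * (b - c))" and "R = cos (pi * (f - g))"
  define U where "U = P * sin (pi * (a - d)) + R * sin (pi * e) - cos (pi * \<rho>) * sin (pi * (a - d - e))"
  define k1 k2 k3 where "k1 = KR a b c d e f g" and "k2 = KR d b c a e f g"
    and "k3 = KR (1 + a - e) (1 + b - e) (1 + c - e) (1 + d - e) (2 - e) (1 + f - e) (1 + g - e)"
  have cospi: "cos (pi * (1 + x)) = - cos (pi * x)" for x
    by (simp add: distrib_left cos_add)
  have fg: "(f - d) - (g - d) = f - g" "(f - a) - (g - a) = f - g" "(f - d) + (g - d) = 1 + ((a - d) + \<rho>)" "(f - a) + (g - a) = 1 + - ((a - d) - \<rho>)"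
    using saal by (simp_all add: \<rho>_def)
  have ebc: "(e - b) - (e - c) = - (b - c)" "(e - b) + (e - c) = e - \<rho>" "b + c = e + \<rho>"
    by (simp_all add: \<rho>_def)
  have 1: "sin (pi * (f - d)) * sin (pi * (g - d)) = (R + cos (pi * (a - d) + pi * \<rho>)) / 2"
    unfolding sin_sin_pi fg cospi R_def by (simp add: distrib_left)
  have 2: "sin (pi * (f - a)) * sin (pi * (g - a)) = (R + cos (pi * (a - d) - pi * \<rho>)) / 2"
    unfolding sin_sin_pi fg cospi R_def mult_minus_right cos_minus by (simp add: right_diff_distrib)
  have 3: "sin (pi * (e - b)) * sin (pi * (e - c)) = (P - cos (pi * e - pi * \<rho>)) / 2"
    unfolding sin_sin_pi ebc P_def mult_minus_right cos_minus by (simp add: right_diff_distrib)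
  have 4: "sin (pi * b) * sin (pi * c) = (P - cos (pi * e + pi * \<rho>)) / 2"
    unfolding sin_sin_pi ebc P_def by (simp add: distrib_left)
  have c1: "sin (pi * (f - d)) * sin (pi * (g - d)) * sin (pi * (e - b)) * sin (pi * (e - c)) - sin (pi * (f - a)) * sin (pi * (g - a)) * sin (pi * b) * sin (pi * c)
     = sin (pi * \<rho>) * (- U / 2)"
  proof -
    have "sin (pi * (f - d)) * sin (pi * (g - d)) * sin (pi * (e - b)) * sin (pi * (e - c)) - sin (pi * (f - a)) * sin (pi * (g - a)) * sin (pi * b) * sin (pi * c)
      = (sin (pi * (f - d)) * sin (pi * (g - d))) * (sin (pi * (e - b)) * sin (pi * (e - c))) - (sin (pi * (f - a)) * sin (pi * (g - a))) * (sin (pi * b) * sin (pi * c))"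
      by (simp only: mult.assoc)
    also have "\<dots> = ((R + cos (pi * (a - d) + pi * \<rho>)) * (P - cos (pi * e - pi * \<rho>)) - (R + cos (pi * (a - d) - pi * \<rho>)) * (P - cos (pi * e + pi * \<rho>))) / 4"
    proof -
      have "x / 2 * (y / 2) - z / 2 * (w / 2) = (x * y - z * w) / 4" for x y z w :: real
        by (simp add: field_simps)
      thus ?thesis unfolding 1 2 3 4 by this
    qed
    also have "\<dots> = sin (pi * \<rho>) * (- U / 2)"
      unfolding connection_determinant U_def by (simp add: right_diff_distrib)
    finally show ?thesis .
  qed
  have cc: "cos (x - y) - cos (x + y) = 2 * (sin y * sin x)" for x y :: real
    by (simp add: cos_add cos_diff)
  have gen: "(P - x) / 2 - (P - y) / 2 = (y - x) / 2" "(R + x) / 2 - (R + y) / 2 = (x - y) / 2" for x y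
    by (simp_all add: diff_divide_distrib add_divide_distrib)
  have c2: "sin (pi * b) * sin (pi * c) - sin (pi * (e - b)) * sin (pi * (e - c)) = sin (pi * \<rho>) * sin (pi * e)"
    unfolding 3 4 gen cc by simp
  have c3: "sin (pi * (f - a)) * sin (pi * (g - a)) - sin (pi * (f - d)) * sin (pi * (g - d)) = sin (pi * \<rho>) * sin (pi * (a - d))"
    unfolding 1 2 gen cc by simp
  define r1 r2 r3 where "r1 = rGamma (1 + d - e)" and "r2 = rGamma (f - d) * rGamma (g - d) * rGamma (1 + a - f) * rGamma (1 + a - g)"
    and "r3 = rGamma b * rGamma c * rGamma (e - b) * rGamma (e - c)"
  note * = KR_three_term[OF admissible nz, unfolded c1 c2 c3, folded k1_def k2_def k3_def r1_def r2_def r3_def]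
  have "sin (pi * \<rho>) / pi ^ 2 * (- U / (2 * pi ^ 2) * r1 * k1 + sin (pi * e) * r2 * rGamma (1 + a - e) * k2 + sin (pi * (a - d)) * r3 * rGamma d * k3) = 0"
  proof -
    have alg: "s * (- U / 2) / (w * w) * r1 * k1 + r2 * (s * x / w) * y * k2 + r3 * (s * z / w) * v * k3
       = s / w * (- U / (2 * w) * r1 * k1 + x * r2 * y * k2 + z * r3 * v * k3)" if "w \<noteq> 0" for s w x y z v :: real
      using that by (simp add: field_simps)
    have "pi ^ 4 = pi ^ 2 * pi ^ 2" by (simp flip: power_add)
    with * show ?thesis by (simp only: alg power_not_zero[OF pi_neq_zero] not_False_eq_True)
  qed
  hence "- U / (2 * pi ^ 2) * r1 * k1 + sin (pi * e) * r2 * rGamma (1 + a - e) * k2 + sin (pi * (a - d)) * r3 * rGamma d * k3 = 0"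
    using s by simp
  thus ?thesis unfolding U_def \<rho>_def P_def R_def r1_def r2_def r3_def k1_def k2_def k3_def .
qed

definition Kfun where
  "Kfun a b c d e f g = F43_reg a b c d e f g * rGamma (1 + a - e) * rGamma (1 + a - f) * rGamma (1 + a - g)
   + F43_reg a (1 + a - e) (1 + a - f) (1 + a - g) (1 + a - b) (1 + a - c) (1 + a - d) * rGamma b * rGamma c * rGamma d"
  for a :: complex

lemma KK_Kfun: "KK (vector [a, b, c, d, e, f, g]) = Kfun a b c d e f g"
  by (simp add: KK_def Kfun_def Let_def)

lemma Kfun_of_real:
  assumes "e + f + g - a - b - c - d = 1"
  shows "Kfun (of_real a) (of_real b) (of_real c) (of_real d) (of_real e) (of_real f) (of_real g) = of_real (KR a b c d e f g)"
proof -
  have 1: "1 + complex_of_real x - complex_of_real y = of_real (1 + x - y)" for x y by simp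
  have "(1 + a - b) + (1 + a - c) + (1 + a - d) - a - (1 + a - e) - (1 + a - f) - (1 + a - g) = 1" using assms by simp
  thus ?thesis using assms
    unfolding Kfun_def KR_def 1 rGamma_complex_of_real by (simp only: suminf_F43_termR_of_real of_real_add of_real_mult)
qed

lemma KR_sym:
  "KR a b c d e f g = KR a c b d f g e" "KR a b c d e f g = KR a b c d f e g"
  "KR a b c d e f g = KR a b c d g e f"
proof -
  have F: "F43_termR a b c d e f g = F43_termR a c b d f g e" "F43_termR a b c d e f g = F43_termR a b c d f e g"
    "F43_termR a b c d e f g = F43_termR a b c d g e f" "F43_termR a b c d e f g = F43_termR a c d b f e g"
    "F43_termR a b c d e f g = F43_termR a c b d e f g" "F43_termR a b c d e f g = F43_termR a d b c e f g" for a b c d e f g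
    by (simp_all add: F43_termR_def fun_eq_iff mult_ac)
  show "KR a b c d e f g = KR a b c d f e g"
    unfolding KR_def F(2)[of a b c d e f g] F(5)[of a "1 + a - e" "1 + a - f"] by simp
  show "KR a b c d e f g = KR a b c d g e f"
    unfolding KR_def F(3)[of a b c d e f g] F(6)[of a "1 + a - e" "1 + a - f" "1 + a - g"] by simp
  show "KR a b c d e f g = KR a c b d f g e"
    unfolding KR_def F(1)[of a b c d e f g] F(4)[of a "1 + a - e" "1 + a - f" "1 + a - g"] by simp
qed

section \<open>The region of admissible parameters and the two relations to be combined\<close>

lemma box_pos:
  fixes t1 t2 t3 t4 t5 t6 u1 u2 u3 u4 u5 u6 :: real
  assumes u: "- u1 \<le> t1" "t1 \<le> u1" "- u2 \<le> t2" "t2 \<le> u2" "- u3 \<le> t3" "t3 \<le> u3"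
    "- u4 \<le> t4" "t4 \<le> u4" "- u5 \<le> t5" "t5 \<le> u5" "- u6 \<le> t6" "t6 \<le> u6"
    and v: "u1 + u2 + u3 + u4 + u5 + u6 < 1"
  shows "0 < 1 + t1 + t2 + t3 + t4 + t5 + t6" "0 < 1 + t1 - t2 - t3 + t4 + t5 + t6"
    "0 < 1 - t1 + t2 - t3 + t4 + t5 + t6" "0 < 1 - t1 - t2 + t3 + t4 + t5 + t6"
    "0 < 1 + t1 + t2 + t3 + t4 - t5 - t6" "0 < 1 + t1 + t2 + t3 - t4 + t5 - t6"
    "0 < 1 + t1 + t2 + t3 - t4 - t5 + t6"
    "0 < 1 - t1 + t2 + t3 - t4 + t5 + t6" "0 < 1 + t1 - t2 + t3 - t4 + t5 + t6"
    "0 < 1 + t1 + t2 - t3 + t4 - t5 + t6" "0 < 1 + t1 + t2 - t3 + t4 + t5 - t6"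
    "0 < 1 + t5 + t6" "0 < 1 + t4 + t6" "0 < 1 + t4 + t5" "0 < 1 + t2 + t3" "0 < 1 + t1 + t3" "0 < 1 + t1 + t2"
    "\<bar>t4 - t3\<bar> < 1"
proof -
  show "\<bar>t4 - t3\<bar> < 1"
    unfolding abs_less_iff by (rule conjI; insert u v; linarith)
qed (insert u v, linarith+)

text \<open>Each quantity required to be positive is 1 plus a signed sum of distinct t's, possibly
  halved, and \<rho> = t4 - t3. The hypothesis is invariant under signed permutations, so applying
  the lemma to permuted and negated t's covers every image point.\<close>

lemma admissible_t:
  assumes "\<bar>t1\<bar> + \<bar>t2\<bar> + \<bar>t3\<bar> + \<bar>t4\<bar> + \<bar>t5\<bar> + \<bar>t6\<bar> < (1::real)"
    and "a = (1 + t1 + t2 + t3 + t4 + t5 + t6) / 2" "b = (1 + t1 - t2 - t3 + t4 + t5 + t6) / 2"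
     "c = (1 - t1 + t2 - t3 + t4 + t5 + t6) / 2" "d = (1 - t1 - t2 + t3 + t4 + t5 + t6) / 2"
     "e = 1 + t5 + t6" "f = 1 + t4 + t6" "g = 1 + t4 + t5"
  shows "admissible a b c d e f g"
proof -
  have m: "- \<bar>x\<bar> \<le> x" for x :: real by (rule abs_le_D2[THEN neg_le_iff_le[THEN iffD2], of x "\<bar>x\<bar>", simplified minus_minus]) (rule order_refl)
  have r: "b + c - e = t4 - t3" "1 + a - e = (1 + t1 + t2 + t3 + t4 - t5 - t6) / 2" "1 + a - f = (1 + t1 + t2 + t3 - t4 + t5 - t6) / 2"
    "1 + a - g = (1 + t1 + t2 + t3 - t4 - t5 + t6) / 2" "1 + a - b = 1 + t2 + t3" "1 + a - c = 1 + t1 + t3" "1 + a - d = 1 + t1 + t2"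
    "e - b = (1 - t1 + t2 + t3 - t4 + t5 + t6) / 2" "e - c = (1 + t1 - t2 + t3 - t4 + t5 + t6) / 2"
    "f - d = (1 + t1 + t2 - t3 + t4 - t5 + t6) / 2" "g - d = (1 + t1 + t2 - t3 + t4 + t5 - t6) / 2"
    "e + f + g - a - b - c - d = 1"
    unfolding assms(2-) by (simp_all add: field_simps)
  note pos = box_pos[OF m abs_ge_self m abs_ge_self m abs_ge_self m abs_ge_self m abs_ge_self m abs_ge_self assms(1)]
  show ?thesis unfolding admissible_def r unfolding assms(2-)
    by (intro conjI refl pos half_gt_zero)
qed

text \<open>The second relation is the first one at another point of the \<open>M_K\<close>-orbit.
  There the leading two values of \<open>K\<close> are the second and first of the original
  relation, by invariance under \<open>G_K\<close>, and the third is \<open>K_n4\<close>.\<close>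

lemma box_relations:
  fixes t1 t2 t3 t4 t5 t6 :: real
  assumes t: "\<bar>t1\<bar> + \<bar>t2\<bar> + \<bar>t3\<bar> + \<bar>t4\<bar> + \<bar>t5\<bar> + \<bar>t6\<bar> < 1" and ne: "t3 \<noteq> t4" "t5 \<noteq> t6"
    and p: "a = (1 + t1 + t2 + t3 + t4 + t5 + t6) / 2" "b = (1 + t1 - t2 - t3 + t4 + t5 + t6) / 2"
     "c = (1 - t1 + t2 - t3 + t4 + t5 + t6) / 2" "d = (1 - t1 - t2 + t3 + t4 + t5 + t6) / 2"
     "e = 1 + t5 + t6" "f = 1 + t4 + t6" "g = 1 + t4 + t5"
  shows "- (cos (pi * (b - c)) * sin (pi * (a - d)) + cos (pi * (f - g)) * sin (pi * e) - cos (pi * (b + c - e)) * sin (pi * (a - d - e)))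
        / (2 * pi ^ 2) * rGamma (1 + d - e) * KR a b c d e f g
    + sin (pi * e) * (rGamma (f - d) * rGamma (g - d) * rGamma (1 + a - f) * rGamma (1 + a - g)) * rGamma (1 + a - e) * KR d b c a e f g
    + sin (pi * (a - d)) * (rGamma b * rGamma c * rGamma (e - b) * rGamma (e - c)) * rGamma d
        * KR (1 + a - e) (1 + b - e) (1 + c - e) (1 + d - e) (2 - e) (1 + f - e) (1 + g - e) = 0" (is ?R1)
    and "- (cos (pi * (b - c)) * sin (pi * (d - a)) + cos (pi * (b + c - e)) * sin (pi * (1 + a + d - e)) - cos (pi * (f - g)) * sin (pi * (d - a - (1 + a + d - e))))
        / (2 * pi ^ 2) * rGamma (e - d) * KR d b c a e f g
    + sin (pi * (1 + a + d - e)) * (rGamma (f - a) * rGamma (1 + d - g) * rGamma (1 + d - f) * rGamma (g - a)) * rGamma (e - a) * KR a b c d e f g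
    + sin (pi * (d - a)) * (rGamma (f - b) * rGamma (f - c) * rGamma (g - c) * rGamma (g - b)) * rGamma a
        * KR (e - a) (e - b) (e - c) (e - d) (1 + e - f) (1 + e - g) e = 0" (is ?R2)
proof -
  have a1: "admissible a b c d e f g" by (rule admissible_t[OF t]) fact+
  have a2: "admissible d b c a e f g" by (rule admissible_t[of "- t2" "- t1" t3 t4 t5 t6]) (use t in \<open>simp_all add: p field_simps\<close>)
  have a3: "admissible (1 + a - e) (1 + b - e) (1 + c - e) (1 + d - e) (2 - e) (1 + f - e) (1 + g - e)"
    by (rule admissible_t[of t1 t2 t3 t4 "- t6" "- t5"]) (use t in \<open>simp_all add: p field_simps\<close>)
  have "b + c - e \<noteq> 0" using ne by (simp add: p field_simps)
  with a1 a2 a3 show ?R1 by (rule KR_three_term_factored)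
  \<comment> \<open>The point d, b', c', a, e', f, g' has coordinates (-t1, -t2, t5, t6, t3, t4).
    Its number \<rho> is f - g = t6 - t5, whence the hypothesis on t5 and t6.\<close>
  define b' c' e' g' where "b' = f - b" and "c' = f - c" and "e' = 1 + a + d - e" and "g' = 1 + a + d - g"
  have b1: "admissible d b' c' a e' f g'"
    by (rule admissible_t[of "- t1" "- t2" t5 t6 t3 t4]) (use t in \<open>simp_all add: p b'_def c'_def e'_def g'_def field_simps\<close>)
  have b2: "admissible a b' c' d e' f g'"
    by (rule admissible_t[of t2 t1 t5 t6 t3 t4]) (use t in \<open>simp_all add: p b'_def c'_def e'_def g'_def field_simps\<close>)
  have b3: "admissible (1 + d - e') (1 + b' - e') (1 + c' - e') (1 + a - e') (2 - e') (1 + f - e') (1 + g' - e')"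
    by (rule admissible_t[of "- t1" "- t2" t5 t6 "- t4" "- t3"]) (use t in \<open>simp_all add: p b'_def c'_def e'_def g'_def field_simps\<close>)
  have nz: "b' + c' - e' \<noteq> 0" using ne by (simp add: p b'_def c'_def e'_def field_simps)
  \<comment> \<open>\<open>KR_swap\<close> exchanges only the third and fourth coordinate.
    Conjugated with visible permutations of the parameters it yields the invariance needed for
    \<open>k1\<close>, \<open>k2\<close> and \<open>k3\<close>.\<close>
  have "admissible d b c a f e g" by (rule admissible_t[of "- t2" "- t1" t3 t5 t4 t6]) (use t in \<open>simp_all add: p field_simps\<close>)
  moreover have "admissible d (f - c) (f - b) a f (1 + d + a - g) (1 + d + a - e)"
    by (rule admissible_t[of "- t2" "- t1" t5 t3 t4 t6]) (use t in \<open>simp_all add: p field_simps\<close>)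
  ultimately have "KR d (f - c) (f - b) a f (1 + d + a - g) (1 + d + a - e) = KR d b c a f e g"
    by (rule KR_swap)
  hence k1: "KR d b' c' a e' f g' = KR d b c a e f g"
    using KR_sym(1)[of d b' c' a e' f g'] KR_sym(2)[of d b c a f e g]
    by (simp add: b'_def c'_def e'_def g'_def add_ac)
  have "admissible a b c d f e g" by (rule admissible_t[of t1 t2 t3 t5 t4 t6]) (use t in \<open>simp_all add: p field_simps\<close>)
  moreover have "admissible a (f - c) (f - b) d f (1 + a + d - g) (1 + a + d - e)"
    by (rule admissible_t[of t1 t2 t5 t3 t4 t6]) (use t in \<open>simp_all add: p field_simps\<close>)
  ultimately have "KR a (f - c) (f - b) d f (1 + a + d - g) (1 + a + d - e) = KR a b c d f e g"
    by (rule KR_swap)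
  hence k2: "KR a b' c' d e' f g' = KR a b c d e f g"
    using KR_sym(1)[of a b' c' d e' f g'] KR_sym(2)[of a b c d f e g]
    by (simp add: b'_def c'_def e'_def g'_def)
  have "admissible (e - a) (e - b) (e - c) (e - d) (1 + e - g) (1 + e - f) e"
    by (rule admissible_t[of "- t1" "- t2" "- t3" t5 t6 "- t4"]) (use t in \<open>simp_all add: p field_simps\<close>)
  moreover have "admissible (e - a) (1 + e - g - (e - c)) (1 + e - g - (e - b)) (e - d) (1 + e - g) (1 + (e - a) + (e - d) - e) (1 + (e - a) + (e - d) - (1 + e - f))"
    by (rule admissible_t[of "- t1" "- t2" t5 "- t3" t6 "- t4"]) (use t in \<open>simp_all add: p field_simps\<close>)
  ultimately have "KR (e - a) (1 + e - g - (e - c)) (1 + e - g - (e - b)) (e - d) (1 + e - g) (1 + (e - a) + (e - d) - e) (1 + (e - a) + (e - d) - (1 + e - f)) = KR (e - a) (e - b) (e - c) (e - d) (1 + e - g) (1 + e - f) e"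
    by (rule KR_swap)
  moreover have "1 + e - g - (e - c) = 1 + b' - e'" "1 + e - g - (e - b) = 1 + c' - e'" "1 + (e - a) + (e - d) - e = 2 - e'"
     "1 + (e - a) + (e - d) - (1 + e - f) = 1 + f - e'" "1 + e - g = 1 + g' - e'" "e - a = 1 + d - e'" "e - d = 1 + a - e'"
    by (simp_all add: p b'_def c'_def e'_def g'_def field_simps)
  ultimately have "KR (1 + d - e') (1 + b' - e') (1 + c' - e') (1 + a - e') (1 + g' - e') (2 - e') (1 + f - e') = KR (e - a) (e - b) (e - c) (e - d) (1 + e - g) (1 + e - f) e"
    by (simp only:)
  hence k3: "KR (1 + d - e') (1 + b' - e') (1 + c' - e') (1 + a - e') (2 - e') (1 + f - e') (1 + g' - e') = KR (e - a) (e - b) (e - c) (e - d) (1 + e - f) (1 + e - g) e"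
    using KR_sym(3)[of "1 + d - e'" "1 + b' - e'" "1 + c' - e'" "1 + a - e'" "2 - e'" "1 + f - e'" "1 + g' - e'"]
      KR_sym(2)[of "e - a" "e - b" "e - c" "e - d" "1 + e - g" "1 + e - f" e]
    by (simp only:)
  have q: "b' - c' = - (b - c)" "f - g' = b + c - e" "b' + c' - e' = f - g" "1 + a - e' = e - d" "g' - a = 1 + d - g" "1 + d - g' = g - a"
    "1 + d - e' = e - a" "e' - b' = g - c" "e' - c' = g - b"
    by (simp_all add: p b'_def c'_def e'_def g'_def field_simps)
  show ?R2
    using KR_three_term_factored[OF b1 b2 b3 nz] unfolding k1 k2 k3 unfolding q mult_minus_right cos_minus e'_def[symmetric]
    unfolding b'_def c'_def .
qed

subsection \<open>Signed-permutation coordinates and the extended coefficients\<close>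

text \<open>Every point of \<open>VV\<close> outside \<open>VV_generic\<close> is a limit of generic
  points, so a continuous \<open>G\<close> that agrees with \<open>h\<close> on generic points has
  to be the extension.\<close>

lemma continuous_extension_eq:
  assumes h: "\<And>y. y \<in> VV_generic \<Longrightarrow> h y = G y" and G: "continuous_on UNIV G" and x: "x \<in> VV"
  shows "continuous_extension h x = G x"
proof (cases "x \<in> VV_generic")
  case True
  thus ?thesis by (simp add: continuous_extension_def h)
next
  case False
  hence s0: "sinpi (x$3 - x$2) = 0" using x by (simp add: VV_generic_def)
  \<comment> \<open>Raising \<open>c\<close> and \<open>e\<close> together stays in
    \<open>VV\<close> and moves c - b by w. The denominators n + 2 keep w strictly between 0 and 1,
    where sin(pi w) is nonzero.\<close>
  define v :: "complex^7" where "v = vector [0, 0, 1, 0, 1, 0, 0]"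
  define y where "y = (\<lambda>n. x + of_real (1 / real (n + 2)) *s v)"
  have gen: "y n \<in> VV_generic" for n
  proof -
    define w where "w = 1 / real (n + 2)"
    have w: "0 < w" "w < 1" by (simp_all add: w_def)
    have "sin (pi * w) \<noteq> 0" using w by (intro sin_pi_nonzero) auto
    hence s1: "sinpi (of_real w) \<noteq> 0"
      by (simp only: sinpi_def of_real_mult[symmetric] sin_of_real of_real_eq_0_iff not_False_eq_True)
    have "y n \<in> VV" using x by (simp add: y_def v_def VV_def algebra_simps)
    moreover have "sinpi (y n $ 3 - y n $ 2) \<noteq> 0"
    proof
      assume z: "sinpi (y n $ 3 - y n $ 2) = 0"
      define \<alpha> where "\<alpha> = of_real pi * (x $ 3 - x $ 2)"
      have "sin \<alpha> = 0" using s0 by (simp add: \<alpha>_def sinpi_def)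
      moreover have "y n $ 3 - y n $ 2 = (x $ 3 - x $ 2) + of_real w"
        by (simp add: y_def v_def w_def)
      hence "sin (\<alpha> + of_real pi * of_real w) = 0" using z by (simp add: \<alpha>_def sinpi_def distrib_left)
      ultimately have "cos \<alpha> * sin (of_real pi * of_real w) = 0" by (simp add: sin_add)
      moreover have "cos \<alpha> \<noteq> 0" using \<open>sin \<alpha> = 0\<close> sin_cos_squared_add[of \<alpha>] by auto
      ultimately show False using s1 by (simp add: sinpi_def)
    qed
    ultimately show ?thesis by (simp add: VV_generic_def)
  qed
  have lim: "y \<longlonglongrightarrow> x"
  proof -
    have "(\<lambda>n. 1 / real (n + 2)) \<longlonglongrightarrow> 0" by real_asymp
    hence "(\<lambda>n. complex_of_real (1 / real (n + 2))) \<longlonglongrightarrow> of_real 0" by (rule tendsto_of_real)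
    hence "(\<lambda>n. x $ i + of_real (1 / real (n + 2)) * v $ i) \<longlonglongrightarrow> x $ i + of_real 0 * v $ i" for i
      by (intro tendsto_add tendsto_mult tendsto_const)
    thus ?thesis unfolding y_def by (intro vec_tendstoI) simp
  qed
  have "x islimpt VV_generic"
    unfolding islimpt_sequential using gen lim False by (intro exI[of _ y]) auto
  hence nb: "at x within VV_generic \<noteq> bot" by (simp add: trivial_limit_within)
  have "(G \<longlongrightarrow> G x) (at x)" using G by (simp add: continuous_on_def)
  hence "(G \<longlongrightarrow> G x) (at x within VV_generic)" by (rule tendsto_within_subset) simp
  hence "(h \<longlongrightarrow> G x) (at x within VV_generic)"
    by (rule Lim_transform_eventually) (auto simp: eventually_at_filter h)
  hence "Lim (at x within VV_generic) h = G x" by (rule tendsto_Lim[OF nb])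
  thus ?thesis using False by (simp add: continuous_extension_def)
qed

lemma coeff_bracket_quadratic:
  fixes t1 t2 t3 t4 h :: complex
  shows "sin (t2 + t4) * cos (h - t1 + t3) - sin (t1 + t4) * cos (h - t2 + t3) = sin (t2 - t1) * cos (h + (t3 + t4))"
proof -
  have "t2 + t4 + (h - t1 + t3) = (h + (t3 + t4)) + (t2 - t1)" "t2 + t4 - (h - t1 + t3) = t1 + t2 + t4 - h - t3"
    "t1 + t4 + (h - t2 + t3) = (h + (t3 + t4)) - (t2 - t1)" "t1 + t4 - (h - t2 + t3) = t1 + t2 + t4 - h - t3" by simp_all
  hence e: "sin (t2 + t4) * cos (h - t1 + t3) = (sin ((h + (t3 + t4)) + (t2 - t1)) + sin (t1 + t2 + t4 - h - t3)) / 2"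
    "sin (t1 + t4) * cos (h - t2 + t3) = (sin ((h + (t3 + t4)) - (t2 - t1)) + sin (t1 + t2 + t4 - h - t3)) / 2"
    unfolding sin_times_cos by (simp_all only:)
  have "(u + z) / 2 - (v + z) / 2 = (u - v) / 2" for u v z :: complex
    by (simp add: diff_divide_distrib add_divide_distrib)
  moreover have "sin (x + y) - sin (x - y) = 2 * (sin y * cos x)" for x y :: complex
    by (simp add: sin_add sin_diff)
  ultimately show ?thesis unfolding e by (simp only:) simp
qed

text \<open>Both sides are quadratic in \<open>R\<close>; the coefficients of 1, R and R^2 are
  compared separately, the last by \<open>coeff_bracket_quadratic\<close>.\<close>

lemma coeff_bracket:
  fixes t1 t2 t3 t4 h R :: complex
  assumes p: "p = t1 + t2" and q: "q = t3 + t4" and r: "r = h + h - (t1 + t2) + (t3 + t4)"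
    and P: "P = cos (t1 - t2)" and Q: "Q = cos (t3 - t4)"
  shows "sin (t2 - t1) * coeff_factor p q r P Q R h =
    - ((cos (t1 - t2 + q) + R) / 2) * sin (t2 + t4) * cos (h - t1 + t3) * ((cos (t1 - t4) * sin (t2 + t3 - r) + sin (t2 + t3) * cos (t2 - t3) - R * sin r) / 2)
    + ((cos (t2 - t1 + q) + R) / 2) * sin (t1 + t4) * cos (h - t2 + t3) * ((cos (t2 - t4) * sin (t1 + t3 - r) + sin (t1 + t3) * cos (t1 - t3) - R * sin r) / 2)"
proof -
  define X1 where "X1 = (Q * cos r + P) * sin (p + q) * cos h - sin r * P * cos h
        - sin r * Q * (cos p * cos q * cos h - 2 * sin q * cos p * sin h + sin q * sin p * cos h)"
  define X0 where "X0 = (Q * cos r + P) * (sin p * P + sin q * Q) * cos h - sin r * Q * P * cos p * cos h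
        + sin r * sin q * (Q * Q * sin h - sin p * cos (h - p))"
  have coeff_factor: "coeff_factor p q r P Q R h = - 1 / 4 * (X0 + R * X1 - R\<^sup>2 * sin r * cos (h + q))"
  proof -
    have "(((Q * cr + P) * (sp * (R * cq + P) + sq * (Q + R * cp)) - sr * (R + Q * cp) * (R * cq + P)) * ch
      + sr * sq * ((R\<^sup>2 + Q\<^sup>2) * sh + R * Q * (2 * cp * sh - sp * ch) - sp * chp))
      = ((Q * cr + P) * (sp * P + sq * Q) * ch - sr * Q * P * cp * ch + sr * sq * (Q * Q * sh - sp * chp))
       + R * ((Q * cr + P) * (sp * cq + cp * sq) * ch - sr * P * ch - sr * Q * (cp * cq * ch - 2 * sq * cp * sh + sq * sp * ch))
       - R\<^sup>2 * sr * (ch * cq - sh * sq)" for cr sp cq sq cp sr ch sh chp :: complex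
      by (simp add: algebra_simps power2_eq_square)
    thus ?thesis unfolding coeff_factor_def X1_def X0_def cos_add[of h q] sin_add[of p q] by (rule arg_cong)
  qed
  define A B C1 C2 V1 V2 where "A = sin (t2 + t4) * cos (h - t1 + t3)" and "B = sin (t1 + t4) * cos (h - t2 + t3)"
    and "C1 = cos (t1 - t2 + q)" and "C2 = cos (t2 - t1 + q)"
    and "V1 = cos (t1 - t4) * sin (t2 + t3 - r) + sin (t2 + t3) * cos (t2 - t3)"
    and "V2 = cos (t2 - t4) * sin (t1 + t3 - r) + sin (t1 + t3) * cos (t1 - t3)"
  have l0: "sin (t2 - t1) * X0 = A * C1 * V1 - B * C2 * V2"
    unfolding X0_def A_def B_def C1_def C2_def V1_def V2_def p q by (rule coeff_bracket_coeffs(2)[OF r P Q])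
  have l1: "sin (t2 - t1) * X1 = A * (V1 - C1 * sin r) - B * (V2 - C2 * sin r)"
    unfolding X1_def A_def B_def C1_def C2_def V1_def V2_def p q by (rule coeff_bracket_coeffs(1)[OF r P Q])
  have l2: "sin (t2 - t1) * cos (h + q) = A - B"
    unfolding A_def B_def q by (rule coeff_bracket_quadratic[symmetric])
  have "sin (t2 - t1) * coeff_factor p q r P Q R h = - 1 / 4 * (sin (t2 - t1) * X0 + R * (sin (t2 - t1) * X1) - R\<^sup>2 * sin r * (sin (t2 - t1) * cos (h + q)))"
    unfolding coeff_factor by (simp add: algebra_simps)
  also have "\<dots> = - 1 / 4 * ((A * C1 * V1 - B * C2 * V2) + R * (A * (V1 - C1 * sin r) - B * (V2 - C2 * sin r)) - R\<^sup>2 * sin r * (A - B))"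
    unfolding l0 l1 l2 ..
  also have "\<dots> = - ((C1 + R) / 2) * A * ((V1 - R * sin r) / 2) + ((C2 + R) / 2) * B * ((V2 - R * sin r) / 2)"
  proof -
    have "- 1 / 4 * ((A * C1 * V1 - B * C2 * V2) + R * (A * (V1 - C1 * S) - B * (V2 - C2 * S)) - R\<^sup>2 * S * (A - B))
       = - ((C1 + R) / 2) * A * ((V1 - R * S) / 2) + ((C2 + R) / 2) * B * ((V2 - R * S) / 2)" for S
      by (simp add: algebra_simps power2_eq_square add_divide_distrib diff_divide_distrib)
    thus ?thesis .
  qed
  finally show ?thesis unfolding A_def B_def C1_def C2_def V1_def V2_def by (simp only: mult.assoc)
qed

text \<open>The affine version of \<open>YY\<close>: it parametrises \<open>VV\<close>.\<close>

definition tpoint where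
  "tpoint t1 t2 t3 t4 t5 t6 = vector [(1 + t1 + t2 + t3 + t4 + t5 + t6) / 2, (1 + t1 - t2 - t3 + t4 + t5 + t6) / 2,
     (1 - t1 + t2 - t3 + t4 + t5 + t6) / 2, (1 - t1 - t2 + t3 + t4 + t5 + t6) / 2, 1 + t5 + t6, 1 + t4 + t6, 1 + t4 + t5]"
  for t1 :: complex

lemma tpoint_in_VV: "tpoint t1 t2 t3 t4 t5 t6 \<in> VV"
  by (simp add: tpoint_def VV_def field_simps)

lemma VV_tpoint:
  assumes "x \<in> VV"
  shows "\<exists>t1 t2 t3 t4 t5 t6. x = tpoint t1 t2 t3 t4 t5 t6"
proof -
  define y1 y2 y3 y4 where "y1 = x$1 / 2" and "y2 = x$2 / 2" and "y3 = x$3 / 2" and "y4 = x$4 / 2"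
  define t1 t2 t3 t4 t5 t6 where "t1 = y1 + y2 - y3 - y4" and "t2 = y1 - y2 + y3 - y4" and "t3 = y1 - y2 - y3 + y4"
    and "t4 = y1 + y2 + y3 + y4 - x$5" and "t5 = y1 + y2 + y3 + y4 - x$6" and "t6 = y1 + y2 + y3 + y4 - x$7"
  note t = t1_def t2_def t3_def t4_def t5_def t6_def
  have y: "x$1 = y1 + y1" "x$2 = y2 + y2" "x$3 = y3 + y3" "x$4 = y4 + y4"
    by (simp_all add: y1_def y2_def y3_def y4_def)
  have g: "x $ 7 = 1 + x $ 1 + x $ 2 + x $ 3 + x $ 4 - x $ 5 - x $ 6"
    using assms by (simp add: VV_def algebra_simps)
  have 1: "1 + t1 + t2 + t3 + t4 + t5 + t6 = x$1 + x$1" "1 + t1 - t2 - t3 + t4 + t5 + t6 = x$2 + x$2"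
    "1 - t1 + t2 - t3 + t4 + t5 + t6 = x$3 + x$3" "1 - t1 - t2 + t3 + t4 + t5 + t6 = x$4 + x$4"
    and 2: "1 + t5 + t6 = x$5" "1 + t4 + t6 = x$6" "1 + t4 + t5 = x$7"
    unfolding t g y by simp_all
  have "x = tpoint t1 t2 t3 t4 t5 t6"
    unfolding vec_eq_7_iff tpoint_def 1 2 by simp
  thus ?thesis by blast
qed

definition cospi :: "complex \<Rightarrow> complex" where "cospi z = cos (of_real pi * z)"

text \<open>The last two summands in the parentheses add up to half the sum of sin(2 pi ti) for i =
  1, ..., 4. Thus gamma divided by sin pi(e - b) is symmetric in t1, ..., t4 and in t5, t6.\<close>

definition gam_factor :: "complex \<Rightarrow> complex \<Rightarrow> complex \<Rightarrow> complex \<Rightarrow> complex \<Rightarrow> complex \<Rightarrow> complex" where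
  "gam_factor t1 t2 t3 t4 t5 t6 = (cospi (t5 - t6) * sinpi (t1 + t2 + t3 + t4) + sinpi (t1 + t2) * cospi (t1 - t2)
     + sinpi (t3 + t4) * cospi (t3 - t4)) / 2"

lemma sinpi_1_plus: "sinpi (1 + z) = - sinpi z" "sinpi (1 - z) = sinpi z" "sinpi (- z) = - sinpi z" "cospi (- z) = cospi z"
  by (simp_all add: sinpi_def cospi_def distrib_left right_diff_distrib sin_add sin_diff)

lemma sinpi_half_plus: "sinpi (1 / 2 + z) = cospi z" "sinpi (1 / 2 - z) = cospi z"
proof -
  have h: "of_real pi * (1 / 2) = (of_real (pi / 2) :: complex)" by simp
  have "sin (complex_of_real (pi / 2)) = 1" "cos (complex_of_real (pi / 2)) = 0"
    by (simp_all only: sin_of_real cos_of_real sin_pi_half cos_pi_half of_real_1 of_real_0)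
  thus "sinpi (1 / 2 + z) = cospi z" "sinpi (1 / 2 - z) = cospi z"
    unfolding sinpi_def cospi_def distrib_left right_diff_distrib h sin_add sin_diff by simp_all
qed

definition gam_poly :: "complex^7 \<Rightarrow> complex" where
  "gam_poly x = (let a = x$1; b = x$2; c = x$3; e = x$5; f = x$6; g = x$7 in
     sinpi (e - b) * ((cospi (f - g) * sinpi (2 * a - e) + sinpi (e + f + g - 2 * a - b - c) * cospi (b - c)
     - cospi (e - b - c) * sinpi (f + g - b - c)) / 2))"

lemma gam_bracket_pi:
  "sinpi (a - c) * sinpi (e - a - b) * sinpi (f - b) * sinpi (g - b) - sinpi (a - b) * sinpi (e - a - c) * sinpi (f - c) * sinpi (g - c)
    = sinpi (c - b) * ((cospi (f - g) * sinpi (2 * a - e) + sinpi (e + f + g - 2 * a - b - c) * cospi (b - c) - cospi (e - b - c) * sinpi (f + g - b - c)) / 2)"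
proof -
  show ?thesis
    unfolding sinpi_def cospi_def right_diff_distrib[of "of_real pi"] distrib_left[of "of_real pi"]
      mult.left_commute[of "of_real pi" 2] by (rule gam_bracket)
qed

lemma gam_eq:
  assumes "x \<in> VV"
  shows "gam x = gam_poly x"
  unfolding gam_def
proof (rule continuous_extension_eq[OF _ _ assms], goal_cases)
  case (1 y)
  hence nz: "sinpi (y$3 - y$2) \<noteq> 0" by (simp add: VV_generic_def)
  show ?case
    unfolding gam_poly_def Let_def gam_bracket_pi using nz by (simp only: mult.assoc[symmetric] nonzero_eq_divide_eq times_divide_eq_left) simp
qed (auto simp: gam_poly_def Let_def sinpi_def cospi_def intro!: continuous_intros)

lemma gam_tpoint: "gam (tpoint t1 t2 t3 t4 t5 t6) = sinpi ((1 - t1 + t2 + t3 - t4 + t5 + t6) / 2) * gam_factor t1 t2 t3 t4 t5 t6"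
proof -
  define a b c e f g where "a = (1 + t1 + t2 + t3 + t4 + t5 + t6) / 2" and "b = (1 + t1 - t2 - t3 + t4 + t5 + t6) / 2"
     and "c = (1 - t1 + t2 - t3 + t4 + t5 + t6) / 2" and "e = 1 + t5 + t6" and "f = 1 + t4 + t6" and "g = 1 + t4 + t5"
  have bb: "b + b = 1 + t1 - t2 - t3 + t4 + t5 + t6" and cc: "c + c = 1 - t1 + t2 - t3 + t4 + t5 + t6"
    and aa: "2 * a = 1 + t1 + t2 + t3 + t4 + t5 + t6"
    by (simp_all add: a_def b_def c_def)
  have bc: "b + c = 1 - t3 + t4 + t5 + t6" by (simp add: b_def c_def add_divide_distrib[symmetric])
  have e1: "e - b = (1 - t1 + t2 + t3 - t4 + t5 + t6) / 2"
    by (simp add: e_def b_def field_simps)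
  have e2: "f - g = - (t5 - t6)" by (simp add: f_def g_def)
  have e3: "2 * a - e = t1 + t2 + t3 + t4" unfolding aa e_def by simp
  have e4: "e + f + g - 2 * a - b - c = 1 - (t1 + t2)"
  proof -
    have "e + f + g - 2 * a - b - c = e + f + g - 2 * a - (b + c)" by simp
    also have "\<dots> = 1 - (t1 + t2)" unfolding aa bc e_def f_def g_def by simp
    finally show ?thesis .
  qed
  have e5: "b - c = t1 - t2" by (simp add: b_def c_def diff_divide_distrib[symmetric])
  have e6: "e - b - c = t3 - t4"
  proof -
    have "e - b - c = e - (b + c)" by simp
    thus ?thesis unfolding bc e_def by simp
  qed
  have e7: "f + g - b - c = 1 + (t3 + t4)"
  proof -
    have "f + g - b - c = f + g - (b + c)" by simp
    thus ?thesis unfolding bc f_def g_def by simp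
  qed
  have "gam_poly (tpoint t1 t2 t3 t4 t5 t6) = sinpi (e - b) * ((cospi (f - g) * sinpi (2 * a - e) + sinpi (e + f + g - 2 * a - b - c) * cospi (b - c)
     - cospi (e - b - c) * sinpi (f + g - b - c)) / 2)"
    by (simp only: gam_poly_def Let_def tpoint_def vector_7_nth a_def b_def c_def e_def f_def g_def)
  thus ?thesis unfolding gam_eq[OF tpoint_in_VV] e4 e6 e7 unfolding e1 e2 e3 e5 sinpi_1_plus gam_factor_def
    by (simp add: mult.commute)
qed

subsection \<open>Elimination\<close>

text \<open>The first relation is multiplied by V z q1 and the second by sr x1 r2. The
  \<open>K2\<close> terms cancel, and by \<open>M\<close> the remainder is divisible by
  \<open>sp\<close>.\<close>

lemma elimination_step:
  fixes K K2 K3 K4 :: "'a::field"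
  assumes R1: "- U * z * r1 * K + - sr * x1 * r2 * K2 + sp * r3 * K3 = 0"
    and R2: "V * z * q1 * K2 + - sq * x2 * q2 * K + - sp * q3 * K4 = 0"
    and rq: "r1 * q1 = ch * i" "r2 * q2 = chp * i" "x1 * x2 = W * (z * z)"
    and M: "U * V * ch + sr * sq * W * chp = - 4 * (sp * C)" and sp: "sp \<noteq> 0"
  shows "4 * (z * z) * i * C * K + V * z * q1 * r3 * K3 - sr * x1 * r2 * q3 * K4 = 0"
proof -
  have "0 = (V * z * q1) * (- U * z * r1 * K + - sr * x1 * r2 * K2 + sp * r3 * K3)
    + (sr * x1 * r2) * (V * z * q1 * K2 + - sq * x2 * q2 * K + - sp * q3 * K4)"
    unfolding R1 R2 by simp
  also have "\<dots> = - (U * V * (z * z) * (r1 * q1) * K) - sr * sq * (x1 * x2) * (r2 * q2) * K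
      + sp * (V * z * q1 * r3 * K3 - sr * x1 * r2 * q3 * K4)"
    by (simp add: algebra_simps)
  also have "\<dots> = - (U * V * ch + sr * sq * W * chp) * ((z * z) * i * K) + sp * (V * z * q1 * r3 * K3 - sr * x1 * r2 * q3 * K4)"
    unfolding rq by (simp add: algebra_simps)
  also have "\<dots> = sp * (4 * (z * z) * i * C * K + V * z * q1 * r3 * K3 - sr * x1 * r2 * q3 * K4)"
    unfolding M by (simp add: algebra_simps)
  finally show ?thesis using sp by simp
qed

lemma box_elimination:
  fixes t1 t2 t3 t4 t5 t6 :: real
  assumes t: "\<bar>t1\<bar> + \<bar>t2\<bar> + \<bar>t3\<bar> + \<bar>t4\<bar> + \<bar>t5\<bar> + \<bar>t6\<bar> < 1" and ne: "t3 \<noteq> t4" "t5 \<noteq> t6" "t1 + t2 \<noteq> 0"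
    and p: "a = (1 + t1 + t2 + t3 + t4 + t5 + t6) / 2" "b = (1 + t1 - t2 - t3 + t4 + t5 + t6) / 2"
     "c = (1 - t1 + t2 - t3 + t4 + t5 + t6) / 2" "d = (1 - t1 - t2 + t3 + t4 + t5 + t6) / 2"
     "e = 1 + t5 + t6" "f = 1 + t4 + t6" "g = 1 + t4 + t5"
  shows "sin (pi * (e - b)) * coeff_factor (pi * (a - d)) (pi * (a + d - e)) (pi * (e - 1)) (cos (pi * (b - c))) (cos (pi * (b + c - e))) (cos (pi * (f - g))) (pi * (e - d) - pi / 2) * KR a b c d e f g
    + pi ^ 6 * sin (pi * e) * (rGamma a * rGamma (1 + b - e) * rGamma (f - c) * rGamma (f - d) * rGamma (g - c) * rGamma (g - d))
        * (rGamma (1 + a - e) * rGamma (e - b) * rGamma (1 + a - f) * rGamma (1 + a - g) * rGamma (g - b) * rGamma (f - b))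
        * KR (e - a) (e - b) (e - c) (e - d) (1 + e - f) (1 + e - g) e
    + pi ^ 3 * (sin (pi * (e - b)) * ((cos (pi * (f - g)) * sin (pi * (a - d) + pi * (a + d - e)) + cos (pi * (b - c)) * sin (pi * (a - d))
          + cos (pi * (b + c - e)) * sin (pi * (a + d - e))) / 2))
        * (rGamma b * rGamma c * rGamma d * rGamma (e - b) * rGamma (e - c) * rGamma (e - d))
        * KR (1 + a - e) (1 + b - e) (1 + c - e) (1 + d - e) (2 - e) (1 + f - e) (1 + g - e) = 0"
proof -
  have saal: "e + f + g - a - b - c - d = 1" by (simp add: p field_simps)
  define P Q R where "P = cos (pi * (b - c))" and "Q = cos (pi * (b + c - e))" and "R = cos (pi * (f - g))"
  \<comment> \<open>The shifts by pi and pi/2 make all arguments linear in the t's: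
    \<open>p'\<close>, \<open>q\<close>, \<open>r\<close> are pi times t1 + t2, t3 + t4, t5 + t6,
    and \<open>h\<close> is pi times (t1 + t2 + t5 + t6 - t3 - t4) / 2.\<close>
  define p' q r h where "p' = pi * (a - d)" and "q = pi * (a + d - e)" and "r = pi * (e - 1)" and "h = pi * (e - d) - pi / 2"
  define \<rho> where "\<rho> = pi * (b + c - e)"
  define k1 k2 k3 k4 where "k1 = KR a b c d e f g" and "k2 = KR d b c a e f g"
    and "k3 = KR (1 + a - e) (1 + b - e) (1 + c - e) (1 + d - e) (2 - e) (1 + f - e) (1 + g - e)"
    and "k4 = KR (e - a) (e - b) (e - c) (e - d) (1 + e - f) (1 + e - g) e"
  define z where "z = 1 / (2 * pi ^ 2)"
  define U V where "U = P * sin p' - R * sin r + Q * sin (p' - r)" and "V = R * sin (p' + q) + P * sin p' + Q * sin q"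
  define W where "W = R\<^sup>2 + 2 * R * Q * cos p' + Q\<^sup>2 - (sin p')\<^sup>2"
  define r1 r2 q1 q2 where "r1 = rGamma (1 + d - e)" and "r2 = rGamma (1 + a - e)" and "q1 = rGamma (e - d)" and "q2 = rGamma (e - a)"
  define x1 x2 where "x1 = rGamma (f - d) * rGamma (g - d) * rGamma (1 + a - f) * rGamma (1 + a - g)"
    and "x2 = rGamma (f - a) * rGamma (1 + d - g) * rGamma (1 + d - f) * rGamma (g - a)"
  define r3 q3 where "r3 = rGamma b * rGamma c * rGamma (e - b) * rGamma (e - c) * rGamma d"
    and "q3 = rGamma (f - b) * rGamma (f - c) * rGamma (g - c) * rGamma (g - b) * rGamma a"
  have e1: "pi * e = r + pi" "pi * (a - d - e) = (p' - r) - pi" "pi * (d - a) = - p'" "pi * (1 + a + d - e) = q + pi"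
    "pi * (d - a - (1 + a + d - e)) = - (p' + q) - pi" "pi * (e - d) = h + pi / 2" "pi * (e - a) = (h - p') + pi / 2"
    by (simp_all add: r_def p'_def q_def h_def algebra_simps)
  have sh: "sin (x + pi / 2) = cos x" "sin (x - pi) = - sin x" "sin (x + pi) = - sin x" for x :: real
    by (simp_all add: sin_add sin_diff)
  have R1: "- U * z * r1 * k1 + - sin r * x1 * r2 * k2 + sin p' * r3 * k3 = 0"
    using box_relations(1)[OF t ne(1,2) p, folded P_def Q_def R_def k1_def k2_def k3_def p'_def, folded r1_def r2_def x1_def]
    unfolding e1 sh by (simp add: U_def z_def r3_def mult_ac)
  have v: "R * sin (p' + q) - (- (P * sin p') - Q * sin q) = V" by (simp add: V_def)
  have R2: "V * z * q1 * k2 + - sin q * x2 * q2 * k1 + - sin p' * q3 * k4 = 0"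
    using box_relations(2)[OF t ne(1,2) p, folded P_def Q_def R_def k1_def k2_def k4_def, folded q1_def q2_def x2_def]
    unfolding e1 sh sin_minus by (simp add: v z_def q3_def mult_ac)
  have refl: "rGamma x * rGamma y = sin (pi * x) / pi" if "y = 1 - x" for x y :: real
    unfolding that by (simp add: rGamma_reflection_real)
  have c1: "r1 * q1 = cos h * (1 / pi)"
  proof -
    have "q1 * r1 = sin (pi * (e - d)) / pi" unfolding q1_def r1_def by (rule refl) simp
    thus ?thesis unfolding e1 sh by (simp add: mult.commute)
  qed
  have c2: "r2 * q2 = cos (h - p') * (1 / pi)"
  proof -
    have "q2 * r2 = sin (pi * (e - a)) / pi" unfolding q2_def r2_def by (rule refl) simp
    thus ?thesis unfolding e1 sh by (simp add: mult.commute)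
  qed
  have fg: "(f - d) - (g - d) = f - g" "(f - a) - (g - a) = f - g"
    "pi * ((f - d) + (g - d)) = (p' + \<rho>) + pi" "pi * ((f - a) + (g - a)) = - (p' - \<rho>) + pi"
  proof -
    have "(f - d) + (g - d) = (a - d) + (b + c - e) + 1" "(f - a) + (g - a) = - ((a - d) - (b + c - e)) + 1" using saal by simp_all
    thus "pi * ((f - d) + (g - d)) = (p' + \<rho>) + pi" "pi * ((f - a) + (g - a)) = - (p' - \<rho>) + pi"
      by (simp_all only: p'_def \<rho>_def distrib_left right_diff_distrib mult_minus_right mult_1_right)
  qed simp_all
  have ch: "cos (x + pi) = - cos x" for x :: real by (simp add: cos_add)
  have s1: "sin (pi * (f - d)) * sin (pi * (g - d)) = (R + cos (p' + \<rho>)) / 2"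
    unfolding sin_sin_pi fg R_def ch by simp
  have s2: "sin (pi * (f - a)) * sin (pi * (g - a)) = (R + cos (p' - \<rho>)) / 2"
    unfolding sin_sin_pi fg R_def ch cos_minus by simp
  have Qr: "Q = cos \<rho>" by (simp only: Q_def \<rho>_def)
  \<comment> \<open>The eight reciprocal Gamma factors of \<open>x1 * x2\<close> pair off into four
    sines. These give two factors conjugate under \<rho> to -\<rho>, so their product depends on
    \<rho> through Q alone.\<close>
  have W: "(R + cos (p' + \<rho>)) * (R + cos (p' - \<rho>)) = W"
  proof -
    have "(R + cos (p' + \<rho>)) * (R + cos (p' - \<rho>)) = R\<^sup>2 + 2 * R * Q * cos p' + (cos p' * cos p') * Q\<^sup>2 - (sin p')\<^sup>2 * (sin \<rho> * sin \<rho>)"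
      unfolding Qr cos_add cos_diff by (simp add: algebra_simps power2_eq_square)
    also have "sin \<rho> * sin \<rho> = 1 - Q\<^sup>2" using cos_cos_eq[of \<rho>] unfolding Qr power2_eq_square by simp
    finally show ?thesis unfolding cos_cos_eq W_def by (simp add: algebra_simps power2_eq_square)
  qed
  have c3: "x1 * x2 = W * (z * z)"
  proof -
    have "x1 * x2 = (rGamma (f - d) * rGamma (1 + d - f)) * (rGamma (g - d) * rGamma (1 + d - g)) * ((rGamma (f - a) * rGamma (1 + a - f)) * (rGamma (g - a) * rGamma (1 + a - g)))"
      by (simp only: x1_def x2_def mult_ac)
    also have "\<dots> = (sin (pi * (f - d)) / pi) * (sin (pi * (g - d)) / pi) * ((sin (pi * (f - a)) / pi) * (sin (pi * (g - a)) / pi))"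
      using refl[of "1 + d - f" "f - d"] refl[of "1 + d - g" "g - d"] refl[of "1 + a - f" "f - a"] refl[of "1 + a - g" "g - a"] by simp
    also have "\<dots> = (sin (pi * (f - d)) * sin (pi * (g - d))) * (sin (pi * (f - a)) * sin (pi * (g - a))) / pi ^ 4"
      by (simp add: eval_nat_numeral)
    also have "\<dots> = ((R + cos (p' + \<rho>)) * (R + cos (p' - \<rho>))) * (z * z)"
      unfolding s1 s2 z_def by (simp add: eval_nat_numeral)
    finally show ?thesis unfolding W .
  qed
  define C where "C = coeff_factor p' q r P Q R h"
  have M: "U * V * cos h + sin r * sin q * W * cos (h - p') = - 4 * (sin p' * C)"
  proof -
    have "U = Q * sin (p' - r) + P * sin p' - R * sin r" by (simp add: U_def)
    hence *: "- 1 / 4 * (U * V * cos h + sin r * sin q * W * cos (h - p')) = sin p' * C"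
      using elimination_identity[of Q p' r P R q h] by (simp only: V_def W_def C_def)
    have "x = - 4 * (- 1 / 4 * x)" for x :: real by simp
    from this[of "U * V * cos h + sin r * sin q * W * cos (h - p')"] show ?thesis unfolding * .
  qed
  have sp: "sin p' \<noteq> 0"
  proof -
    have "\<bar>a - d\<bar> < 1" "a - d \<noteq> 0" using t ne(3) by (simp_all add: p field_simps)
    thus ?thesis unfolding p'_def by (intro sin_pi_nonzero)
  qed
  have E: "4 * (z * z) * (1 / pi) * C * k1 + V * z * q1 * r3 * k3 - sin r * x1 * r2 * q3 * k4 = 0"
    by (rule elimination_step[OF R1 R2 c1 c2 c3 M sp])
  define S where "S = sin (pi * (e - b))"
  have S: "S = pi * (rGamma (e - b) * rGamma (1 + b - e))"
    using refl[of "1 + b - e" "e - b"] by (simp add: S_def)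
  \<comment> \<open>The multiplier pi^5 S normalises the coefficient of \<open>k1\<close>. Written
    by reflection as a product of two reciprocal Gammas, S also completes the two beta factors in
    front of \<open>k4\<close>.\<close>
  have "S * C * k1 + pi ^ 6 * sin (pi * e) * (q3 * x1 * r2 * (rGamma (e - b) * rGamma (1 + b - e))) * k4 + pi ^ 3 * (S * (V / 2)) * (q1 * r3) * k3
      = pi ^ 5 * S * (4 * (z * z) * (1 / pi) * C * k1 + V * z * q1 * r3 * k3 - sin r * x1 * r2 * q3 * k4)"
  proof -
    have A: "pi ^ 5 * (4 * (z * z) * (1 / pi)) = 1" by (simp add: z_def eval_nat_numeral)
    have B: "pi ^ 5 * z = pi ^ 3 / 2" by (simp add: z_def eval_nat_numeral)
    have D: "pi ^ 5 * S = pi ^ 6 * (rGamma (e - b) * rGamma (1 + b - e))" unfolding S by (simp add: eval_nat_numeral)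
    have se: "sin (pi * e) = - sin r" unfolding e1 sh ..
    have "pi ^ 5 * S * (4 * (z * z) * (1 / pi) * C * k1 + V * z * q1 * r3 * k3 - sin r * x1 * r2 * q3 * k4)
      = (pi ^ 5 * (4 * (z * z) * (1 / pi))) * (S * C * k1) + (pi ^ 5 * z) * (S * V * q1 * r3 * k3) - (pi ^ 5 * S) * (sin r * x1 * r2 * q3 * k4)"
      by (simp only: right_diff_distrib distrib_left mult_ac)
    thus ?thesis unfolding A B D se by simp
  qed
  hence "S * C * k1 + pi ^ 6 * sin (pi * e) * (q3 * x1 * r2 * (rGamma (e - b) * rGamma (1 + b - e))) * k4 + pi ^ 3 * (S * (V / 2)) * (q1 * r3) * k3 = 0"
    unfolding E by simp
  thus ?thesis
    unfolding P_def[symmetric] Q_def[symmetric] R_def[symmetric] S_def[symmetric] p'_def[symmetric] q_def[symmetric] r_def[symmetric] h_def[symmetric]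
      C_def[symmetric] k1_def[symmetric] k3_def[symmetric] k4_def[symmetric] V_def[symmetric]
    unfolding q3_def x1_def r2_def q1_def r3_def by (simp only: mult_ac)
qed

text \<open>In the t-coordinates the map is a signed permutation, so \<open>gam_tpoint\<close>
  evaluates gamma at the image directly.\<close>

lemma sigma_tpoint_12_34: "sigma_map (perm_12_34 (tpoint t1 t2 t3 t4 t5 t6)) = tpoint t3 (- t5) (- t6) t2 t4 t1"
  by (simp add: vec_eq_7_iff tpoint_def sigma_map_def perm_12_34_def Let_def, simp add: field_simps)

lemma sigma_tpoint_1342: "sigma_map (perm_1342 (tpoint t1 t2 t3 t4 t5 t6)) = tpoint t3 (- t5) (- t6) t1 t4 t2"
  by (simp add: vec_eq_7_iff tpoint_def sigma_map_def perm_1342_def Let_def, simp add: field_simps)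

definition coeff_poly :: "complex^7 \<Rightarrow> complex" where
  "coeff_poly x = (let a = x$1; b = x$2; c = x$3; d = x$4; e = x$5; f = x$6; g = x$7 in
     sinpi (e - b) * coeff_factor (of_real pi * (a - d)) (of_real pi * (a + d - e)) (of_real pi * (e - 1)) (cospi (b - c)) (cospi (b + c - e))
       (cospi (f - g)) (of_real pi * (e - d) - of_real pi / 2))"

text \<open>Each product of a sine and a cosine here is half a sum or difference of sines of doubled
  arguments.\<close>

lemma sin_cos_sum:
  fixes x y u v :: complex
  shows "sin (x - u) * cos (x + u) + sin (y - v) * cos (y + v) = sin (y + x) * cos (y - x) - cos (u - v) * sin (u + v)"
proof -
  have "sin (x - u) * cos (x + u) = (sin (2 * x) - sin (2 * u)) / 2" for x u :: complex
  proof -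
    have "x - u + (x + u) = 2 * x" "x - u - (x + u) = - (2 * u)" by simp_all
    thus ?thesis unfolding sin_times_cos by (simp only: sin_minus) simp
  qed
  note A = this
  have "sin (y + x) * cos (y - x) = (sin (2 * y) + sin (2 * x)) / 2" for x y :: complex
  proof -
    have "y + x + (y - x) = 2 * y" "y + x - (y - x) = 2 * x" by simp_all
    thus ?thesis unfolding sin_times_cos by (simp only:)
  qed
  note B = this
  have "cos (u - v) * sin (u + v) = (sin (2 * u) + sin (2 * v)) / 2" using B[of u v] by (simp add: mult.commute)
  thus ?thesis unfolding A B by (simp add: add_divide_distrib diff_divide_distrib)
qed

lemma sinpi_sinpi: "sinpi x * sinpi y = (cospi (x - y) - cospi (x + y)) / 2"
  by (simp add: sinpi_def cospi_def sin_times_sin distrib_left right_diff_distrib)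

lemma gam_factor_swapped:
  "gam_factor t3 (- t5) (- t6) t2 t4 t1 = (cospi (t1 - t4) * sinpi (t2 + t3 - (t5 + t6)) + sinpi (t2 + t3) * cospi (t2 - t3) - cospi (t5 - t6) * sinpi (t5 + t6)) / 2"
proof -
  have A: "sinpi (t3 - t5) * cospi (t3 + t5) + sinpi (t2 - t6) * cospi (t2 + t6) = sinpi (t2 + t3) * cospi (t2 - t3) - cospi (t5 - t6) * sinpi (t5 + t6)"
    unfolding sinpi_def cospi_def distrib_left right_diff_distrib by (rule sin_cos_sum)
  have B: "t3 + - t5 + - t6 + t2 = t2 + t3 - (t5 + t6)" "t3 + - t5 = t3 - t5" "t3 - - t5 = t3 + t5" "- t6 + t2 = t2 - t6" "- t6 - t2 = - (t2 + t6)"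
    "t4 - t1 = - (t1 - t4)" by simp_all
  show ?thesis unfolding gam_factor_def B(1) unfolding B(2-) sinpi_1_plus using A by (simp add: add.assoc)
qed

lemma coeff_p0_tpoint:
  assumes "tpoint t1 t2 t3 t4 t5 t6 \<in> VV_generic"
  shows "(let x = tpoint t1 t2 t3 t4 t5 t6; a = x $ 1; b = x $ 2; c = x $ 3; d = x $ 4; e = x $ 5; f = x $ 6; g = x $ 7
          in sinpi (e - b) / sinpi (c - b) *
             (sinpi (f - c) * sinpi (g - c) * sinpi (e - a - c) * gam (sigma_map (perm_12_34 x))
              - sinpi (f - b) * sinpi (g - b) * sinpi (e - a - b) * gam (sigma_map (perm_1342 x)))) = coeff_poly (tpoint t1 t2 t3 t4 t5 t6)"
proof -
  define a b c d e f g where "a = (1 + t1 + t2 + t3 + t4 + t5 + t6) / 2" and "b = (1 + t1 - t2 - t3 + t4 + t5 + t6) / 2"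
     and "c = (1 - t1 + t2 - t3 + t4 + t5 + t6) / 2" and "d = (1 - t1 - t2 + t3 + t4 + t5 + t6) / 2"
     and "e = 1 + t5 + t6" and "f = 1 + t4 + t6" and "g = 1 + t4 + t5"
  note df = a_def b_def c_def d_def e_def f_def g_def
  define H where "H = (t1 + t2 + t5 + t6 - t3 - t4) / 2"
  have s1: "c - b = t2 - t1" "e - a - c = - (t2 + t4)" "e - a - b = - (t1 + t4)" "a - d = t1 + t2" "a + d - e = t3 + t4" "e - 1 = t5 + t6"
    "b - c = t1 - t2" "b + c - e = - (t3 - t4)" "f - g = - (t5 - t6)"
    by (simp_all add: df field_simps)
  have s2: "(f - c) - (g - c) = - (t5 - t6)" "(f - c) + (g - c) = 1 + (t1 - t2 + (t3 + t4))"
     "(f - b) - (g - b) = - (t5 - t6)" "(f - b) + (g - b) = 1 + (t2 - t1 + (t3 + t4))"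
    by (simp_all add: df field_simps)
  have s3: "e - d = 1 / 2 + H" by (simp add: df H_def field_simps)
  have s4: "(1 - t3 + - t5 + - t6 - t2 + t4 + t1) / 2 = 1 / 2 - (H - t1 + t3)" "(1 - t3 + - t5 + - t6 - t1 + t4 + t2) / 2 = 1 / 2 - (H - t2 + t3)"
    by (simp_all add: H_def field_simps)
  have c1: "cospi (1 + z) = - cospi z" for z by (simp add: cospi_def distrib_left cos_add)
  define R where "R = cospi (t5 - t6)"
  have A1: "sinpi (f - c) * sinpi (g - c) = (cospi (t1 - t2 + (t3 + t4)) + R) / 2"
    and A2: "sinpi (f - b) * sinpi (g - b) = (cospi (t2 - t1 + (t3 + t4)) + R) / 2"
    unfolding sinpi_sinpi s2 sinpi_1_plus c1 R_def by (simp_all add: add.commute)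
  have g1: "gam (tpoint t3 (- t5) (- t6) t2 t4 t1) = cospi (H - t1 + t3) * ((cospi (t1 - t4) * sinpi (t2 + t3 - (t5 + t6)) + sinpi (t2 + t3) * cospi (t2 - t3) - R * sinpi (t5 + t6)) / 2)"
    unfolding gam_tpoint s4 sinpi_half_plus gam_factor_swapped R_def ..
  have g2: "gam (tpoint t3 (- t5) (- t6) t1 t4 t2) = cospi (H - t2 + t3) * ((cospi (t2 - t4) * sinpi (t1 + t3 - (t5 + t6)) + sinpi (t1 + t3) * cospi (t1 - t3) - R * sinpi (t5 + t6)) / 2)"
    unfolding gam_tpoint s4 sinpi_half_plus gam_factor_swapped R_def ..
  define C where "C = coeff_factor (of_real pi * (a - d)) (of_real pi * (a + d - e)) (of_real pi * (e - 1)) (cospi (b - c)) (cospi (b + c - e))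
       (cospi (f - g)) (of_real pi * (e - d) - of_real pi / 2)"
  define p :: complex where "p = of_real pi"
  have ph: "p * (1 / 2) + p * H - p / 2 = p * H" by simp
  have HH: "p * H + p * H = p * t1 + p * t2 + p * t5 + p * t6 - p * t3 - p * t4"
    by (simp add: H_def distrib_left[symmetric] right_diff_distrib[symmetric])
  have HH': "p * t5 + p * t6 = p * H + p * H - (p * t1 + p * t2) + (p * t3 + p * t4)" unfolding HH by simp
  have L: "sinpi (t2 - t1) * C =
     - ((cospi (t1 - t2 + (t3 + t4)) + R) / 2) * sinpi (t2 + t4) * cospi (H - t1 + t3) * ((cospi (t1 - t4) * sinpi (t2 + t3 - (t5 + t6)) + sinpi (t2 + t3) * cospi (t2 - t3) - R * sinpi (t5 + t6)) / 2)
    + ((cospi (t2 - t1 + (t3 + t4)) + R) / 2) * sinpi (t1 + t4) * cospi (H - t2 + t3) * ((cospi (t2 - t4) * sinpi (t1 + t3 - (t5 + t6)) + sinpi (t1 + t3) * cospi (t1 - t3) - R * sinpi (t5 + t6)) / 2)"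
    unfolding C_def s1 s3 sinpi_1_plus R_def[symmetric]
    unfolding sinpi_def cospi_def p_def[symmetric] distrib_left right_diff_distrib ph
    by (rule coeff_bracket) (rule refl HH')+
  have nz: "sinpi (t2 - t1) \<noteq> 0"
    using assms unfolding VV_generic_def mem_Collect_eq tpoint_def vector_7_nth s1(1)[unfolded b_def c_def] by simp
  have "sinpi (f - c) * sinpi (g - c) * sinpi (e - a - c) * gam (sigma_map (perm_12_34 (tpoint t1 t2 t3 t4 t5 t6)))
              - sinpi (f - b) * sinpi (g - b) * sinpi (e - a - b) * gam (sigma_map (perm_1342 (tpoint t1 t2 t3 t4 t5 t6))) = sinpi (t2 - t1) * C"
    unfolding sigma_tpoint_12_34 sigma_tpoint_1342 A1 A2 g1 g2 L s1 sinpi_1_plus by (simp add: mult.assoc)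
  hence "sinpi (e - b) / sinpi (c - b) * (sinpi (f - c) * sinpi (g - c) * sinpi (e - a - c) * gam (sigma_map (perm_12_34 (tpoint t1 t2 t3 t4 t5 t6)))
              - sinpi (f - b) * sinpi (g - b) * sinpi (e - a - b) * gam (sigma_map (perm_1342 (tpoint t1 t2 t3 t4 t5 t6)))) = sinpi (e - b) * C"
    using nz unfolding s1(1) by simp
  moreover have x: "tpoint t1 t2 t3 t4 t5 t6 = vector [a, b, c, d, e, f, g]" by (simp only: tpoint_def df)
  ultimately show ?thesis unfolding coeff_poly_def Let_def C_def x vector_7_nth by simp
qed

lemma continuous_on_coeff_poly: "continuous_on A coeff_poly"
  by (auto simp: coeff_poly_def coeff_factor_def Let_def sinpi_def cospi_def intro!: continuous_intros)

lemma coeff_p0_eq: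
  assumes "x \<in> VV"
  shows "coeff_p0 x = coeff_poly x"
  unfolding coeff_p0_def
proof (rule continuous_extension_eq[OF _ continuous_on_coeff_poly assms], goal_cases)
  case (1 y)
  hence "y \<in> VV" by (simp add: VV_generic_def)
  then obtain t1 t2 t3 t4 t5 t6 where tpoint: "y = tpoint t1 t2 t3 t4 t5 t6" using VV_tpoint by blast
  show ?case using coeff_p0_tpoint[OF 1[unfolded tpoint], folded tpoint] unfolding Let_def .
qed

subsection \<open>Analytic continuation\<close>

lemma coeff_factor_of_real: "of_real (coeff_factor p q r P Q R h) = coeff_factor (of_real p) (of_real q) (of_real r) (of_real P) (of_real Q) (of_real R) (of_real h :: complex)"
  by (simp only: coeff_factor_def of_real_add of_real_mult of_real_minus of_real_divide of_real_diff of_real_power sin_of_real[symmetric] cos_of_real[symmetric] of_real_1 of_real_numeral)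

text \<open>The coefficients are entered in their factored entire form, so no removable singularity
  obstructs holomorphy.\<close>

definition relation_lhs :: "complex \<Rightarrow> complex \<Rightarrow> complex \<Rightarrow> complex \<Rightarrow> complex \<Rightarrow> complex \<Rightarrow> complex \<Rightarrow> complex" where
  "relation_lhs a b c d e f g = sinpi (e - b) * coeff_factor (of_real pi * (a - d)) (of_real pi * (a + d - e)) (of_real pi * (e - 1)) (cospi (b - c)) (cospi (b + c - e)) (cospi (f - g))
        (of_real pi * (e - d) - of_real pi / 2) * Kfun a b c d e f g
    + of_real pi ^ 6 * sinpi e * (rGamma a * rGamma (1 + b - e) * rGamma (f - c) * rGamma (f - d) * rGamma (g - c) * rGamma (g - d))
        * (rGamma (1 + a - e) * rGamma (e - b) * rGamma (1 + a - f) * rGamma (1 + a - g) * rGamma (g - b) * rGamma (f - b))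
        * Kfun (e - a) (e - b) (e - c) (e - d) (1 + e - f) (1 + e - g) e
    + of_real pi ^ 3 * (sinpi (e - b) * ((cospi (f - g) * sinpi ((a - d) + (a + d - e)) + cospi (b - c) * sinpi (a - d)
          + cospi (b + c - e) * sinpi (a + d - e)) / 2))
        * (rGamma b * rGamma c * rGamma d * rGamma (e - b) * rGamma (e - c) * rGamma (e - d))
        * Kfun (1 + a - e) (1 + b - e) (1 + c - e) (1 + d - e) (2 - e) (1 + f - e) (1 + g - e)"

lemma Kfun_holomorphic:
  assumes "A holomorphic_on UNIV" "B holomorphic_on UNIV" "C holomorphic_on UNIV" "D holomorphic_on UNIV"
    "E holomorphic_on UNIV" "F holomorphic_on UNIV" "G holomorphic_on UNIV"
    and saal: "\<And>z. E z + F z + G z - A z - B z - C z - D z = 1"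
  shows "(\<lambda>z. Kfun (A z) (B z) (C z) (D z) (E z) (F z) (G z)) holomorphic_on UNIV"
proof -
  have rG: "(\<lambda>z. rGamma (H z)) holomorphic_on UNIV" if "H holomorphic_on UNIV" for H :: "complex \<Rightarrow> complex"
    using that by (rule holomorphic_rGamma')
  have 1: "(\<lambda>z. F43_reg (A z) (B z) (C z) (D z) (E z) (F z) (G z)) holomorphic_on UNIV"
    by (rule F43_reg_holomorphic) (fact assms)+
  have 2: "(\<lambda>z. F43_reg (A z) (1 + A z - E z) (1 + A z - F z) (1 + A z - G z) (1 + A z - B z) (1 + A z - C z) (1 + A z - D z)) holomorphic_on UNIV"
  proof (rule F43_reg_holomorphic)
    fix z
    show "1 + A z - B z + (1 + A z - C z) + (1 + A z - D z) - A z - (1 + A z - E z) - (1 + A z - F z) - (1 + A z - G z) = 1"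
      using saal[of z] by (simp add: algebra_simps)
  qed (intro holomorphic_intros assms)+
  show ?thesis unfolding Kfun_def by (intro holomorphic_intros 1 2 rG assms)
qed

lemma relation_lhs_holomorphic:
  assumes h: "A holomorphic_on UNIV" "B holomorphic_on UNIV" "C holomorphic_on UNIV" "D holomorphic_on UNIV"
    "E holomorphic_on UNIV" "F holomorphic_on UNIV" "G holomorphic_on UNIV"
    and saal: "\<And>z. E z + F z + G z - A z - B z - C z - D z = 1"
  shows "(\<lambda>z. relation_lhs (A z) (B z) (C z) (D z) (E z) (F z) (G z)) holomorphic_on UNIV"
proof -
  have rG: "(\<lambda>z. rGamma (H z)) holomorphic_on UNIV" if "H holomorphic_on UNIV" for H :: "complex \<Rightarrow> complex"
    using that by (rule holomorphic_rGamma')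
  have 1: "(\<lambda>z. Kfun (A z) (B z) (C z) (D z) (E z) (F z) (G z)) holomorphic_on UNIV"
    by (rule Kfun_holomorphic) (fact assms)+
  have 2: "(\<lambda>z. Kfun (E z - A z) (E z - B z) (E z - C z) (E z - D z) (1 + E z - F z) (1 + E z - G z) (E z)) holomorphic_on UNIV"
  proof (rule Kfun_holomorphic)
    fix z
    show "1 + E z - F z + (1 + E z - G z) + E z - (E z - A z) - (E z - B z) - (E z - C z) - (E z - D z) = 1"
      using saal[of z] by (simp add: algebra_simps)
  qed (intro holomorphic_intros assms)+
  have 3: "(\<lambda>z. Kfun (1 + A z - E z) (1 + B z - E z) (1 + C z - E z) (1 + D z - E z) (2 - E z) (1 + F z - E z) (1 + G z - E z)) holomorphic_on UNIV"
  proof (rule Kfun_holomorphic)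
    fix z
    show "2 - E z + (1 + F z - E z) + (1 + G z - E z) - (1 + A z - E z) - (1 + B z - E z) - (1 + C z - E z) - (1 + D z - E z) = 1"
      using saal[of z] by (simp add: algebra_simps)
  qed (intro holomorphic_intros assms)+
  have sc: "(\<lambda>z. sinpi (H z)) holomorphic_on UNIV" "(\<lambda>z. cospi (H z)) holomorphic_on UNIV" if "H holomorphic_on UNIV" for H
    unfolding sinpi_def cospi_def by (intro holomorphic_intros that)+
  have coeff_factor: "(\<lambda>z. coeff_factor (p z) (q z) (r z) (P z) (Q z) (R z) (k z)) holomorphic_on UNIV"
    if "p holomorphic_on UNIV" "q holomorphic_on UNIV" "r holomorphic_on UNIV" "P holomorphic_on UNIV" "Q holomorphic_on UNIV"
      "R holomorphic_on UNIV" "k holomorphic_on UNIV" for p q r P Q R k :: "complex \<Rightarrow> complex"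
    unfolding coeff_factor_def by (intro holomorphic_intros that) simp_all
  show ?thesis unfolding relation_lhs_def
    by (intro holomorphic_on_add holomorphic_on_mult holomorphic_on_diff holomorphic_on_divide holomorphic_on_power holomorphic_on_const 1 2 3 sc rG coeff_factor h) simp_all
qed

text \<open>The identity theorem: a real interval accumulates at its midpoint.\<close>

lemma holomorphic_zero_on_interval:
  fixes f :: "complex \<Rightarrow> complex"
  assumes f: "f holomorphic_on UNIV" and ab: "l < u" and z: "\<And>s. l < s \<Longrightarrow> s < u \<Longrightarrow> f (of_real s) = 0"
  shows "f w = 0"
proof -
  define x where "x = (l + u) / 2"
  have x: "l < x" "x < u" using ab by (simp_all add: x_def)
  have lp: "complex_of_real x islimpt (of_real ` {l<..<u})"
    unfolding islimpt_approachable
  proof (intro allI impI)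
    fix \<epsilon> :: real assume e: "\<epsilon> > 0"
    define s where "s = x + min (\<epsilon> / 2) ((u - x) / 2)"
    have "s < u" "x < s" "s - x < \<epsilon>" using e x by (auto simp: s_def min_def field_simps)
    hence "complex_of_real s \<in> of_real ` {l<..<u}" "complex_of_real s \<noteq> of_real x" "dist (complex_of_real s) (of_real x) < \<epsilon>"
      using x by (auto simp: dist_real_def)
    thus "\<exists>x'\<in>complex_of_real ` {l<..<u}. x' \<noteq> complex_of_real x \<and> dist x' (complex_of_real x) < \<epsilon>" by blast
  qed
  show ?thesis
    by (rule analytic_continuation[OF f _ _ _ _ lp, where w = w]) (use z in auto)
qed

definition relation_t :: "complex \<Rightarrow> complex \<Rightarrow> complex \<Rightarrow> complex \<Rightarrow> complex \<Rightarrow> complex \<Rightarrow> complex" where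
  "relation_t t1 t2 t3 t4 t5 t6 = relation_lhs ((1 + t1 + t2 + t3 + t4 + t5 + t6) / 2) ((1 + t1 - t2 - t3 + t4 + t5 + t6) / 2)
     ((1 - t1 + t2 - t3 + t4 + t5 + t6) / 2) ((1 - t1 - t2 + t3 + t4 + t5 + t6) / 2) (1 + t5 + t6) (1 + t4 + t6) (1 + t4 + t5)"

lemma relation_t_holomorphic:
  assumes "T1 holomorphic_on UNIV" "T2 holomorphic_on UNIV" "T3 holomorphic_on UNIV" "T4 holomorphic_on UNIV"
    "T5 holomorphic_on UNIV" "T6 holomorphic_on UNIV"
  shows "(\<lambda>z. relation_t (T1 z) (T2 z) (T3 z) (T4 z) (T5 z) (T6 z)) holomorphic_on UNIV"
  unfolding relation_t_def
proof (rule relation_lhs_holomorphic)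
  show "1 + T5 z + T6 z + (1 + T4 z + T6 z) + (1 + T4 z + T5 z) - (1 + T1 z + T2 z + T3 z + T4 z + T5 z + T6 z) / 2 - (1 + T1 z - T2 z - T3 z + T4 z + T5 z + T6 z) / 2 -
          (1 - T1 z + T2 z - T3 z + T4 z + T5 z + T6 z) / 2 - (1 - T1 z - T2 z + T3 z + T4 z + T5 z + T6 z) / 2 = 1" for z
    by (simp add: field_simps)
qed (intro holomorphic_on_add holomorphic_on_diff holomorphic_on_divide holomorphic_on_const assms; simp)+

text \<open>Each coordinate in turn is released from its real interval to the whole plane while the
  later ones stay in the box. Points of the box are functions on all of \<open>nat\<close>, so that
  the update \<open>s(i := r)\<close> serves every coordinate alike.\<close>

lemma relation_t_zero:
  fixes lo hi :: "nat \<Rightarrow> real"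
  defines "B \<equiv> {s. \<forall>i. lo i < s i \<and> s i < hi i}"
  assumes box: "\<And>s. s \<in> B \<Longrightarrow> relation_t (of_real (s 1)) (of_real (s 2)) (of_real (s 3)) (of_real (s 4)) (of_real (s 5)) (of_real (s 6)) = 0"
    and lh: "\<And>i. lo i < hi i"
  shows "relation_t z1 z2 z3 z4 z5 z6 = 0"
proof -
  note hol = relation_t_holomorphic holomorphic_on_ident holomorphic_on_const
  have upd: "s(i := r) \<in> B" if "s \<in> B" "lo i < r" "r < hi i" for s i r
    using that by (simp add: B_def)
  have 1: "relation_t z1 (of_real (s 2)) (of_real (s 3)) (of_real (s 4)) (of_real (s 5)) (of_real (s 6)) = 0" if "s \<in> B" for z1 s
    by (rule holomorphic_zero_on_interval[OF _ lh[of 1], where w = z1], intro hol) (use box[OF upd[OF that, where i = 1]] in simp)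
  have 2: "relation_t z1 z2 (of_real (s 3)) (of_real (s 4)) (of_real (s 5)) (of_real (s 6)) = 0" if "s \<in> B" for z1 z2 s
    by (rule holomorphic_zero_on_interval[OF _ lh[of 2], where w = z2], intro hol) (use 1[OF upd[OF that, where i = 2]] in simp)
  have 3: "relation_t z1 z2 z3 (of_real (s 4)) (of_real (s 5)) (of_real (s 6)) = 0" if "s \<in> B" for z1 z2 z3 s
    by (rule holomorphic_zero_on_interval[OF _ lh[of 3], where w = z3], intro hol) (use 2[OF upd[OF that, where i = 3]] in simp)
  have 4: "relation_t z1 z2 z3 z4 (of_real (s 5)) (of_real (s 6)) = 0" if "s \<in> B" for z1 z2 z3 z4 s
    by (rule holomorphic_zero_on_interval[OF _ lh[of 4], where w = z4], intro hol) (use 3[OF upd[OF that, where i = 4]] in simp)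
  have 5: "relation_t z1 z2 z3 z4 z5 (of_real (s 6)) = 0" if "s \<in> B" for z1 z2 z3 z4 z5 s
    by (rule holomorphic_zero_on_interval[OF _ lh[of 5], where w = z5], intro hol) (use 4[OF upd[OF that, where i = 5]] in simp)
  have "(\<lambda>i. (lo i + hi i) / 2) \<in> B" using lh by (simp add: B_def field_simps)
  from 5[OF upd[OF this, where i = 6]] have 6: "relation_t z1 z2 z3 z4 z5 (of_real r) = 0" if "lo 6 < r" "r < hi 6" for r
    using that by simp
  show ?thesis
    by (rule holomorphic_zero_on_interval[OF _ lh[of 6], where w = z6], intro hol) (rule 6)
qed

lemma bij_betw_sigma_map: "bij_betw sigma_map VV VV"
  by (rule bij_betw_byWitness[where f' = "\<lambda>x. sigma_map (sigma_map x)"])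
    (auto simp: sigma_map_cubed intro: sigma_map_in_VV)

lemma relation_t_of_real:
  fixes t1 t2 t3 t4 t5 t6 :: real
  assumes t: "\<bar>t1\<bar> + \<bar>t2\<bar> + \<bar>t3\<bar> + \<bar>t4\<bar> + \<bar>t5\<bar> + \<bar>t6\<bar> < 1" and ne: "t3 \<noteq> t4" "t5 \<noteq> t6" "t1 + t2 \<noteq> 0"
  shows "relation_t (of_real t1) (of_real t2) (of_real t3) (of_real t4) (of_real t5) (of_real t6) = 0"
proof -
  define a b c d e f g where p: "a = (1 + t1 + t2 + t3 + t4 + t5 + t6) / 2" "b = (1 + t1 - t2 - t3 + t4 + t5 + t6) / 2"
     "c = (1 - t1 + t2 - t3 + t4 + t5 + t6) / 2" "d = (1 - t1 - t2 + t3 + t4 + t5 + t6) / 2"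
     "e = 1 + t5 + t6" "f = 1 + t4 + t6" "g = 1 + t4 + t5"
  have s: "e + f + g - a - b - c - d = 1" by (simp add: p field_simps)
  have K: "of_real (KR a b c d e f g) = Kfun (of_real a) (of_real b) (of_real c) (of_real d) (of_real e) (of_real f) (of_real g)"
    "of_real (KR (e - a) (e - b) (e - c) (e - d) (1 + e - f) (1 + e - g) e) = Kfun (of_real (e - a)) (of_real (e - b)) (of_real (e - c)) (of_real (e - d)) (of_real (1 + e - f)) (of_real (1 + e - g)) (of_real e)"
    "of_real (KR (1 + a - e) (1 + b - e) (1 + c - e) (1 + d - e) (2 - e) (1 + f - e) (1 + g - e)) = Kfun (of_real (1 + a - e)) (of_real (1 + b - e)) (of_real (1 + c - e)) (of_real (1 + d - e)) (of_real (2 - e)) (of_real (1 + f - e)) (of_real (1 + g - e))"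
    by (rule Kfun_of_real[symmetric], use s in simp)+
  have "relation_lhs (of_real a) (of_real b) (of_real c) (of_real d) (of_real e) (of_real f) (of_real g) = 0"
    using arg_cong[where f = complex_of_real, OF box_elimination[OF t ne p]]
    unfolding relation_lhs_def sinpi_def cospi_def
    by (simp only: K coeff_factor_of_real of_real_add of_real_mult of_real_diff of_real_minus of_real_divide of_real_power sin_of_real[symmetric] cos_of_real[symmetric]
        rGamma_complex_of_real[symmetric] of_real_1 of_real_0 of_real_numeral distrib_left)
  thus ?thesis unfolding relation_t_def p by simp
qed

text \<open>The intervals (i/50, i/50 + 1/100) are positive and increasing, hence t3 < t4, t5 < t6
  and t1 + t2 > 0. Their upper ends for i = 1, ..., 6 add up to 21/50 + 6/100 < 1.\<close>

lemma relation_t_eq_0: "relation_t t1 t2 t3 t4 t5 t6 = 0"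
proof (rule relation_t_zero[where lo = "\<lambda>i. real i / 50" and hi = "\<lambda>i. real i / 50 + 1 / 100"])
  fix s :: "nat \<Rightarrow> real"
  assume "s \<in> {s. \<forall>i. real i / 50 < s i \<and> s i < real i / 50 + 1 / 100}"
  hence s: "real i / 50 < s i \<and> s i < real i / 50 + 1 / 100" for i by simp
  have "0 < s 1" "0 < s 2" "0 < s 3" "0 < s 4" "0 < s 5" "0 < s 6" "s 1 + s 2 + s 3 + s 4 + s 5 + s 6 < 1" "s 3 < s 4" "s 5 < s 6"
    using s[of 1] s[of 2] s[of 3] s[of 4] s[of 5] s[of 6] by simp_all
  thus "relation_t (of_real (s 1)) (of_real (s 2)) (of_real (s 3)) (of_real (s 4)) (of_real (s 5)) (of_real (s 6)) = 0"
    by (intro relation_t_of_real) simp_all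
qed simp

lemma perm_12_in_VV: "x \<in> VV \<Longrightarrow> perm_12 x \<in> VV"
  by (simp add: VV_def perm_12_def algebra_simps)

text \<open>Reconciles two orderings: \<open>p4\<close> puts \<open>2 - e\<close> last among the
  lower parameters, whereas the integral relation produces it first.\<close>

lemma Kfun_rotate: "Kfun a b c d e f g = Kfun a b c d g e f"
  by (simp add: Kfun_def F43_reg_def mult_ac)

text \<open>Evaluates the maps and beta factors at x, using that the inverse of
  \<open>sigma_map\<close> on \<open>VV\<close> is its square. The six-fold products of reciprocal
  Gammas found by elimination are the values of beta at the two images of
  \<open>perm_12 x\<close>.\<close>

lemma relation_tpoint:
  assumes x: "x = tpoint t1 t2 t3 t4 t5 t6"
  shows "coeff_poly x * K_at p0 x
    + of_real pi ^ 6 * sinpi (x $ 5) * beta x * beta (sigma_map (perm_12 x)) * K_at n4 x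
    + of_real pi ^ 3 * gam x * beta (sigma_map_inv (perm_12 x)) * K_at p4 x = relation_t t1 t2 t3 t4 t5 t6"
proof -
  define a b c d e f g where df: "a = (1 + t1 + t2 + t3 + t4 + t5 + t6) / 2" "b = (1 + t1 - t2 - t3 + t4 + t5 + t6) / 2"
     "c = (1 - t1 + t2 - t3 + t4 + t5 + t6) / 2" "d = (1 - t1 - t2 + t3 + t4 + t5 + t6) / 2"
     "e = 1 + t5 + t6" "f = 1 + t4 + t6" "g = 1 + t4 + t5"
  have x': "x = vector [a, b, c, d, e, f, g]" by (simp only: x tpoint_def df)
  have V: "vector [a, b, c, d, e, f, g] \<in> VV" using tpoint_in_VV[of t1 t2 t3 t4 t5 t6] unfolding x[symmetric] x' .
  hence gg: "g = 1 + a + b + c + d - e - f" by (simp add: VV_def algebra_simps)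
  have s1: "sigma_map (perm_12 (vector [a, b, c, d, e, f, g])) = vector [1 + a - e, a, f - c, g - c, 1 + b + a - e, 1 + a - c, 1 + a + d - e]"
    by (simp only: sigma_map_def perm_12_def Let_def vector_7_nth)
  have z1: "1 + a - (1 + b + a - e) = e - b" "1 + a - c - (f - c) = 1 + a - f" "1 + a - c - (g - c) = 1 + a - g"
    "1 + a + d - e - (f - c) = g - b" "1 + a + d - e - (g - c) = f - b"
    by (simp_all add: gg)
  have b1: "beta (sigma_map (perm_12 (vector [a, b, c, d, e, f, g]))) = rGamma (1 + a - e) * rGamma (e - b) * rGamma (1 + a - f) * rGamma (1 + a - g) * rGamma (g - b) * rGamma (f - b)"
    unfolding s1 beta_def Let_def vector_7_nth z1 ..
  have z2: "1 + (1 + a - e) + a - (1 + b + a - e) = 1 + a - b" "1 + a - (f - c) = 1 + a + c - f" "1 + a + (g - c) - (1 + b + a - e) = 1 + a + d - f"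
    by (simp_all add: gg)
  have s2: "sigma_map_inv (perm_12 (vector [a, b, c, d, e, f, g])) = vector [e - b, a, 1 + a - f, g - b, 1 + a - b, 1 + a + c - f, 1 + a + d - f]"
    unfolding sigma_map_inv_eq[OF perm_12_in_VV[OF V]] s1 unfolding sigma_map_def Let_def vector_7_nth z1 z2 ..
  have z3: "1 + a - (1 + a - b) = b" "1 + a + c - f - (1 + a - f) = c" "1 + a + c - f - (g - b) = e - d" "1 + a + d - f - (1 + a - f) = d"
    "1 + a + d - f - (g - b) = e - c"
    by (simp_all add: gg)
  have b2: "beta (sigma_map_inv (perm_12 (vector [a, b, c, d, e, f, g]))) = rGamma b * rGamma c * rGamma d * rGamma (e - b) * rGamma (e - c) * rGamma (e - d)"
    unfolding s2 beta_def Let_def vector_7_nth z3 by (simp only: mult_ac)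
  have z4: "(1 - t1 + t2 + t3 - t4 + t5 + t6) / 2 = e - b" by (simp add: df field_simps)
  have z5: "a - d = t1 + t2" "a + d - e = t3 + t4" "b - c = t1 - t2" "b + c - e = - (t3 - t4)" "f - g = - (t5 - t6)"
    by (simp_all add: df field_simps)
  have ga: "gam x = sinpi (e - b) * ((cospi (f - g) * sinpi ((a - d) + (a + d - e)) + cospi (b - c) * sinpi (a - d)
          + cospi (b + c - e) * sinpi (a + d - e)) / 2)"
    unfolding x gam_tpoint z4 z5 sinpi_1_plus gam_factor_def by (simp add: mult.commute add.assoc)
  show ?thesis
    unfolding ga unfolding x' b1 b2 K_at_def act_p0 act_n4[OF V] act_p4[OF V]
    unfolding relation_t_def df(1-7)[symmetric] relation_lhs_def beta_def coeff_poly_def Let_def vector_7_nth KK_Kfun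
    unfolding Kfun_rotate[of "1 + a - e" "1 + b - e" "1 + c - e" "1 + d - e" "1 + f - e"]
    by (simp only: mult_ac)
qed

theorem proposition6p7:
  shows "bij_betw sigma_map VV VV
    \<and> continuous_on VV coeff_p0
    \<and> (\<forall>x\<in>VV.
          coeff_p0 x * K_at p0 x
          + of_real pi ^ 6 * sinpi (x$5) * beta x * beta (sigma_map (perm_12 x)) * K_at n4 x
          + of_real pi ^ 3 * gam x * beta (sigma_map_inv (perm_12 x)) * K_at p4 x = 0)
    \<and> {p0, n4, p4} \<subseteq> M_K
    \<and> hamming_type p0 n4 p4 = [2, 4, 6]"
proof (intro conjI ballI)
  show "bij_betw sigma_map VV VV" by (rule bij_betw_sigma_map)
  show "continuous_on VV coeff_p0"
    by (rule continuous_on_eq[OF continuous_on_coeff_poly]) (simp add: coeff_p0_eq)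
  show "{p0, n4, p4} \<subseteq> M_K" by (rule p0_n4_p4_in_M_K)
  show "hamming_type p0 n4 p4 = [2, 4, 6]" by (rule hamming_type_246)
next
  fix x assume x: "x \<in> VV"
  then obtain t1 t2 t3 t4 t5 t6 where tpoint: "x = tpoint t1 t2 t3 t4 t5 t6" using VV_tpoint by blast
  show "coeff_p0 x * K_at p0 x
          + of_real pi ^ 6 * sinpi (x$5) * beta x * beta (sigma_map (perm_12 x)) * K_at n4 x
          + of_real pi ^ 3 * gam x * beta (sigma_map_inv (perm_12 x)) * K_at p4 x = 0"
    unfolding coeff_p0_eq[OF x] relation_tpoint[OF tpoint] by (rule relation_t_eq_0)
qed

end
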